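(* Let $n\ge 1$ and let $p$ be a positive integer. Let $\bar V_p$ be the induced $q(n+1)$-module, $M_p$ its maximal proper submodule and $V_p=\bar V_p/M_p$, as described in the context. The weight vectors $v$ of $\bar V_p$ satisfy the following: (a) if the level of $v$ is greater than $p$, then $v\in M_p$; (b) if the level of $v$ is less than $p$, then $v\notin M_p$ (so $v$ represents a nonzero element of the quotient module $V_p$); (c) if the level of $v$ is equal to $p$, consider its weight $\lambda_m=(0,m_1,\ldots,m_n)$ and put $d_m=\dim(\bar V_p(\lambda_m))$. Then $\dim M_p(\lambda_m)=\dim V_p(\lambda_m)=d_m/2$. Moreover, the vectors $X(p;\boldsymbol{k},\boldsymbol{l})$ of level $p$ with $k_i+l_i=m_i$ ($i=1,\ldots,n$) span $M_p(\lambda_m)$.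
   Context: The Lie superalgebra $G=q(n+1)$ over $\mathbb{C}$ has even basis elements $e_{ij}^{\bar 0}$ and odd basis elements $e_{ij}^{\bar 1}$ ($i,j=0,1,\ldots,n$) with superbracket $[\![ e_{ij}^\sigma, e_{kl}^\theta ]\!] = \delta_{jk} e_{il}^{\sigma+\theta} - (-1)^{\sigma\theta}\delta_{il} e_{kj}^{\sigma+\theta}$, $\sigma,\theta\in\mathbb{Z}_2=\{\bar 0,\bar 1\}$. A $G$-module is a complex vector space $V$ (not required to be $\mathbb{Z}_2$-graded) with a linear map $\rho:G\to \mathrm{End}(V)$ such that $\rho([\![x,y]\!])=\rho(x)\rho(y)-(-1)^{\sigma\theta}\rho(y)\rho(x)$ for $x\in G_\sigma$, $y\in G_\theta$; submodules are likewise not required to be graded. For $i=1,\ldots,n$ put $b_i^+=e_{i0}^{\bar 0}$, $f_i^+=e_{i0}^{\bar 1}$, $b_i^-=e_{0i}^{\bar 0}$, $f_i^-=e_{0i}^{\bar 1}$. Let $q(1)=\mathrm{span}\{e_{00}^{\bar 0},e_{00}^{\bar 1}\}$, $q(n)=\mathrm{span}\{e_{ij}^{\sigma}: 1\le i,j\le n,\ \sigma\in\mathbb{Z}_2\}$, $\tilde G=q(1)\oplus q(n)$, and $P=\mathrm{span}\{b_i^-,f_i^-: 1\le i\le n\}$; $\tilde G+P$ is a subalgebra of $G$. Let $\mathbb{C}v_0$ be the one-dimensional $(\tilde G+P)$-module with $e_{00}^{\bar 0}v_0=p\,v_0$, $e_{00}^{\bar 1}v_0=\sqrt{p}\,v_0$,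 and $xv_0=0$ for $x\in q(n)$ and $x\in P$. Define $\bar V_p=\mathrm{Ind}_{\tilde G+P}^{G}\mathbb{C}v_0 = U(G)\otimes_{U(\tilde G+P)}\mathbb{C}v_0$. A basis of $\bar V_p$ is given by $$|p;\boldsymbol{k},\boldsymbol{l}\rangle=(b_1^+)^{k_1}(f_1^+)^{l_1}\cdots(b_n^+)^{k_n}(f_n^+)^{l_n}v_0,\qquad k_i\in\{0,1,2,\ldots\},\ l_i\in\{0,1\}.$$ Weights are with respect to the commuting elements $e_{00}^{\bar 0},\ldots,e_{nn}^{\bar 0}$: a weight vector of weight $\lambda=(\lambda_0,\ldots,\lambda_n)$ is a nonzero $v$ with $e_{ii}^{\bar 0}v=\lambda_i v$ for all $i$, and $V(\lambda)$ denotes the weight space of $V$. The weights of $\bar V_p$ are exactly the $\lambda_m=(p-\sum_{i=1}^n m_i,m_1,\ldots,m_n)$ with integers $m_i\ge 0$; $|p;\boldsymbol{k},\boldsymbol{l}\rangle$ has weight $\lambda_m$ with $m_i=k_i+l_i$. The level of a weight $\lambda_m$, or of a vector of weight $\lambda_m$, is $\sum_{i=1}^n m_i$. $M_p$ denotes the maximal $G$-submodule of $\bar V_p$ different from $\bar V_p$; thus $v\in M_p$ if and only if $v_0\notin U(G)v$. $V_p=\bar V_p/M_p$ is an irreducible $G$-module. The vectors $X(p;\boldsymbol{k},\boldsymbol{l})$ (which have the same weight as $|p;\boldsymbol{k},\boldsymbol{l}\rangle$) are defined by $$X(p;\boldsymbol{k},\boldsymbol{l}) = (-1)^{l_1+\cdots+l_n}\sqrt{p}\,|p;\boldsymbol{k},\boldsymbol{l}\rangle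 - \sum_{i=1}^n(-1)^{l_1+\cdots+l_i}\,l_i\,|k_i+1,l_i-1\rangle - \sum_{i=1}^n(-1)^{l_1+\cdots+l_i}\,\delta_{l_i,0}\,k_i\,|k_i-1,l_i+1\rangle ,$$ where e.g. $|k_i+1,l_i-1\rangle$ denotes the basis vector obtained from $|p;\boldsymbol{k},\boldsymbol{l}\rangle$ by replacing $k_i$ by $k_i+1$ and $l_i$ by $l_i-1$, all other labels unchanged; terms with out-of-range labels have coefficient zero and are read as zero. *)

theory Defs
  imports
    "HOL-Library.Poly_Mapping"
    "HOL-Library.Z2"
    "HOL-Algebra.QuotRing"
    "Jordan_Normal_Form.VS_Connect"
begin

section \<open>The Lie superalgebra \<open>q(n+1)\<close>\<close>

text \<open>
  Complex vector spaces with a prescribed basis are spaces of finitely supported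
  functions \<^typ>\<open>'a \<Rightarrow>\<^sub>0 complex\<close>; \<open>pm_scale\<close> is their scalar multiplication.
\<close>

definition pm_scale :: "complex \<Rightarrow> ('a \<Rightarrow>\<^sub>0 complex) \<Rightarrow> ('a \<Rightarrow>\<^sub>0 complex)" where
  "pm_scale c = Poly_Mapping.map (\<lambda>z. c * z)"

text \<open>The key \<open>(i, j, \<sigma>)\<close> stands for the basis element with lower indices \<open>i, j\<close> and
  upper index \<open>\<sigma> \<in> \<int>\<^sub>2\<close>.\<close>

type_synonym qelem = "(nat \<times> nat \<times> bit) \<Rightarrow>\<^sub>0 complex"

definition qE :: "nat \<Rightarrow> nat \<Rightarrow> bit \<Rightarrow> qelem" where
  "qE i j s = Poly_Mapping.single (i, j, s) 1"

definition ssign :: "bit \<Rightarrow> bit \<Rightarrow> complex" where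
  "ssign s t = (if s = 1 \<and> t = 1 then - 1 else 1)"

fun basis_bracket :: "nat \<times> nat \<times> bit \<Rightarrow> nat \<times> nat \<times> bit \<Rightarrow> qelem" where
  "basis_bracket (i, j, s) (k, l, t) =
     (if j = k then qE i l (s + t) else 0)
     - pm_scale (ssign s t) (if i = l then qE k j (s + t) else 0)"

definition sbracket :: "qelem \<Rightarrow> qelem \<Rightarrow> qelem" where
  "sbracket x y = (\<Sum>a\<in>Poly_Mapping.keys x. \<Sum>b\<in>Poly_Mapping.keys y.
     pm_scale (Poly_Mapping.lookup x a * Poly_Mapping.lookup y b) (basis_bracket a b))"

definition q_span :: "(nat \<times> nat) set \<Rightarrow> qelem set" where
  "q_span S = {x. \<forall>(i, j, s)\<in>Poly_Mapping.keys x. (i, j) \<in> S}"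

text \<open>\<open>qalg n\<close> is \<open>q(n+1)\<close>; \<open>q_par n\<close> is its subalgebra \<open>q(1) \<oplus> q(n) + P\<close>.\<close>

definition qalg :: "nat \<Rightarrow> qelem set" where
  "qalg n = q_span ({0..n} \<times> {0..n})"

definition q_par :: "nat \<Rightarrow> qelem set" where
  "q_par n = q_span ({(0, 0)} \<union> {1..n} \<times> {1..n} \<union> {0} \<times> {1..n})"

definition homog :: "bit \<Rightarrow> qelem set" where
  "homog s = {x. \<forall>(i, j, t)\<in>Poly_Mapping.keys x. t = s}"


section \<open>Universal enveloping algebras\<close>

text \<open>
  The convolution product of \<^theory>\<open>HOL-Library.Poly_Mapping\<close> over the free monoid
  (written additively) is the product of the free unital algebra.
\<close>

datatype 'a fword = FWord (letters: "'a list")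

instantiation fword :: (type) monoid_add
begin

definition zero_fword :: "'a fword" where
  "0 = FWord []"

definition plus_fword :: "'a fword \<Rightarrow> 'a fword \<Rightarrow> 'a fword" where
  "v + w = FWord (letters v @ letters w)"

instance
  by standard (simp_all add: zero_fword_def plus_fword_def)

end

type_synonym free_elem = "qelem fword \<Rightarrow>\<^sub>0 complex"

definition free_alg :: "qelem set \<Rightarrow> free_elem ring" where
  "free_alg L = class_ring\<lparr>carrier := {f. \<forall>w\<in>Poly_Mapping.keys f. set (letters w) \<subseteq> L}\<rparr>"

definition gen :: "qelem \<Rightarrow> free_elem" where
  "gen x = Poly_Mapping.single (FWord [x]) 1"

text \<open>
  \<open>uea L\<close> is the enveloping algebra of a sub-superalgebra \<open>L\<close>: the tensor algebra of \<open>L\<close>,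
  presented as the free algebra on all elements of \<open>L\<close> modulo linearity, is divided by
  the superbracket relations.
\<close>

definition uea_rels :: "qelem set \<Rightarrow> free_elem set" where
  "uea_rels L =
     {gen (x + y) - gen x - gen y | x y. x \<in> L \<and> y \<in> L}
   \<union> {gen (pm_scale c x) - pm_scale c (gen x) | c x. x \<in> L}
   \<union> {gen x * gen y - pm_scale (ssign s t) (gen y * gen x) - gen (sbracket x y) | x y s t.
        x \<in> L \<inter> homog s \<and> y \<in> L \<inter> homog t}"

definition uea_ideal :: "qelem set \<Rightarrow> free_elem set" where
  "uea_ideal L = genideal (free_alg L) (uea_rels L)"

definition uea :: "qelem set \<Rightarrow> free_elem set ring" where
  "uea L = free_alg L Quot uea_ideal L"

definition uea_of :: "qelem set \<Rightarrow> free_elem \<Rightarrow> free_elem set" where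
  "uea_of L f = uea_ideal L +>\<^bsub>free_alg L\<^esub> f"

definition uea_scale :: "qelem set \<Rightarrow> complex \<Rightarrow> free_elem set \<Rightarrow> free_elem set" where
  "uea_scale L c u = uea_of L (Poly_Mapping.single 0 c) \<otimes>\<^bsub>uea L\<^esub> u"

text \<open>The homomorphism \<open>U(H) \<rightarrow> U(L)\<close> induced by an inclusion \<open>H \<subseteq> L\<close>: it enlarges a coset of
  the ideal of \<open>H\<close> to the coset of the ideal of \<open>L\<close> containing it.\<close>

definition uea_incl :: "qelem set \<Rightarrow> free_elem set \<Rightarrow> free_elem set" where
  "uea_incl L h = uea_ideal L <+>\<^bsub>free_alg L\<^esub> h"

text \<open>A one-dimensional module is given by the scalars \<open>\<chi> x\<close> by which the elements \<open>x\<close> act;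
  \<open>uea_char \<chi>\<close> gives the scalars by which the enveloping algebra acts.\<close>

definition free_char :: "(qelem \<Rightarrow> complex) \<Rightarrow> free_elem \<Rightarrow> complex" where
  "free_char \<chi> f =
     (\<Sum>w\<in>Poly_Mapping.keys f. Poly_Mapping.lookup f w * prod_list (map \<chi> (letters w)))"

definition uea_char :: "(qelem \<Rightarrow> complex) \<Rightarrow> free_elem set \<Rightarrow> complex" where
  "uea_char \<chi> h = the_elem (free_char \<chi> ` h)"


section \<open>Modules\<close>

record 'v qmodule = "(complex, 'v) module" +
  act :: "qelem \<Rightarrow> 'v \<Rightarrow> 'v"

definition is_submodule :: "nat \<Rightarrow> 'v qmodule \<Rightarrow> 'v set \<Rightarrow> bool" where
  "is_submodule n V W \<longleftrightarrow>
     VectorSpace.subspace class_ring W V \<and> (\<forall>x\<in>qalg n. \<forall>w\<in>W. act V x w \<in> W)"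

text \<open>The ring fields \<open>mult\<close> and \<open>one\<close> of a module record carry no information.\<close>

definition quot_module :: "'v qmodule \<Rightarrow> 'v set \<Rightarrow> 'v set qmodule" where
  "quot_module V N =
     \<lparr>carrier = a_rcosets\<^bsub>V\<^esub> N, mult = (\<lambda>_ _. N), one = N, zero = N,
      add = (\<lambda>A B. A <+>\<^bsub>V\<^esub> B),
      smult = (\<lambda>c A. \<Union>v\<in>A. N +>\<^bsub>V\<^esub> (c \<odot>\<^bsub>V\<^esub> v)),
      act = (\<lambda>x A. \<Union>v\<in>A. N +>\<^bsub>V\<^esub> act V x v)\<rparr>"

definition weight_space :: "nat \<Rightarrow> 'v qmodule \<Rightarrow> (nat \<Rightarrow> complex) \<Rightarrow> 'v set" where
  "weight_space n V lam = {v \<in> carrier V. \<forall>i\<le>n. act V (qE i i 0) v = lam i \<odot>\<^bsub>V\<^esub> v}"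

definition weight_vector :: "nat \<Rightarrow> 'v qmodule \<Rightarrow> (nat \<Rightarrow> complex) \<Rightarrow> 'v \<Rightarrow> bool" where
  "weight_vector n V lam v \<longleftrightarrow> v \<in> weight_space n V lam \<and> v \<noteq> \<zero>\<^bsub>V\<^esub>"

definition subdim :: "'v qmodule \<Rightarrow> 'v set \<Rightarrow> nat" where
  "subdim V W = vectorspace.dim class_ring (V\<lparr>carrier := W\<rparr>)"


section \<open>Induction from a one-dimensional module\<close>

text \<open>
  \<open>ind_module L H \<chi>\<close> is \<open>U(L) \<otimes> \<complex>\<close>, the tensor product taken over \<open>U(H)\<close>, where \<open>H\<close> acts
  on \<open>\<complex>\<close> by \<open>\<chi>\<close>: the vector space with basis \<open>U(L) \<times> \<complex>\<close> modulo the bilinearity and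
  balancing relations. \<open>L\<close> acts by left multiplication on \<open>U(L)\<close>.
\<close>

type_synonym pre_ind = "(free_elem set \<times> complex) \<Rightarrow>\<^sub>0 complex"

definition free_tensor :: "qelem set \<Rightarrow> pre_ind qmodule" where
  "free_tensor L =
     \<lparr>carrier = {f. Poly_Mapping.keys f \<subseteq> carrier (uea L) \<times> UNIV},
      mult = (\<lambda>_ _. 0), one = 0, zero = 0, add = (+), smult = pm_scale,
      act = (\<lambda>x f. \<Sum>(u, z)\<in>Poly_Mapping.keys f.
        Poly_Mapping.single (uea_of L (gen x) \<otimes>\<^bsub>uea L\<^esub> u, z) (Poly_Mapping.lookup f (u, z)))\<rparr>"

definition ptensor :: "free_elem set \<Rightarrow> complex \<Rightarrow> pre_ind" where
  "ptensor u z = Poly_Mapping.single (u, z) 1"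

definition tensor_rels :: "qelem set \<Rightarrow> qelem set \<Rightarrow> (qelem \<Rightarrow> complex) \<Rightarrow> pre_ind set" where
  "tensor_rels L H \<chi> =
     {ptensor (u \<oplus>\<^bsub>uea L\<^esub> u') z - ptensor u z - ptensor u' z | u u' z.
        u \<in> carrier (uea L) \<and> u' \<in> carrier (uea L)}
   \<union> {ptensor u (z + z') - ptensor u z - ptensor u z' | u z z'. u \<in> carrier (uea L)}
   \<union> {ptensor (uea_scale L c u) z - pm_scale c (ptensor u z) | c u z. u \<in> carrier (uea L)}
   \<union> {ptensor u (c * z) - pm_scale c (ptensor u z) | c u z. u \<in> carrier (uea L)}
   \<union> {ptensor (u \<otimes>\<^bsub>uea L\<^esub> uea_incl L h) z - ptensor u (uea_char \<chi> h * z) | u h z.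
        u \<in> carrier (uea L) \<and> h \<in> carrier (uea H)}"

definition tensor_kernel :: "qelem set \<Rightarrow> qelem set \<Rightarrow> (qelem \<Rightarrow> complex) \<Rightarrow> pre_ind set" where
  "tensor_kernel L H \<chi> =
     LinearCombinations.module.span class_ring (free_tensor L) (tensor_rels L H \<chi>)"

definition ind_module :: "qelem set \<Rightarrow> qelem set \<Rightarrow> (qelem \<Rightarrow> complex) \<Rightarrow> pre_ind set qmodule" where
  "ind_module L H \<chi> = quot_module (free_tensor L) (tensor_kernel L H \<chi>)"


section \<open>The modules \<open>\<bar>V\<^sub>p\<close>, \<open>M\<^sub>p\<close> and \<open>V\<^sub>p\<close>\<close>

definition chi :: "nat \<Rightarrow> qelem \<Rightarrow> complex" where
  "chi p x = of_nat p * Poly_Mapping.lookup x (0, 0, 0)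
             + complex_of_real (sqrt (real p)) * Poly_Mapping.lookup x (0, 0, 1)"

definition Vbar :: "nat \<Rightarrow> nat \<Rightarrow> pre_ind set qmodule" where
  "Vbar n p = ind_module (qalg n) (q_par n) (chi p)"

definition v0 :: "nat \<Rightarrow> nat \<Rightarrow> pre_ind set" where
  "v0 n p = tensor_kernel (qalg n) (q_par n) (chi p)
              +>\<^bsub>free_tensor (qalg n)\<^esub> ptensor \<one>\<^bsub>uea (qalg n)\<^esub> 1"

text \<open>\<open>GREATEST\<close> refers to set inclusion.\<close>

definition Mp :: "nat \<Rightarrow> nat \<Rightarrow> pre_ind set set" where
  "Mp n p = (GREATEST M. is_submodule n (Vbar n p) M \<and> M \<noteq> carrier (Vbar n p))"

definition Vp :: "nat \<Rightarrow> nat \<Rightarrow> pre_ind set set qmodule" where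
  "Vp n p = quot_module (Vbar n p) (Mp n p)"

text \<open>For the labels \<open>k\<close>, \<open>l\<close> and \<open>m\<close> below only the values at \<open>1, \<dots>, n\<close> matter.\<close>

definition level :: "nat \<Rightarrow> (nat \<Rightarrow> nat) \<Rightarrow> nat" where
  "level n m = (\<Sum>i=1..n. m i)"

definition lambda_wt :: "nat \<Rightarrow> nat \<Rightarrow> (nat \<Rightarrow> nat) \<Rightarrow> nat \<Rightarrow> complex" where
  "lambda_wt n p m i = (if i = 0 then of_nat p - of_nat (level n m) else of_nat (m i))"

text \<open>Here \<open>b\<^sub>i\<^sup>+\<close> is \<open>qE i 0 0\<close> and \<open>f\<^sub>i\<^sup>+\<close> is \<open>qE i 0 1\<close>; the factors with index \<open>1\<close> stand leftmost.\<close>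

definition ket :: "nat \<Rightarrow> nat \<Rightarrow> (nat \<Rightarrow> nat) \<Rightarrow> (nat \<Rightarrow> nat) \<Rightarrow> pre_ind set" where
  "ket n p k l =
     foldr (\<lambda>i v. (act (Vbar n p) (qE i 0 0) ^^ k i) ((act (Vbar n p) (qE i 0 1) ^^ l i) v))
       [1..<Suc n] (v0 n p)"

text \<open>Where truncated subtraction or \<open>l i + 1 > 1\<close> produces an out-of-range label, the
  coefficient in front of it is zero.\<close>

definition Xvec :: "nat \<Rightarrow> nat \<Rightarrow> (nat \<Rightarrow> nat) \<Rightarrow> (nat \<Rightarrow> nat) \<Rightarrow> pre_ind set" where
  "Xvec n p k l =
     (((- 1) ^ (\<Sum>i=1..n. l i) * complex_of_real (sqrt (real p))) \<odot>\<^bsub>Vbar n p\<^esub> ket n p k l)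
     \<ominus>\<^bsub>Vbar n p\<^esub>
     (\<Oplus>\<^bsub>Vbar n p\<^esub> i\<in>{1..n}. ((- 1) ^ (\<Sum>j=1..i. l j) * of_nat (l i))
        \<odot>\<^bsub>Vbar n p\<^esub> ket n p (k(i := k i + 1)) (l(i := l i - 1)))
     \<ominus>\<^bsub>Vbar n p\<^esub>
     (\<Oplus>\<^bsub>Vbar n p\<^esub> i\<in>{1..n}. ((- 1) ^ (\<Sum>j=1..i. l j) * (if l i = 0 then of_nat (k i) else 0))
        \<odot>\<^bsub>Vbar n p\<^esub> ket n p (k(i := k i - 1)) (l(i := l i + 1)))"

end

theory Submission
  imports Defs "HOL-Library.Function_Algebras"
begin

text \<open>
  Identify \<open>|p; k, l\<rangle>\<close> with a monomial in bosonic variables \<open>x\<^sub>i\<close> and fermionic variables \<open>\<xi>\<^sub>i\<close>.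
  Let \<open>H = \<surd>p \<Pi> + (\<Sum>i. x\<^sub>i \<partial>/\<partial>\<xi>\<^sub>i - \<xi>\<^sub>i \<partial>/\<partial>x\<^sub>i)\<close> with \<open>\<Pi>\<close> the parity, so that \<open>H\<^sup>2 = p - E\<close> for the level
  operator \<open>E\<close>. Letting the odd \<open>e\<^sub>0\<^sub>0\<close> act by \<open>H\<close>, the even and odd \<open>e\<^sub>i\<^sub>0\<close> by multiplication with \<open>x\<^sub>i\<close> and \<open>\<xi>\<^sub>i\<close>,
  the even \<open>e\<^sub>0\<^sub>j\<close> by \<open>H (\<partial>/\<partial>x\<^sub>j) H\<close> and the odd one by \<open>- H (\<partial>/\<partial>\<xi>\<^sub>j) H\<close> gives a representation of \<open>q(n+1)\<close>,
  and the induced module is isomorphic to it: commuting a generator past creation operators shows, by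
  induction on the degree, that the linear map sending a monomial to its ordered word is equivariant.

  In this model \<open>X(p; k, l)\<close> is just \<open>H |p; k, l\<rangle>\<close>, and \<open>M\<^sub>p\<close> consists of the \<open>f\<close> that vanish below level \<open>p\<close>
  and for which \<open>H f\<close> vanishes at level \<open>p\<close>. This is a submodule because the \<open>e\<^sub>0\<^sub>j\<close> factor through \<open>H\<close> on
  both sides. If \<open>f\<close> has level \<open>0 < r \<le> p\<close> and \<open>H f \<noteq> 0\<close>, some derivative of \<open>H f\<close> is nonzero, and since \<open>H\<close> is
  invertible below level \<open>p\<close>, some \<open>e\<^sub>0\<^sub>j f\<close> is a nonzero vector of level \<open>r - 1\<close>; so one descends to the
  vacuum. At level \<open>p\<close> we have \<open>H\<^sup>2 = 0\<close>, and \<open>H\<close> is exact by the homotopy \<open>\<Sum>i. \<xi>\<^sub>i \<partial>/\<partial>x\<^sub>i\<close>, whence the halving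
  of dimensions by rank-nullity.
\<close>

section \<open>Fock space\<close>

text \<open>The induced module is defined as a quotient of formal tensors, which gives no basis:
  independence of the kets would be the Poincare-Birkhoff-Witt theorem for \<open>q(n+1)\<close>.
  The Fock representation supplies it. Evaluation on the vacuum is well defined because the brackets
  hold in Fock space, it separates the ordered words, and these words give the inverse map. The
  operators are forced. The superbracket of the odd e00 with itself is twice the even e00, so the
  square of H has to be p - E. The sum of the shifts between bosons and fermions squares to - E;
  adding sqrt p times the parity, which anticommutes with it, contributes p and gives the vacuum the
  eigenvalue sqrt p. The lowering operators are then determined by their brackets with the creation
  operators and by annihilating the vacuum. Its level components are, because the even e00 acts by p
  - E, and the descent to the vacuum uses only these.\<close>

text \<open>A vector \<open>f\<close> has coefficient \<open>f k l\<close> at the basis vector \<open>|p; k, l\<rangle>\<close>. The operators \<open>bcr\<close>, \<open>ban\<close>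
  create and annihilate bosons, \<open>fcr\<close>, \<open>fan\<close> fermions; \<open>e00\<close> is the action of the odd element
  \<open>e\<^sub>0\<^sub>0\<close>.\<close>

type_synonym fock = "(nat \<Rightarrow> nat) \<Rightarrow> (nat \<Rightarrow> bool) \<Rightarrow> complex"

lemma sum_fun_apply: "(\<Sum>i\<in>A. f i) x = (\<Sum>i\<in>A. f i x)"
  by (induction A rule: infinite_finite_induct) auto

lemma bit_cases: fixes s :: bit obtains "s = 0" | "s = 1"
  by (cases s) auto

definition scal :: "complex \<Rightarrow> fock \<Rightarrow> fock" where
  "scal c f = (\<lambda>k l. c * f k l)"

text \<open>The Jordan-Wigner sign: bringing a fermion of index \<open>i\<close> to its place in the
  ordered product passes the occupied ones of smaller index. Index 0 is harmless since admissible
  labels leave it empty. At \<open>Suc n\<close> this is the total parity.\<close>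

definition sgn_upto :: "nat \<Rightarrow> (nat \<Rightarrow> bool) \<Rightarrow> complex" where
  "sgn_upto i l = (\<Prod>j<i. if l j then - 1 else 1)"

text \<open>Operators act on coefficient functions, so labels shift against the effect on basis
  vectors: the coefficient of a raised vector at \<open>k\<close> is the old one at the lowered
  label.\<close>

definition bcr :: "nat \<Rightarrow> fock \<Rightarrow> fock" where
  "bcr i f = (\<lambda>k l. if k i = 0 then 0 else f (k(i := k i - 1)) l)"

definition ban :: "nat \<Rightarrow> fock \<Rightarrow> fock" where
  "ban i f = (\<lambda>k l. of_nat (Suc (k i)) * f (k(i := Suc (k i))) l)"

definition fcr :: "nat \<Rightarrow> fock \<Rightarrow> fock" where
  "fcr i f = (\<lambda>k l. if l i then sgn_upto i l * f k (l(i := False)) else 0)"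

definition fan :: "nat \<Rightarrow> fock \<Rightarrow> fock" where
  "fan i f = (\<lambda>k l. if l i then 0 else sgn_upto i l * f k (l(i := True)))"

definition deg :: "nat \<Rightarrow> (nat \<Rightarrow> nat) \<Rightarrow> (nat \<Rightarrow> bool) \<Rightarrow> nat" where
  "deg n k l = (\<Sum>i=1..n. k i + of_bool (l i))"

definition euler :: "nat \<Rightarrow> fock \<Rightarrow> fock" where
  "euler n f = (\<lambda>k l. of_nat (deg n k l) * f k l)"

definition parity :: "nat \<Rightarrow> fock \<Rightarrow> fock" where
  "parity n f = (\<lambda>k l. sgn_upto (Suc n) l * f k l)"

definition mix :: "nat \<Rightarrow> fock \<Rightarrow> fock" where
  "mix n f = (\<Sum>i=1..n. bcr i (fan i f) - fcr i (ban i f))"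

definition e00 :: "nat \<Rightarrow> nat \<Rightarrow> fock \<Rightarrow> fock" where
  "e00 n p f = scal (complex_of_real (sqrt (real p))) (parity n f) + mix n f"

lemmas fock_defs = scal_def bcr_def ban_def fcr_def fan_def euler_def parity_def

lemma scal_simps:
  "scal c (f + g) = scal c f + scal c g"
  "scal c (f - g) = scal c f - scal c g"
  "scal c (- f) = - scal c f"
  "scal c 0 = 0"
  "scal c (scal d f) = scal (c * d) f"
  "scal 1 f = f"
  "scal 0 f = 0"
  "scal (- c) f = - scal c f"
  by (simp_all add: scal_def fun_eq_iff algebra_simps)

lemma scal_add_left: "scal (c + d) f = scal c f + scal d f"
  by (simp add: scal_def fun_eq_iff algebra_simps)

lemma scal_diff_left: "scal (c - d) f = scal c f - scal d f"
  by (simp add: scal_def fun_eq_iff algebra_simps)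

lemma scal_sum: "scal c (\<Sum>i\<in>A. f i) = (\<Sum>i\<in>A. scal c (f i))"
  using sum_comp_morphism[of "scal c" f A] by (simp add: scal_simps comp_def)

section \<open>Linear operators on coefficient functions\<close>

definition lin :: "(fock \<Rightarrow> fock) \<Rightarrow> bool" where
  "lin T \<longleftrightarrow> (\<forall>f g. T (f + g) = T f + T g) \<and> (\<forall>c f. T (scal c f) = scal c (T f))"

lemma linI:
  assumes "\<And>f g. T (f + g) = T f + T g" "\<And>c f. T (scal c f) = scal c (T f)"
  shows "lin T"
  using assms by (simp add: lin_def)

lemma lin_simps:
  assumes "lin T"
  shows "T (f + g) = T f + T g" "T (scal c f) = scal c (T f)" "T 0 = 0"
    "T (- f) = - T f" "T (f - g) = T f - T g" "T (sum h A) = (\<Sum>i\<in>A. T (h i))"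
proof -
  show ad: "T (f + g) = T f + T g" for f g using assms by (simp add: lin_def)
  show sc: "T (scal c f) = scal c (T f)" for c f using assms by (simp add: lin_def)
  show z: "T 0 = 0" using sc[of 0 0] by (simp add: scal_simps)
  show m: "T (- f) = - T f" for f using sc[of "-1" f] by (simp add: scal_simps)
  show "T (f - g) = T f - T g" using ad[of f "- g"] m[of g] by simp
  show "T (sum h A) = (\<Sum>i\<in>A. T (h i))"
    using sum_comp_morphism[of T h A] by (simp add: z ad comp_def)
qed

lemma lin_basic [simp]: "lin (bcr i)" "lin (ban i)" "lin (fcr i)" "lin (fan i)"
  "lin (euler n)" "lin (parity n)" "lin (scal c)"
  by (rule linI; simp add: fock_defs fun_eq_iff algebra_simps)+

lemma lin_scal: "lin T \<Longrightarrow> lin (\<lambda>f. scal c (T f))"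
  by (simp add: lin_def scal_simps ac_simps)
lemma lin_sum: "(\<And>i. i \<in> A \<Longrightarrow> lin (T i)) \<Longrightarrow> lin (\<lambda>f. \<Sum>i\<in>A. T i f)"
  by (simp add: lin_def sum.distrib scal_sum)

lemma lin_mix [simp]: "lin (mix n)"
  by (rule linI) (simp_all add: mix_def lin_basic[THEN lin_simps(1)] lin_basic[THEN lin_simps(2)]
      sum.distrib[symmetric] scal_sum scal_simps algebra_simps)

lemma lin_e00 [simp]: "lin (e00 n p)"
  unfolding e00_def[abs_def] by (rule linI)
    (simp_all add: lin_simps(1,2)[OF lin_mix] lin_basic[THEN lin_simps(1)] lin_basic[THEN lin_simps(2)]
      scal_simps algebra_simps)

lemmas op_lin = lin_basic[THEN lin_simps(1)] lin_basic[THEN lin_simps(2)] lin_basic[THEN lin_simps(3)]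
  lin_basic[THEN lin_simps(4)] lin_basic[THEN lin_simps(5)]
  lin_simps(1-5)[OF lin_mix] lin_simps(1-5)[OF lin_e00]

lemma sgn_upto_same: "i \<le> j \<Longrightarrow> sgn_upto i (l(j := b)) = sgn_upto i l"
  by (auto simp: sgn_upto_def intro!: prod.cong)

lemma sgn_upto_flip:
  assumes "j < i" "l j \<noteq> b" shows "sgn_upto i (l(j := b)) = - sgn_upto i l"
proof -
  have "sgn_upto i (l(j := b)) = (if b then -1 else 1) * (\<Prod>m\<in>{..<i}-{j}. if l m then - 1 else 1)"
    unfolding sgn_upto_def by (subst prod.remove[of _ j]) (use assms in \<open>auto intro!: prod.cong\<close>)
  moreover have "sgn_upto i l = (if l j then -1 else 1) * (\<Prod>m\<in>{..<i}-{j}. if l m then - 1 else 1)"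
    unfolding sgn_upto_def by (subst prod.remove[of _ j]) (use assms in auto)
  ultimately show ?thesis using assms by auto
qed

lemma sgn_upto_sq [simp]: "sgn_upto i l * sgn_upto i l = 1" "sgn_upto i l * (sgn_upto i l * z) = z"
proof -
  show "sgn_upto i l * sgn_upto i l = 1"
    unfolding sgn_upto_def prod.distrib[symmetric] by (rule prod.neutral) auto
  then show "sgn_upto i l * (sgn_upto i l * z) = z"
    by (metis mult.assoc mult_1)
qed

lemma sgn_upto_nz [simp]: "sgn_upto i l \<noteq> 0"
  by (metis sgn_upto_sq(1) mult_zero_left zero_neq_one)

section \<open>Canonical commutation and anticommutation relations\<close>

lemma bcr_comm: "bcr i (bcr j f) = bcr j (bcr i f)"
  by (cases "i = j") (auto simp: bcr_def fun_eq_iff fun_upd_twist)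
lemma ban_comm: "ban i (ban j f) = ban j (ban i f)"
  by (cases "i = j") (auto simp: ban_def fun_eq_iff fun_upd_twist)
lemma ban_bcr: "ban i (bcr j f) = bcr j (ban i f) + (if i = j then f else 0)"
  by (cases "i = j") (auto simp: ban_def bcr_def fun_eq_iff fun_upd_twist algebra_simps)

lemma fermi_bose_comm:
  "fcr i (bcr j f) = bcr j (fcr i f)" "fan i (bcr j f) = bcr j (fan i f)"
  "ban j (fcr i f) = fcr i (ban j f)" "fan i (ban j f) = ban j (fan i f)"
  by (auto simp: fock_defs fun_eq_iff)

lemma fermi_sq: "fcr i (fcr i f) = 0" "fan i (fan i f) = 0"
  by (auto simp: fock_defs fun_eq_iff)

text \<open>For distinct indices only the sign belonging to the larger index sees the occupation of
  the smaller one change, so the two orders differ by one flip.\<close>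

lemma fcr_anti: "fcr i (fcr j f) = - fcr j (fcr i f)"
proof (cases i j rule: linorder_cases)
  case equal then show ?thesis by (simp add: fermi_sq)
qed (auto simp: fcr_def fun_eq_iff fun_upd_twist sgn_upto_same sgn_upto_flip)
lemma fan_anti: "fan i (fan j f) = - fan j (fan i f)"
proof (cases i j rule: linorder_cases)
  case equal then show ?thesis by (simp add: fermi_sq)
qed (auto simp: fan_def fun_eq_iff fun_upd_twist sgn_upto_same sgn_upto_flip)
lemma fan_fcr: "fan i (fcr j f) = (if i = j then f else 0) - fcr j (fan i f)"
proof (cases i j rule: linorder_cases)
  case equal then show ?thesis
    by (auto simp: fan_def fcr_def fun_eq_iff sgn_upto_same fun_upd_idem)
qed (auto simp: fan_def fcr_def fun_eq_iff fun_upd_twist sgn_upto_same sgn_upto_flip)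

lemma number_op: "bcr i (ban i f) + fcr i (fan i f) = (\<lambda>k l. of_nat (k i + of_bool (l i)) * f k l)"
  by (auto simp: fock_defs fun_eq_iff sgn_upto_same fun_upd_idem algebra_simps)

lemma euler_eq: "euler n f = (\<Sum>i=1..n. bcr i (ban i f) + fcr i (fan i f))"
  unfolding number_op euler_def deg_def
  by (intro ext) (simp only: sum_fun_apply of_nat_sum sum_distrib_right)

lemma deg_upd:
  assumes "i \<in> {1..n}"
  shows "deg n (k(i := a)) l + k i = deg n k l + a"
    "deg n k (l(i := b)) + of_bool (l i) = deg n k l + of_bool b"
  unfolding deg_def using assms by (subst (1 2) sum.remove[of _ i]; simp)+

lemma of_nat_deg_upd:
  assumes "i \<in> {1..n}"
  shows "of_nat (deg n (k(i := a)) l) = (of_nat (deg n k l) + of_nat a - of_nat (k i) :: complex)"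
    "of_nat (deg n k (l(i := b))) = (of_nat (deg n k l) + of_bool b - of_bool (l i) :: complex)"
proof -
  show "of_nat (deg n (k(i := a)) l) = (of_nat (deg n k l) + of_nat a - of_nat (k i) :: complex)"
    using arg_cong[OF deg_upd(1)[OF assms, of k a l], of "of_nat :: _ \<Rightarrow> complex"]
    by (simp add: algebra_simps)
  show "of_nat (deg n k (l(i := b))) = (of_nat (deg n k l) + of_bool b - of_bool (l i) :: complex)"
    using arg_cong[OF deg_upd(2)[OF assms, of k l b], of "of_nat :: _ \<Rightarrow> complex"]
    by (simp add: algebra_simps)
qed

section \<open>Relations of level, parity and H with the variables and derivatives\<close>

lemma euler_comm:
  assumes "i \<in> {1..n}"
  shows "euler n (bcr i f) = bcr i (euler n f) + bcr i f" "euler n (fcr i f) = fcr i (euler n f) + fcr i f"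
    "ban i (euler n f) = euler n (ban i f) + ban i f" "fan i (euler n f) = euler n (fan i f) + fan i f"
  by (auto simp: fock_defs fun_eq_iff algebra_simps of_nat_diff of_nat_deg_upd[OF assms])

lemma parity_comm:
  assumes "i \<in> {1..n}"
  shows "parity n (bcr i f) = bcr i (parity n f)" "parity n (fcr i f) = - fcr i (parity n f)"
    "ban i (parity n f) = parity n (ban i f)" "fan i (parity n f) = - parity n (fan i f)"
  using assms by (auto simp: fock_defs fun_eq_iff sgn_upto_flip)

lemma parity_parity: "parity n (parity n f) = f"
  by (simp add: fock_defs)

text \<open>Moving a single variable or derivative through the sum \<open>mix\<close> disturbs
  exactly one summand; \<open>c\<close> collects the correction.\<close>

lemma sum_delta_add:
  fixes a :: "'a \<Rightarrow> 'b::comm_monoid_add"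
  assumes "finite A" "i \<in> A" "\<And>j. j \<in> A \<Longrightarrow> b j = a j + (if i = j then c else 0)"
  shows "(\<Sum>j\<in>A. b j) = (\<Sum>j\<in>A. a j) + c"
  using assms by (simp add: sum.distrib cong: sum.cong)

lemma mix_comm:
  assumes "i \<in> {1..n}"
  shows "mix n (bcr i f) = bcr i (mix n f) - fcr i f"
    "mix n (fcr i f) = bcr i f - fcr i (mix n f)"
    "ban i (mix n f) = mix n (ban i f) + fan i f"
    "fan i (mix n f) = - mix n (fan i f) - ban i f"
proof -
  have "mix n (bcr i f) = bcr i (mix n f) + (- fcr i f)"
    unfolding mix_def lin_simps(6)[OF lin_basic(1)]
    by (rule sum_delta_add) (use assms in \<open>auto simp: op_lin ban_bcr fermi_bose_comm bcr_comm algebra_simps\<close>)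
  then show "mix n (bcr i f) = bcr i (mix n f) - fcr i f" by simp
  have "mix n (fcr i f) = - fcr i (mix n f) + bcr i f"
    unfolding mix_def lin_simps(6)[OF lin_basic(3)] sum_negf[symmetric]
    by (rule sum_delta_add)
      (use assms in \<open>auto simp: op_lin fan_fcr fermi_bose_comm fcr_anti[of _ i] algebra_simps\<close>)
  then show "mix n (fcr i f) = bcr i f - fcr i (mix n f)" by simp
  show "ban i (mix n f) = mix n (ban i f) + fan i f"
    unfolding mix_def lin_simps(6)[OF lin_basic(2)]
    by (rule sum_delta_add) 
      (use assms in \<open>auto simp: op_lin ban_bcr fermi_bose_comm ban_comm[of i] algebra_simps\<close>)
  have "fan i (mix n f) = - mix n (fan i f) + (- ban i f)"
    unfolding mix_def lin_simps(6)[OF lin_basic(4)] sum_negf[symmetric]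
    by (rule sum_delta_add)
      (use assms in \<open>auto simp: op_lin fan_fcr fermi_bose_comm fan_anti[of i] algebra_simps\<close>)
  then show "fan i (mix n f) = - mix n (fan i f) - ban i f" by simp
qed

lemma half_eq: "f = - f + (g + g) \<Longrightarrow> f = (g :: fock)"
  by (auto simp: fun_eq_iff)

text \<open>Carrying the outer \<open>mix\<close> through the summands of the inner one reproduces
  \<open>- mix n (mix n f)\<close> and subtracts each number operator twice. Halving gives the
  square without a double sum over indices.\<close>

lemma mix_mix: "mix n (mix n f) = - euler n f"
proof (rule half_eq)
  have "mix n (mix n f) = (\<Sum>i=1..n. mix n (bcr i (fan i f)) - mix n (fcr i (ban i f)))"
    unfolding mix_def[of n f] lin_simps(6)[OF lin_mix] by (simp add: op_lin)
  also have "\<dots> = (\<Sum>i=1..n. - (bcr i (fan i (mix n f)) - fcr i (ban i (mix n f)))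
     + (- (bcr i (ban i f) + fcr i (fan i f)) - (bcr i (ban i f) + fcr i (fan i f))))"
    by (rule sum.cong) (auto simp: mix_comm op_lin algebra_simps)
  also have "\<dots> = - mix n (mix n f) + (- euler n f + - euler n f)"
    by (simp add: sum.distrib sum_subtractf sum_negf mix_def[of n "mix n f"] euler_eq sum_distrib_left algebra_simps)
  finally show "mix n (mix n f) = - mix n (mix n f) + (- euler n f + - euler n f)" .
qed

lemma parity_mix: "parity n (mix n f) = - mix n (parity n f)"
  unfolding mix_def lin_simps(6)[OF lin_basic(6)] sum_negf[symmetric]
  by (rule sum.cong) (auto simp: op_lin parity_comm)

text \<open>The parity commutes with bosonic and anticommutes with fermionic operators, so the term
  with sqrt p drops out and the relations of \<open>mix\<close> remain.\<close>

lemma e00_comm: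
  assumes "i \<in> {1..n}"
  shows "e00 n p (bcr i f) = bcr i (e00 n p f) - fcr i f"
    "e00 n p (fcr i f) = bcr i f - fcr i (e00 n p f)"
    "ban i (e00 n p f) = e00 n p (ban i f) + fan i f"
    "fan i (e00 n p f) = - e00 n p (fan i f) - ban i f"
  using assms by (auto simp: e00_def mix_comm parity_comm op_lin scal_simps algebra_simps)

text \<open>Parity and \<open>mix\<close> anticommute, which cancels the cross terms; their squares
  contribute p and - E.\<close>

lemma e00_e00: "e00 n p (e00 n p f) = scal (of_nat p) f - euler n f"
proof -
  have "complex_of_real (sqrt p) * complex_of_real (sqrt p) = of_nat p"
    by (simp flip: of_real_mult)
  then show ?thesis
    by (simp add: e00_def op_lin parity_parity parity_mix mix_mix scal_simps)
qed

text \<open>H commutes with its own square p - E.\<close>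

lemma euler_e00: "euler n (e00 n p f) = e00 n p (euler n f)"
  using e00_e00[of n p "e00 n p f"] arg_cong[OF e00_e00[of n p f], of "e00 n p"]
  by (simp add: op_lin)

section \<open>The action of \<open>q(n+1)\<close> on Fock space\<close>

text \<open>By \<open>e00_comm\<close> the even lowering operator equals
  \<open>(p - E) ban j + e00 fan j\<close>. The form with H on both sides makes the maximal
  submodule visible, and in a product of two lowering operators the inner factors combine to p -
  E.\<close>

definition qop :: "nat \<Rightarrow> nat \<Rightarrow> nat \<Rightarrow> nat \<Rightarrow> bit \<Rightarrow> fock \<Rightarrow> fock" where
  "qop n p i j s f =
    (if j = 0 then
       if i = 0 then if s = 0 then e00 n p (e00 n p f) else e00 n p f
       else if s = 0 then bcr i f else fcr i f
     else
       if i = 0 then if s = 0 then e00 n p (ban j (e00 n p f)) else - e00 n p (fan j (e00 n p f))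
       else if s = 0 then bcr i (ban j f) + fcr i (fan j f) else fcr i (ban j f) + bcr i (fan j f))"

lemma lin_qop [simp]: "lin (qop n p i j s)"
  by (rule linI) (simp_all add: qop_def op_lin scal_simps algebra_simps)

definition qrel :: "nat \<Rightarrow> nat \<Rightarrow> nat \<Rightarrow> nat \<Rightarrow> bit \<Rightarrow> nat \<Rightarrow> nat \<Rightarrow> bit \<Rightarrow> bool" where
  "qrel n p i j s k l t \<longleftrightarrow> (\<forall>f.
     qop n p i j s (qop n p k l t f) - scal (ssign s t) (qop n p k l t (qop n p i j s f))
     = (if j = k then qop n p i l (s + t) f else 0) - scal (ssign s t) (if i = l then qop n p k j (s + t) f else 0))"

lemma ssign_simps [simp]: "ssign 0 t = 1" "ssign t 0 = 1" "ssign 1 1 = -1"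
  by (simp_all add: ssign_def)

lemma ssign_commute: "ssign s t = ssign t s"
  by (auto simp: ssign_def)

text \<open>Super-antisymmetry of the bracket: one check serves both orders of a pair of
  generators.\<close>

lemma qrel_sym:
  assumes "qrel n p i j s k l t" shows "qrel n p k l t i j s"
proof -
  have "qop n p k l t (qop n p i j s f) - scal (ssign s t) (qop n p i j s (qop n p k l t f))
    = (if i = l then qop n p k j (s + t) f else 0) - scal (ssign s t) (if j = k then qop n p i l (s + t) f else 0)" for f
    using assms[unfolded qrel_def, rule_format, of f]
    by (cases s; cases t) (auto simp: scal_simps algebra_simps split: if_splits)
  then show ?thesis by (auto simp: qrel_def ssign_commute add.commute)
qed

text \<open>Creation operators move in front of annihilation operators, which brings both sides of a
  bracket relation to a common form. Signs from exchanging two fermionic operators of the same kind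
  are supplied separately, for the pair at hand.\<close>

lemmas normal_order = qop_def op_lin scal_simps ban_bcr fan_fcr fermi_bose_comm
  bcr_comm ban_comm fermi_sq e00_e00 euler_e00

lemma qrel_raise_raise:
  assumes "i \<in> {1..n}" "k \<in> {1..n}" shows "qrel n p i 0 s k 0 t"
  using assms fcr_anti[of i k]
  by (cases s; cases t) (auto simp: qrel_def normal_order)

lemma qrel_zero_raise:
  assumes "k \<in> {1..n}" shows "qrel n p 0 0 s k 0 t"
  using assms
  by (cases s; cases t) (auto simp: qrel_def normal_order euler_comm e00_comm algebra_simps)

lemma qrel_zero_zero: "qrel n p 0 0 s 0 0 t"
  by (cases s; cases t) (auto simp: qrel_def normal_order algebra_simps)

lemma qrel_level_raise:
  assumes "i \<in> {1..n}" "j \<in> {1..n}" "k \<in> {1..n}" shows "qrel n p i j s k 0 t"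
  using assms fcr_anti[of i k]
  by (cases s; cases t; cases "j = k") (auto simp: qrel_def normal_order algebra_simps)

lemma qrel_level_zero:
  assumes "i \<in> {1..n}" "j \<in> {1..n}" shows "qrel n p i j s 0 0 t"
  using assms
  by (cases s; cases t) (auto simp: qrel_def normal_order e00_comm euler_comm algebra_simps)

lemma qrel_level_level:
  assumes "i \<in> {1..n}" "j \<in> {1..n}" "k \<in> {1..n}" "l \<in> {1..n}" shows "qrel n p i j s k l t"
  using assms fcr_anti[of i k] fan_anti[of j l]
  by (cases s; cases t; cases "j = k"; cases "i = l") (auto simp: qrel_def normal_order algebra_simps)

lemma qrel_lower_raise:
  assumes "j \<in> {1..n}" "k \<in> {1..n}" shows "qrel n p 0 j s k 0 t"
  using assms
  by (cases s; cases t; cases "j = k") (auto simp: qrel_def normal_order e00_comm euler_comm algebra_simps)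

lemma qrel_lower_zero:
  assumes "j \<in> {1..n}" shows "qrel n p 0 j s 0 0 t"
  using assms
  by (cases s; cases t) (auto simp: qrel_def normal_order e00_comm euler_comm algebra_simps)

lemma qrel_lower_level:
  assumes "j \<in> {1..n}" "k \<in> {1..n}" "l \<in> {1..n}" shows "qrel n p 0 j s k l t"
  using assms fan_anti[of j l]
  by (cases s; cases t; cases "j = k") (auto simp: qrel_def normal_order e00_comm euler_comm algebra_simps)

text \<open>The inner factors H meet and give p - E, while the outer ones stay in place. What
  remains is that two derivatives with p - E between them supercommute.\<close>

lemma qrel_lower_lower:
  assumes "i \<in> {1..n}" "j \<in> {1..n}" shows "qrel n p 0 i s 0 j t"
  using assms fan_anti[of i j]
  by (cases s; cases t) (auto simp: qrel_def normal_order euler_comm algebra_simps)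

theorem qop_bracket:
  assumes "i \<le> n" "j \<le> n" "k \<le> n" "l \<le> n" shows "qrel n p i j s k l t"
proof -
  have *: "m = 0 \<or> m \<in> {1..n}" if "m \<le> n" for m using that by auto
  show ?thesis
    using *[OF assms(1)] *[OF assms(2)] *[OF assms(3)] *[OF assms(4)]
    by (elim disjE)
      (simp_all add: qrel_raise_raise qrel_zero_raise qrel_zero_zero qrel_level_raise qrel_level_zero
        qrel_level_level qrel_lower_raise qrel_lower_zero qrel_lower_level qrel_lower_lower
        qrel_sym[OF qrel_zero_raise] qrel_sym[OF qrel_level_raise] qrel_sym[OF qrel_level_zero]
        qrel_sym[OF qrel_lower_raise] qrel_sym[OF qrel_lower_zero] qrel_sym[OF qrel_lower_level])
qed

section \<open>Finitely supported vectors\<close>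

definition fsupp :: "fock \<Rightarrow> ((nat \<Rightarrow> nat) \<times> (nat \<Rightarrow> bool)) set" where
  "fsupp f = {(k, l). f k l \<noteq> 0}"

text \<open>Labels are functions on all natural numbers; vanishing off \<open>{1..n}\<close> makes
  them unique, so that they index a basis.\<close>

definition labels :: "nat \<Rightarrow> ((nat \<Rightarrow> nat) \<times> (nat \<Rightarrow> bool)) set" where
  "labels n = {(k, l). \<forall>i. i \<notin> {1..n} \<longrightarrow> k i = 0 \<and> \<not> l i}"

text \<open>The bracket relations hold for arbitrary coefficient functions. Finite support enters
  with the comparison with the induced module and with the separation of levels.\<close>

definition fockn :: "nat \<Rightarrow> fock set" where
  "fockn n = {f. finite (fsupp f) \<and> fsupp f \<subseteq> labels n}"

lemma focknI_subset:
  assumes "fsupp f \<subseteq> A" "finite A" "A \<subseteq> labels n" shows "f \<in> fockn n"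
  using assms by (auto simp: fockn_def intro: finite_subset)

lemma focknI_image:
  assumes "f \<in> fockn n" "fsupp g \<subseteq> h ` fsupp f" "\<And>z. z \<in> labels n \<Longrightarrow> h z \<in> labels n"
  shows "g \<in> fockn n"
  by (rule focknI_subset[OF assms(2)]) (use assms in \<open>auto simp: fockn_def\<close>)

lemma fockn_zero [simp]: "0 \<in> fockn n"
  by (simp add: fockn_def fsupp_def)

lemma fockn_add [intro]: "f \<in> fockn n \<Longrightarrow> g \<in> fockn n \<Longrightarrow> f + g \<in> fockn n"
  by (rule focknI_subset[of _ "fsupp f \<union> fsupp g"]) (auto simp: fockn_def fsupp_def)

lemma fockn_scal [intro]: "f \<in> fockn n \<Longrightarrow> scal c f \<in> fockn n"
  by (rule focknI_subset[of _ "fsupp f"]) (auto simp: fockn_def fsupp_def scal_def)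

lemma fockn_uminus [intro]: "f \<in> fockn n \<Longrightarrow> - f \<in> fockn n"
  by (rule focknI_subset[of _ "fsupp f"]) (auto simp: fockn_def fsupp_def)

lemma fockn_diff [intro]: "f \<in> fockn n \<Longrightarrow> g \<in> fockn n \<Longrightarrow> f - g \<in> fockn n"
  using fockn_add[of f n "- g"] by auto

lemma fockn_sum [intro]: "(\<And>i. i \<in> A \<Longrightarrow> f i \<in> fockn n) \<Longrightarrow> sum f A \<in> fockn n"
  by (induction A rule: infinite_finite_induct) (simp_all add: fockn_add del: plus_fun_apply zero_fun_apply)

lemma fockn_bcr: assumes "f \<in> fockn n" "i \<in> {1..n}" shows "bcr i f \<in> fockn n"
proof (rule focknI_image[OF assms(1), of _ "\<lambda>(k, l). (k(i := Suc (k i)), l)"])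
  show "fsupp (bcr i f) \<subseteq> (\<lambda>(k, l). (k(i := Suc (k i)), l)) ` fsupp f"
  proof clarify
    fix k l assume "(k, l) \<in> fsupp (bcr i f)"
    then have "k i \<noteq> 0" "(k(i := k i - 1), l) \<in> fsupp f" by (auto simp: fsupp_def bcr_def split: if_splits)
    then show "(k, l) \<in> (\<lambda>(k, l). (k(i := Suc (k i)), l)) ` fsupp f"
      by (intro image_eqI[of _ _ "(k(i := k i - 1), l)"]) auto
  qed
qed (use assms in \<open>auto simp: labels_def\<close>)

lemma fockn_ban: assumes "f \<in> fockn n" shows "ban i f \<in> fockn n"
proof (rule focknI_image[OF assms(1), of _ "\<lambda>(k, l). (k(i := k i - 1), l)"])
  show "fsupp (ban i f) \<subseteq> (\<lambda>(k, l). (k(i := k i - 1), l)) ` fsupp f"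
  proof clarify
    fix k l assume "(k, l) \<in> fsupp (ban i f)"
    then have "(k(i := Suc (k i)), l) \<in> fsupp f" by (auto simp: fsupp_def ban_def split: if_splits)
    then show "(k, l) \<in> (\<lambda>(k, l). (k(i := k i - 1), l)) ` fsupp f"
      by (intro image_eqI[of _ _ "(k(i := Suc (k i)), l)"]) auto
  qed
qed (auto simp: labels_def)

lemma fockn_fcr: assumes "f \<in> fockn n" "i \<in> {1..n}" shows "fcr i f \<in> fockn n"
proof (rule focknI_image[OF assms(1), of _ "\<lambda>(k, l). (k, l(i := True))"])
  show "fsupp (fcr i f) \<subseteq> (\<lambda>(k, l). (k, l(i := True))) ` fsupp f"
  proof clarify
    fix k l assume "(k, l) \<in> fsupp (fcr i f)"
    then have "l i" "(k, l(i := False)) \<in> fsupp f" by (auto simp: fsupp_def fcr_def split: if_splits)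
    then show "(k, l) \<in> (\<lambda>(k, l). (k, l(i := True))) ` fsupp f"
      by (intro image_eqI[of _ _ "(k, l(i := False))"]) (auto simp: fun_upd_idem)
  qed
qed (use assms in \<open>auto simp: labels_def\<close>)

lemma fockn_fan: assumes "f \<in> fockn n" shows "fan i f \<in> fockn n"
proof (rule focknI_image[OF assms(1), of _ "\<lambda>(k, l). (k, l(i := False))"])
  show "fsupp (fan i f) \<subseteq> (\<lambda>(k, l). (k, l(i := False))) ` fsupp f"
  proof clarify
    fix k l assume "(k, l) \<in> fsupp (fan i f)"
    then have "\<not> l i" "(k, l(i := True)) \<in> fsupp f" by (auto simp: fsupp_def fan_def split: if_splits)
    then show "(k, l) \<in> (\<lambda>(k, l). (k, l(i := False))) ` fsupp f"
      by (intro image_eqI[of _ _ "(k, l(i := True))"]) (auto simp: fun_upd_idem)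
  qed
qed (auto simp: labels_def split: if_splits)

lemma fockn_parity: "f \<in> fockn n \<Longrightarrow> parity n f \<in> fockn n"
  by (rule focknI_subset[of _ "fsupp f"]) (auto simp: fockn_def fsupp_def parity_def)

lemma fockn_e00: "f \<in> fockn n \<Longrightarrow> e00 n p f \<in> fockn n"
  unfolding e00_def mix_def
  by (intro fockn_add fockn_scal fockn_parity fockn_sum fockn_diff fockn_bcr fockn_fcr fockn_ban fockn_fan)

lemma fockn_qop: "f \<in> fockn n \<Longrightarrow> i \<le> n \<Longrightarrow> j \<le> n \<Longrightarrow> qop n p i j s f \<in> fockn n"
  unfolding qop_def
  by (auto intro!: fockn_add fockn_e00 fockn_bcr fockn_fcr fockn_ban fockn_fan fockn_uminus)

section \<open>Monomials and the vacuum\<close>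

definition fmon :: "(nat \<Rightarrow> nat) \<Rightarrow> (nat \<Rightarrow> bool) \<Rightarrow> fock" where
  "fmon k l = (\<lambda>k' l'. if k' = k \<and> l' = l then 1 else 0)"

definition vac :: fock where
  "vac = fmon (\<lambda>_. 0) (\<lambda>_. False)"

lemma sgn_upto_cong: "(\<And>j. j < i \<Longrightarrow> l j = l' j) \<Longrightarrow> sgn_upto i l = sgn_upto i l'"
  unfolding sgn_upto_def by (rule prod.cong) auto

lemma bcr_mon: "bcr i (fmon k l) = fmon (k(i := Suc (k i))) l"
  by (auto simp: bcr_def fmon_def fun_eq_iff)

lemma ban_mon: "ban i (fmon k l) = scal (of_nat (k i)) (fmon (k(i := k i - 1)) l)"
  by (auto simp: ban_def fmon_def scal_def fun_eq_iff)

lemma fcr_mon: "fcr i (fmon k l) = (if l i then 0 else scal (sgn_upto i l) (fmon k (l(i := True))))"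
  by (auto simp: fcr_def fmon_def scal_def fun_eq_iff intro!: sgn_upto_cong)

lemma fan_mon: "fan i (fmon k l) = (if l i then scal (sgn_upto i l) (fmon k (l(i := False))) else 0)"
  by (auto simp: fan_def fmon_def scal_def fun_eq_iff intro!: sgn_upto_cong)

lemma fock_expand:
  assumes "finite A" "fsupp f \<subseteq> A"
  shows "f = (\<Sum>(k, l)\<in>A. scal (f k l) (fmon k l))"
proof (intro ext)
  fix k l
  have "(\<Sum>(k', l')\<in>A. scal (f k' l') (fmon k' l')) k l = (\<Sum>z\<in>A. if z = (k, l) then f k l else 0)"
    unfolding sum_fun_apply by (rule sum.cong) (auto simp: scal_def fmon_def split: if_splits)
  also have "\<dots> = f k l" using assms by (auto simp: fsupp_def)
  finally show "f k l = (\<Sum>(k', l')\<in>A. scal (f k' l') (fmon k' l')) k l" by simp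
qed

lemma fmon_fockn: "(k, l) \<in> labels n \<Longrightarrow> fmon k l \<in> fockn n"
  by (rule focknI_subset[of _ "{(k, l)}"]) (auto simp: fsupp_def fmon_def)

lemma vac_fockn [simp]: "vac \<in> fockn n"
  unfolding vac_def by (rule fmon_fockn) (simp add: labels_def)

lemma fockn_lin_induct [consumes 1, case_names zero add scal fmon]:
  assumes "f \<in> fockn n"
    and zero: "P 0"
    and add: "\<And>f g. f \<in> fockn n \<Longrightarrow> g \<in> fockn n \<Longrightarrow> P f \<Longrightarrow> P g \<Longrightarrow> P (f + g)"
    and scal: "\<And>c f. f \<in> fockn n \<Longrightarrow> P f \<Longrightarrow> P (scal c f)"
    and fmon: "\<And>k l. (k, l) \<in> labels n \<Longrightarrow> P (fmon k l)"
  shows "P f"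
proof -
  have f: "finite (fsupp f)" "fsupp f \<subseteq> labels n" using assms(1) by (auto simp: fockn_def)
  have "P (\<Sum>(k, l)\<in>A. scal (f k l) (fmon k l)) \<and> (\<Sum>(k, l)\<in>A. scal (f k l) (fmon k l)) \<in> fockn n"
    if "finite A" "A \<subseteq> labels n" for A
    using that
  proof (induction A rule: finite_induct)
    case (insert z A)
    obtain k l where z: "z = (k, l)" by force
    have "P (scal (f k l) (fmon k l))" "scal (f k l) (fmon k l) \<in> fockn n"
      using insert z by (auto intro!: scal fmon fmon_fockn fockn_scal)
    with insert z show ?case by (auto simp del: plus_fun_apply intro!: add)
  qed (auto simp: zero)
  from this[OF f] fock_expand[OF f(1) subset_refl] show ?thesis by simp
qed

text \<open>Up to a sign, a monomial of positive degree is a creation operator applied to one of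
  smaller degree. This form suits properties that pass through creation operators, such as
  equivariance and membership in a submodule.\<close>

lemma fockn_induct [consumes 1, case_names vac zero add scal bcr fcr]:
  assumes "f \<in> fockn n" and vac: "P vac"
    and zero: "P 0"
    and add: "\<And>f g. f \<in> fockn n \<Longrightarrow> g \<in> fockn n \<Longrightarrow> P f \<Longrightarrow> P g \<Longrightarrow> P (f + g)"
    and scal: "\<And>c f. f \<in> fockn n \<Longrightarrow> P f \<Longrightarrow> P (scal c f)"
    and bcr: "\<And>i f. i \<in> {1..n} \<Longrightarrow> f \<in> fockn n \<Longrightarrow> P f \<Longrightarrow> P (bcr i f)"
    and fcr: "\<And>i f. i \<in> {1..n} \<Longrightarrow> f \<in> fockn n \<Longrightarrow> P f \<Longrightarrow> P (fcr i f)"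
  shows "P f"
proof -
  have fmon: "P (fmon k l)" if "(k, l) \<in> labels n" for k l
    using that
  proof (induction "deg n k l" arbitrary: k l)
    case 0
    then have "k i = 0 \<and> \<not> l i" for i
      by (cases "i \<in> {1..n}") (auto simp: deg_def labels_def)
    then have "k = (\<lambda>_. 0)" "l = (\<lambda>_. False)" by auto
    then show ?case using vac by (simp add: vac_def)
  next
    case (Suc d)
    have "\<exists>i\<in>{1..n}. k i + of_bool (l i) \<noteq> 0"
    proof (rule ccontr)
      assume "\<not> ?thesis"
      then have "deg n k l = 0" unfolding deg_def by (intro sum.neutral) auto
      with Suc show False by simp
    qed
    then obtain i where i: "i \<in> {1..n}" "k i \<noteq> 0 \<or> l i" by auto
    show ?case
    proof (cases "k i = 0")
      case False
      let ?k = "k(i := k i - 1)"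
      have "deg n ?k l = d" using deg_upd(1)[OF i(1), of k "k i - 1" l] False Suc.hyps(2) by auto
      moreover have L: "(?k, l) \<in> labels n" using Suc.prems by (auto simp: labels_def)
      ultimately have "P (bcr i (fmon ?k l))"
        using Suc.hyps(1)[of ?k l] by (intro bcr i fmon_fockn) auto
      then show ?thesis using False by (simp add: bcr_mon)
    next
      case True
      then have li: "l i" using i by simp
      let ?l = "l(i := False)"
      have "deg n k ?l = d" using deg_upd(2)[OF i(1), of k l False] li Suc.hyps(2) by auto
      moreover have L: "(k, ?l) \<in> labels n" using Suc.prems by (auto simp: labels_def)
      \<comment> \<open>The sign produced by \<open>fcr\<close> is its own inverse, so scaling by it
        restores the monomial.\<close>
      ultimately have "P (scal (sgn_upto i l) (fcr i (fmon k ?l)))"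
        using Suc.hyps(1)[of k ?l] by (intro scal fcr fockn_fcr i fmon_fockn) auto
      then show ?thesis using li by (simp add: fcr_mon scal_simps sgn_upto_same fun_upd_idem)
    qed
  qed
  show ?thesis
    by (rule fockn_lin_induct[where P = P, OF assms(1) zero add scal fmon])
qed

lemma e00_vac: "e00 n p vac = scal (complex_of_real (sqrt (real p))) vac"
proof -
  have "parity n vac = vac" by (auto simp: parity_def vac_def fmon_def fun_eq_iff sgn_upto_def)
  moreover have "mix n vac = 0"
    unfolding mix_def by (rule sum.neutral) (simp add: vac_def ban_mon fan_mon scal_simps op_lin)
  ultimately show ?thesis by (simp add: e00_def)
qed

lemma annihilate_vac: "ban i vac = 0" "fan i vac = 0" "euler n vac = 0"
  by (auto simp: vac_def ban_mon fan_mon scal_simps) (auto simp: euler_def fmon_def deg_def fun_eq_iff)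

text \<open>H only scales the vacuum, so the inner H of a lowering operator leaves a vacuum for the
  derivative to kill.\<close>

lemma qop_vac:
  assumes "(i, j) \<in> {(0, 0)} \<union> {1..n} \<times> {1..n} \<union> {0} \<times> {1..n}"
  shows "qop n p i j s vac = scal (if (i, j) = (0, 0) then
    if s = 0 then of_nat p else complex_of_real (sqrt (real p)) else 0) vac"
  using assms
  by (auto simp: qop_def e00_vac annihilate_vac op_lin scal_simps simp flip: of_real_mult)

section \<open>The maximal submodule\<close>

definition maxsub :: "nat \<Rightarrow> nat \<Rightarrow> fock set" where
  "maxsub n p = {f \<in> fockn n. \<forall>k l. (deg n k l < p \<longrightarrow> f k l = 0) \<and> (deg n k l = p \<longrightarrow> e00 n p f k l = 0)}"

section \<open>Operators that depend on the weight only\<close>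

definition wt :: "(nat \<Rightarrow> nat) \<Rightarrow> (nat \<Rightarrow> bool) \<Rightarrow> nat \<Rightarrow> nat" where
  "wt k l = (\<lambda>i. k i + of_bool (l i))"

text \<open>These diagonal operators include the projections onto weight components and onto level
  components. H commutes with all of them, because its off-diagonal part trades a boson for a
  fermion of the same index or conversely.\<close>

definition wmul :: "((nat \<Rightarrow> nat) \<Rightarrow> complex) \<Rightarrow> fock \<Rightarrow> fock" where
  "wmul \<phi> f = (\<lambda>k l. \<phi> (wt k l) * f k l)"

lemma lin_wmul [simp]: "lin (wmul \<phi>)"
  by (rule linI) (simp_all add: wmul_def scal_def fun_eq_iff algebra_simps)

lemma wmul_bcr_fan: "bcr i (fan i (wmul \<phi> f)) = wmul \<phi> (bcr i (fan i f))"
proof -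
  have "wt (k(i := k i - Suc 0)) (l(i := True)) = wt k l" if "k i > 0" "\<not> l i" for k l
    using that by (auto simp: wt_def)
  then show ?thesis
    by (intro ext) (simp add: bcr_def fan_def wmul_def)
qed

lemma wmul_fcr_ban: "fcr i (ban i (wmul \<phi> f)) = wmul \<phi> (fcr i (ban i f))"
proof -
  have "wt (k(i := Suc (k i))) (l(i := False)) = wt k l" if "l i" for k l
    using that by (auto simp: wt_def)
  then show ?thesis
    by (intro ext) (simp add: fcr_def ban_def wmul_def)
qed

lemma wmul_e00: "e00 n p (wmul \<phi> f) = wmul \<phi> (e00 n p f)"
proof -
  have "parity n (wmul \<phi> f) = wmul \<phi> (parity n f)"
    by (simp add: parity_def wmul_def fun_eq_iff)
  moreover have "mix n (wmul \<phi> f) = wmul \<phi> (mix n f)"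
    unfolding mix_def lin_simps(6)[OF lin_wmul]
    by (simp add: wmul_bcr_fan wmul_fcr_ban lin_simps(5)[OF lin_wmul])
  ultimately show ?thesis by (simp add: e00_def lin_simps[OF lin_wmul])
qed

lemma fockn_wmul: "f \<in> fockn n \<Longrightarrow> wmul \<phi> f \<in> fockn n"
  by (rule focknI_subset[of _ "fsupp f"]) (auto simp: fockn_def fsupp_def wmul_def)

lemma level_wt: "level n (wt k l) = deg n k l"
  by (simp add: level_def deg_def wt_def)

lemma e00_vanish:
  assumes "\<And>k l. deg n k l = r \<Longrightarrow> f k l = 0" "deg n k l = r"
  shows "e00 n p f k l = 0"
proof -
  \<comment> \<open>The projection that discards level \<open>r\<close> fixes \<open>f\<close> and
    commutes with H, hence fixes \<open>e00 n p f\<close> as well.\<close>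
  let ?\<phi> = "\<lambda>w. of_bool (level n w \<noteq> r)"
  have "wmul ?\<phi> f = f" using assms(1) by (auto simp: wmul_def level_wt fun_eq_iff)
  then have "e00 n p f k l = wmul ?\<phi> (e00 n p f) k l" by (metis wmul_e00)
  also have "\<dots> = 0" using assms(2) by (simp add: wmul_def level_wt)
  finally show ?thesis .
qed

text \<open>H preserves levels, so the vanishing of \<open>f\<close> below level p passes to
  \<open>e00 n p f\<close> and joins the condition at level p.\<close>

lemma mem_maxsub_iff:
  "f \<in> maxsub n p \<longleftrightarrow> f \<in> fockn n \<and> (\<forall>k l. deg n k l < p \<longrightarrow> f k l = 0) \<and>
     (\<forall>k l. deg n k l \<le> p \<longrightarrow> e00 n p f k l = 0)"
proof -
  have "e00 n p f k l = 0" if "\<forall>k l. deg n k l < p \<longrightarrow> f k l = 0" "deg n k l < p" for k l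
    by (rule e00_vanish[of n "deg n k l"]) (use that in auto)
  then show ?thesis by (auto simp: maxsub_def le_less)
qed

lemma deg_shift:
  assumes "i \<in> {1..n}"
  shows "k i > 0 \<Longrightarrow> deg n (k(i := k i - Suc 0)) l = deg n k l - 1"
    "k i > 0 \<Longrightarrow> 0 < deg n k l"
    "deg n (k(i := Suc (k i))) l = Suc (deg n k l)"
    "l i \<Longrightarrow> deg n k (l(i := False)) = deg n k l - 1"
    "l i \<Longrightarrow> 0 < deg n k l"
    "\<not> l i \<Longrightarrow> deg n k (l(i := True)) = Suc (deg n k l)"
  using deg_upd(1)[OF assms, of k "k i - 1" l] deg_upd(1)[OF assms, of k 0 l] 
    deg_upd(1)[OF assms, of k "Suc (k i)" l]
    deg_upd(2)[OF assms, of k l False] deg_upd(2)[OF assms, of k l True] by auto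

lemma maxsub_lin:
  "0 \<in> maxsub n p" "f \<in> maxsub n p \<Longrightarrow> g \<in> maxsub n p \<Longrightarrow> f + g \<in> maxsub n p"
  "f \<in> maxsub n p \<Longrightarrow> scal c f \<in> maxsub n p" "f \<in> maxsub n p \<Longrightarrow> - f \<in> maxsub n p"
     apply (auto simp: maxsub_def op_lin)
  apply (auto simp: scal_def)
  done

lemma maxsub_qop:
  assumes f: "f \<in> maxsub n p" and ij: "i \<le> n" "j \<le> n"
  shows "qop n p i j s f \<in> maxsub n p"
proof -
  have F: "f \<in> fockn n" "\<And>k l. deg n k l < p \<Longrightarrow> f k l = 0"
    "\<And>k l. deg n k l \<le> p \<Longrightarrow> e00 n p f k l = 0"
    using f by (auto simp: mem_maxsub_iff)
  consider "i = 0" "j = 0" | "i \<in> {1..n}" "j = 0" | "i = 0" "j \<in> {1..n}" | "i \<in> {1..n}" "j \<in> {1..n}"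
    using ij by force
  then show ?thesis
  proof cases
    case 1
    have E: "e00 n p g \<in> maxsub n p" if "g \<in> maxsub n p" for g
      using that
      by (auto simp: mem_maxsub_iff fockn_e00 e00_e00) (auto simp: scal_def euler_def le_less)
    then show ?thesis using 1 f by (auto simp: qop_def)
  next
    case 2
    \<comment> \<open>At level p the vector \<open>e00\<close> of a raised vector involves
      \<open>f\<close> and \<open>e00 n p f\<close> only at level p - 1, where both vanish.\<close>
    have "bcr i f \<in> maxsub n p" "fcr i f \<in> maxsub n p"
      using 2 F by (auto simp: maxsub_def fockn_bcr fockn_fcr e00_comm)
        (auto simp: bcr_def fcr_def deg_shift)
    then show ?thesis using 2 by (simp add: qop_def)
  next
    case 3
    \<comment> \<open>An image under H meets the condition at level p automatically, since there the
      square of H multiplies by p - p. So \<open>g\<close> only has to vanish below p, and a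
      derivative of \<open>e00 n p f\<close> does, because \<open>e00 n p f\<close> vanishes up to
      level p.\<close>
    have *: "e00 n p g \<in> maxsub n p" if "g \<in> fockn n" "\<And>k l. deg n k l < p \<Longrightarrow> g k l = 0" for g
    proof -
      have "e00 n p g k l = 0" if "deg n k l < p" for k l
        by (rule e00_vanish[of n "deg n k l"]) (use that \<open>\<And>k l. deg n k l < p \<Longrightarrow> g k l = 0\<close> in auto)
      then show ?thesis
        using that by (auto simp: maxsub_def fockn_e00 e00_e00) (auto simp: scal_def euler_def)
    qed
    have "e00 n p (ban j (e00 n p f)) \<in> maxsub n p" "e00 n p (fan j (e00 n p f)) \<in> maxsub n p"
      using 3 F by (auto intro!: * fockn_ban fockn_fan fockn_e00) (auto simp: ban_def fan_def deg_shift)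
    then show ?thesis using 3 by (simp add: qop_def maxsub_lin)
  next
    case 4
    have Z: "bcr i (ban j g) k l = 0" "bcr i (fan j g) k l = 0" "fcr i (ban j g) k l = 0" "fcr i (fan j g) k l = 0"
      if "\<And>k l. deg n k l = r \<Longrightarrow> g k l = 0" "deg n k l = r" for g k l r
    proof -
      have "g (k(i := k i - 1, j := Suc ((k(i := k i - 1)) j))) l = 0" if "k i > 0"
        using deg_shift(3)[OF 4(2), of "k(i := k i - 1)" l] deg_shift(1,2)[OF 4(1), of k l] that
          \<open>deg n k l = r\<close> by (intro \<open>\<And>k l. deg n k l = r \<Longrightarrow> g k l = 0\<close>) simp
      then show "bcr i (ban j g) k l = 0" by (simp add: bcr_def ban_def)
      show "bcr i (fan j g) k l = 0" "fcr i (ban j g) k l = 0" "fcr i (fan j g) k l = 0"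
        using that 4 by (auto simp: bcr_def ban_def fcr_def fan_def deg_shift fun_upd_idem)
    qed
    \<comment> \<open>Generators with both indices positive supercommute with the odd e00, so the
      condition on \<open>e00 n p f\<close> is carried along.\<close>
    have C: "e00 n p (qop n p i j s f) = scal (ssign 1 s) (qop n p i j s (e00 n p f))"
      using qop_bracket[of 0 n 0 i j p 1 s, unfolded qrel_def, rule_format, of f] ij 4
      by (auto simp: qop_def scal_simps)
    have "qop n p i j s f k l = 0" if "deg n k l < p" for k l
      using that 4 F(2) by (auto simp: qop_def Z[of "deg n k l"])
    moreover have "qop n p i j s (e00 n p f) k l = 0" if "deg n k l = p" for k l
      using that 4 F(3) by (auto simp: qop_def Z[of "deg n k l"])
    ultimately show ?thesis
      using F(1) ij by (auto simp: maxsub_def fockn_qop C) (auto simp: scal_def)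
  qed
qed

lemma vac_not_maxsub: "p \<ge> 1 \<Longrightarrow> vac \<notin> maxsub n p"
  by (auto simp: maxsub_def vac_def fmon_def deg_def intro!: exI[of _ "\<lambda>_. 0"] exI[of _ "\<lambda>_. False"])

section \<open>Submodules of Fock space and the descent to the vacuum\<close>

locale fock_submodule =
  fixes n p :: nat and M :: "fock set"
  assumes M_sub: "M \<subseteq> fockn n"
    and M_zero: "0 \<in> M"
    and M_add: "f \<in> M \<Longrightarrow> g \<in> M \<Longrightarrow> f + g \<in> M"
    and M_scal: "f \<in> M \<Longrightarrow> scal c f \<in> M"
    and M_qop: "f \<in> M \<Longrightarrow> i \<le> n \<Longrightarrow> j \<le> n \<Longrightarrow> qop n p i j s f \<in> M"
begin

lemma M_uminus: "f \<in> M \<Longrightarrow> - f \<in> M"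
  using M_scal[of f "- 1"] by (simp add: scal_simps)

lemma M_euler: assumes "f \<in> M" shows "euler n f \<in> M"
proof -
  have "scal (of_nat p) f + - qop n p 0 0 0 f \<in> M"
    using assms by (intro M_add M_scal M_uminus M_qop) auto
  then show ?thesis by (simp add: qop_def e00_e00)
qed

lemma M_euler_prod:
  assumes "f \<in> M" "finite S"
  shows "(\<lambda>k l. (\<Prod>s\<in>S. of_nat (deg n k l) - of_nat s) * f k l) \<in> M"
  using assms(2)
proof (induction S rule: finite_induct)
  case empty
  then show ?case using assms by simp
next
  case (insert s S)
  let ?g = "\<lambda>k l. (\<Prod>s\<in>S. of_nat (deg n k l) - of_nat s) * f k l"
  have "euler n ?g + - scal (of_nat s) ?g \<in> M"
    using insert.IH by (intro M_add M_euler M_uminus M_scal)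
  also have "euler n ?g + - scal (of_nat s) ?g
      = (\<lambda>k l. (\<Prod>s\<in>insert s S. of_nat (deg n k l) - of_nat s) * f k l)"
    using insert by (simp add: euler_def scal_def fun_eq_iff algebra_simps)
  finally show ?case .
qed

text \<open>Lagrange interpolation in E: finite support leaves finitely many other levels, and the
  product of the factors E - s over them kills these levels and scales level \<open>r\<close> by a
  nonzero constant.\<close>

lemma M_component:
  assumes "f \<in> M" shows "(\<lambda>k l. of_bool (deg n k l = r) * f k l) \<in> M"
proof -
  define S where "S = (\<lambda>(k, l). deg n k l) ` fsupp f - {r}"
  have fin: "finite S" using assms M_sub by (auto simp: S_def fockn_def)
  define c :: complex where "c = (\<Prod>s\<in>S. of_nat r - of_nat s)"
  have c: "c \<noteq> 0" using fin by (auto simp: c_def S_def)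
  have *: "(\<Prod>s\<in>S. of_nat (deg n k l) - of_nat s) * f k l = c * (of_bool (deg n k l = r) * f k l)" for k l
  proof (cases "deg n k l = r \<or> f k l = 0")
    case False
    then have "deg n k l \<in> S" by (force simp: S_def fsupp_def)
    then have "(\<Prod>s\<in>S. of_nat (deg n k l) - of_nat s :: complex) = 0" using fin by auto
    with False show ?thesis by simp
  qed (auto simp: c_def)
  have "scal c (\<lambda>k l. of_bool (deg n k l = r) * f k l) \<in> M"
    using M_euler_prod[OF assms fin] by (simp only: * scal_def)
  from M_scal[OF this, of "1 / c"] c show ?thesis by (simp add: scal_simps)
qed

lemma descend:
  assumes "f \<in> M" "euler n f = scal (of_nat r) f" "r \<le> p" "e00 n p f \<noteq> 0"
  shows "vac \<in> M"
  using assms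
proof (induction r arbitrary: f)
  case 0
  have F: "f \<in> fockn n" using 0 M_sub by auto
  have *: "f k l = f (\<lambda>_. 0) (\<lambda>_. False) * vac k l" for k l
  proof (cases "f k l = 0")
    case True
    then show ?thesis by (auto simp: vac_def fmon_def)
  next
    case False
    from 0 have "deg n k l = 0"
      using False by (auto simp: euler_def scal_def fun_eq_iff)
    moreover have "(k, l) \<in> labels n" using F False by (auto simp: fockn_def fsupp_def)
    ultimately have "k i = 0 \<and> \<not> l i" for i
      by (cases "i \<in> {1..n}") (auto simp: deg_def labels_def)
    then have "k = (\<lambda>_. 0)" "l = (\<lambda>_. False)" by auto
    then show ?thesis by (simp add: vac_def fmon_def)
  qed
  have f: "f = scal (f (\<lambda>_. 0) (\<lambda>_. False)) vac" (is "_ = scal ?c _")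
    unfolding scal_def by (intro ext) (rule *)
  have "?c \<noteq> 0" using \<open>e00 n p f \<noteq> 0\<close> f by (metis scal_simps(7) lin_simps(3)[OF lin_e00])
  moreover have "scal (1 / ?c) (scal ?c vac) \<in> M" using M_scal[OF 0(1)] f by metis
  ultimately show ?case by (simp add: scal_simps)
next
  case (Suc r)
  define g where "g = e00 n p f"
  have eg: "euler n g = scal (of_nat (Suc r)) g"
    using Suc.prems(2) by (simp add: g_def euler_e00 op_lin)
  \<comment> \<open>By Euler's formula a vector of positive level whose derivatives all vanish is
    zero.\<close>
  have "\<exists>i\<in>{1..n}. ban i g \<noteq> 0 \<or> fan i g \<noteq> 0"
  proof (rule ccontr)
    assume "\<not> ?thesis"
    then have "euler n g = 0" unfolding euler_eq by (intro sum.neutral) (auto simp: op_lin)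
    with eg have "scal (1 / of_nat (Suc r)) (scal (of_nat (Suc r)) g) = 0" by (simp add: scal_simps)
    then have "g = 0" unfolding scal_simps by (simp add: scal_simps del: of_nat_Suc)
    with Suc.prems g_def show False by simp
  qed
  then obtain i where i: "i \<in> {1..n}" "ban i g \<noteq> 0 \<or> fan i g \<noteq> 0" by blast
  \<comment> \<open>A lowering operator yields, up to sign, \<open>e00 n p h\<close> with
    \<open>h\<close> a derivative of \<open>g\<close>. Another H turns this into (p - r)
    \<open>h\<close>, which is nonzero since r < p, so the induction hypothesis applies.\<close>
  have step: "vac \<in> M" if h: "h \<noteq> 0" "e00 n p h \<in> M" "euler n h = scal (of_nat r) h" for h
  proof (rule Suc.IH[OF h(2)])
    show "euler n (e00 n p h) = scal (of_nat r) (e00 n p h)"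
      using h(3) by (simp add: euler_e00 op_lin)
    show "r \<le> p" using Suc.prems by simp
    have "e00 n p (e00 n p h) = scal (of_nat p - of_nat r) h"
      using h(3) by (simp add: e00_e00 scal_diff_left)
    moreover have "of_nat p - of_nat r \<noteq> (0 :: complex)" using Suc.prems(3) by auto
    ultimately show "e00 n p (e00 n p h) \<noteq> 0"
      using h(1) by (auto simp: scal_def fun_eq_iff)
  qed
  have lower: "euler n h = scal (of_nat r) h" if "euler n h + h = scal (of_nat (Suc r)) h" for h
    using that by (simp add: scal_def fun_eq_iff algebra_simps)
  from i(2) show ?case
  proof
    assume "ban i g \<noteq> 0"
    then show ?thesis
    proof (rule step)
      show "e00 n p (ban i g) \<in> M"
        using M_qop[OF Suc.prems(1), of 0 i 0] i by (auto simp: qop_def g_def)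
      show "euler n (ban i g) = scal (of_nat r) (ban i g)"
        by (rule lower) (simp add: euler_comm(3)[OF i(1), symmetric] eg op_lin)
    qed
  next
    assume "fan i g \<noteq> 0"
    then show ?thesis
    proof (rule step)
      show "e00 n p (fan i g) \<in> M"
        using M_uminus[OF M_qop[OF Suc.prems(1), of 0 i 1]] i by (auto simp: qop_def g_def)
      show "euler n (fan i g) = scal (of_nat r) (fan i g)"
        by (rule lower) (simp add: euler_comm(4)[OF i(1), symmetric] eg op_lin)
    qed
  qed
qed

theorem maxsub_greatest:
  assumes "vac \<notin> M" shows "M \<subseteq> maxsub n p"
proof
  fix f assume f: "f \<in> M"
  show "f \<in> maxsub n p"
  proof (rule ccontr)
    assume "f \<notin> maxsub n p"
    then obtain k l where kl: "deg n k l < p \<and> f k l \<noteq> 0 \<or> deg n k l = p \<and> e00 n p f k l \<noteq> 0"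
      using f M_sub by (auto simp: maxsub_def)
    \<comment> \<open>Cutting \<open>f\<close> down to the level where the condition fails keeps the
      failure, since H commutes with the cut.\<close>
    define r where "r = deg n k l"
    let ?\<phi> = "\<lambda>w. of_bool (level n w = r)"
    define g where "g = wmul ?\<phi> f"
    have g: "g = (\<lambda>k l. of_bool (deg n k l = r) * f k l)"
      by (simp add: g_def wmul_def level_wt)
    have "g \<in> M" unfolding g by (rule M_component[OF f])
    moreover have eg: "euler n g = scal (of_nat r) g"
      by (auto simp: g euler_def scal_def fun_eq_iff)
    moreover have "r \<le> p" using kl by (auto simp: r_def)
    moreover have "e00 n p g \<noteq> 0"
      using kl
    proof
      assume a: "deg n k l < p \<and> f k l \<noteq> 0"
      have "e00 n p (e00 n p g) k l = (of_nat p - of_nat r) * f k l"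
        using eg by (simp add: e00_e00) (simp add: scal_def g r_def algebra_simps)
      also have "\<dots> \<noteq> 0" using a by (auto simp: r_def)
      finally show ?thesis by (auto simp: op_lin)
    next
      assume a: "deg n k l = p \<and> e00 n p f k l \<noteq> 0"
      have "e00 n p g k l = e00 n p f k l"
        unfolding g_def wmul_e00 by (simp add: wmul_def level_wt r_def)
      with a show ?thesis by auto
    qed
    ultimately show False using descend assms by blast
  qed
qed

end

section \<open>Weight spaces\<close>

definition wspace :: "nat \<Rightarrow> (nat \<Rightarrow> nat) \<Rightarrow> fock set" where
  "wspace n m = {f \<in> fockn n. \<forall>k l. f k l \<noteq> 0 \<longrightarrow> (\<forall>i\<in>{1..n}. wt k l i = m i)}"

lemma qop_diag:
  "i \<in> {1..n} \<Longrightarrow> qop n p i i 0 f k l = of_nat (wt k l i) * f k l"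
  "qop n p 0 0 0 f k l = (of_nat p - of_nat (deg n k l)) * f k l"
proof -
  assume "i \<in> {1..n}"
  then have "qop n p i i 0 f = bcr i (ban i f) + fcr i (fan i f)" by (simp add: qop_def)
  then show "qop n p i i 0 f k l = of_nat (wt k l i) * f k l"
    unfolding number_op by (simp add: wt_def)
qed (simp add: qop_def e00_e00, simp add: scal_def euler_def algebra_simps)

lemma wspace_deg: "f \<in> wspace n m \<Longrightarrow> f k l \<noteq> 0 \<Longrightarrow> deg n k l = level n m"
  unfolding level_wt[symmetric] level_def by (rule sum.cong) (auto simp: wspace_def)

lemma wspace_iff:
  "f \<in> wspace n m \<longleftrightarrow> f \<in> fockn n \<and> (\<forall>i\<le>n. qop n p i i 0 f = scal (lambda_wt n p m i) f)"
proof safe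
  assume f: "f \<in> wspace n m"
  then show "f \<in> fockn n" by (simp add: wspace_def)
  fix i assume i: "i \<le> n"
  show "qop n p i i 0 f = scal (lambda_wt n p m i) f"
  proof (intro ext)
    fix k l
    show "qop n p i i 0 f k l = scal (lambda_wt n p m i) f k l"
    proof (cases "f k l = 0")
      case True
      then show ?thesis using i by (cases "i = 0") (auto simp: qop_diag scal_def)
    next
      case False
      then show ?thesis using wspace_deg[OF f False] f i
        by (cases "i = 0") (auto simp: qop_diag scal_def lambda_wt_def wspace_def)
    qed
  qed
next
  assume f: "f \<in> fockn n" and w: "\<forall>i\<le>n. qop n p i i 0 f = scal (lambda_wt n p m i) f"
  show "f \<in> wspace n m"
    unfolding wspace_def
  proof safe
    fix k l i assume "f k l \<noteq> 0" and i: "i \<in> {1..n}"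
    then have "of_nat (wt k l i) = (of_nat (m i) :: complex)"
      using w[rule_format, of i] qop_diag(1)[OF i, of p f k l] by (auto simp: scal_def lambda_wt_def)
    then show "wt k l i = m i" using of_nat_eq_iff by blast
  qed (rule f)
qed

text \<open>Seen as the fixed space of a weight projection, a weight space is preserved by operators
  that commute with \<open>wmul\<close>.\<close>

lemma wspace_iff_wmul:
  "f \<in> wspace n m \<longleftrightarrow> f \<in> fockn n \<and> wmul (\<lambda>w. of_bool (\<forall>i\<in>{1..n}. w i = m i)) f = f"
  by (auto simp: wspace_def wmul_def fun_eq_iff)

lemma e00_wspace: "f \<in> wspace n m \<Longrightarrow> e00 n p f \<in> wspace n m"
  by (simp add: wspace_iff_wmul fockn_e00 wmul_e00[symmetric])

text \<open>\<open>htp n\<close> is a contracting homotopy: \<open>e00\<close> squares to zero at level \<open>p\<close>, and its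
  anticommutator with \<open>htp n\<close> is multiplication by the level.\<close>

definition htp :: "nat \<Rightarrow> fock \<Rightarrow> fock" where
  "htp n f = (\<Sum>i=1..n. fcr i (ban i f))"

text \<open>H passes \<open>fcr i\<close> with correction \<open>bcr i\<close>, and
  \<open>ban i\<close> passes H with correction \<open>fan i\<close>. The corrections form the two
  number operators of index \<open>i\<close>; everything else cancels.\<close>

lemma e00_htp: "e00 n p (htp n f) + htp n (e00 n p f) = euler n f"
  unfolding htp_def euler_eq lin_simps(6)[OF lin_e00] sum.distrib[symmetric]
  by (rule sum.cong) (auto simp: e00_comm op_lin)

lemma htp_wspace: "f \<in> wspace n m \<Longrightarrow> htp n f \<in> wspace n m"
  unfolding wspace_iff_wmul htp_def lin_simps(6)[OF lin_wmul] wmul_fcr_ban[symmetric]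
  by (auto intro!: fockn_sum fockn_fcr fockn_ban)

lemma wspace_zero: "f \<in> wspace n m \<Longrightarrow> level n m \<noteq> deg n k l \<Longrightarrow> f k l = 0"
  using wspace_deg by metis

lemma wspace_scal: "f \<in> wspace n m \<Longrightarrow> scal c f \<in> wspace n m"
  by (auto simp: wspace_def fockn_scal) (auto simp: scal_def)

lemma wspace_maxsub_gt: "f \<in> wspace n m \<Longrightarrow> level n m > p \<Longrightarrow> f \<in> maxsub n p"
  using e00_wspace[of f n m p] wspace_zero[of f n m] wspace_zero[of "e00 n p f" n m]
  by (auto simp: maxsub_def) (simp add: wspace_def)

lemma wspace_maxsub_lt:
  assumes "f \<in> wspace n m" "level n m < p" "f \<in> maxsub n p" shows "f = 0"
proof (intro ext)
  fix k l show "f k l = 0 k l"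
    using assms wspace_deg[OF assms(1), of k l] by (cases "f k l = 0") (auto simp: maxsub_def)
qed

lemma wspace_maxsub_eq:
  assumes "level n m = p"
  shows "f \<in> wspace n m \<Longrightarrow> f \<in> maxsub n p \<longleftrightarrow> e00 n p f = 0"
proof -
  assume f: "f \<in> wspace n m"
  show "f \<in> maxsub n p \<longleftrightarrow> e00 n p f = 0"
  proof
    assume "f \<in> maxsub n p"
    then show "e00 n p f = 0"
      using wspace_zero[OF e00_wspace[OF f]] assms by (auto simp: maxsub_def fun_eq_iff) metis
  next
    assume "e00 n p f = 0"
    then show "f \<in> maxsub n p"
      using wspace_zero[OF f] f assms by (auto simp: maxsub_def wspace_def)
  qed
qed

lemma wspace_euler: "f \<in> wspace n m \<Longrightarrow> euler n f = scal (of_nat (level n m)) f"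
  using wspace_zero[of f n m] by (auto simp: euler_def scal_def fun_eq_iff)

lemma maxsub_wspace_image:
  assumes "level n m = p" "p \<ge> 1"
  shows "maxsub n p \<inter> wspace n m = e00 n p ` wspace n m"
proof safe
  fix f assume f: "f \<in> maxsub n p" "f \<in> wspace n m"
  then have "e00 n p f = 0" using wspace_maxsub_eq assms by blast
  then have "e00 n p (htp n f) = scal (of_nat p) f"
    using e00_htp[of n p f] wspace_euler[OF f(2)] assms by (simp add: htp_def op_lin)
  \<comment> \<open>On this weight space E is the constant p, and p is positive: the homotopy
    divided by p supplies the preimage.\<close>
  then have "f = e00 n p (scal (1 / of_nat p) (htp n f))"
    using assms by (simp add: op_lin scal_simps)
  then show "f \<in> e00 n p ` wspace n m" using wspace_scal htp_wspace f by blast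
next
  fix f assume f: "f \<in> wspace n m"
  then show "e00 n p f \<in> wspace n m" by (rule e00_wspace)
  have "e00 n p (e00 n p f) = 0"
    using wspace_euler[OF f] assms by (simp add: e00_e00)
  then show "e00 n p f \<in> maxsub n p"
    using wspace_maxsub_eq[OF assms(1) e00_wspace[OF f]] by simp
qed

text \<open>This lifts weight vectors of the quotient to weight vectors. An even e_ii minus its
  eigenvalue multiplies weight w by w_i - m_i, and \<open>maxsub\<close> is tested label by label,
  so a violation can only sit at weight \<open>m\<close>; the projection to that weight keeps all of
  them.\<close>

lemma wspace_quotient:
  assumes f: "f \<in> fockn n" and m: "level n m = p"
    and w: "\<And>i. i \<le> n \<Longrightarrow> qop n p i i 0 f - scal (lambda_wt n p m i) f \<in> maxsub n p"
  obtains g where "g \<in> wspace n m" "f - g \<in> maxsub n p"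
proof
  let ?\<phi> = "\<lambda>w. of_bool (\<forall>i\<in>{1..n}. w i = m i)"
  show "wmul ?\<phi> f \<in> wspace n m"
    using f fockn_wmul[OF f] by (auto simp: wspace_def wmul_def)
  have wt: "wt k l i = m i" if "i \<in> {1..n}"
    "deg n k l < p \<and> f k l \<noteq> 0 \<or> deg n k l = p \<and> e00 n p f k l \<noteq> 0" for i k l
  proof -
    let ?\<psi> = "\<lambda>w. of_nat (w i) - of_nat (m i) :: complex"
    have "qop n p i i 0 f - scal (lambda_wt n p m i) f = wmul ?\<psi> f"
      using that(1) by (auto simp: fun_eq_iff qop_diag scal_def lambda_wt_def wmul_def algebra_simps)
    then have "wmul ?\<psi> f \<in> maxsub n p" using w[of i] that(1) by simp
    then have "?\<psi> (wt k l) = 0"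
      using that(2) by (auto simp: maxsub_def wmul_e00) (auto simp: wmul_def)
    then show ?thesis by (metis eq_iff_diff_eq_0 of_nat_eq_iff)
  qed
  show "f - wmul ?\<phi> f \<in> maxsub n p"
    unfolding maxsub_def
  proof (safe)
    show "f - wmul ?\<phi> f \<in> fockn n" using f by (intro fockn_diff fockn_wmul)
    fix k l
    { assume d: "deg n k l < p"
      show "(f - wmul ?\<phi> f) k l = 0"
      proof (cases "f k l = 0")
        case False
        then have "\<forall>i\<in>{1..n}. wt k l i = m i" using wt d by blast
        then show ?thesis by (simp add: wmul_def)
      qed (simp add: wmul_def) }
    assume d: "p = deg n k l"
    show "e00 n (deg n k l) (f - wmul ?\<phi> f) k l = 0"
    proof (cases "e00 n p f k l = 0")
      case False
      then have "\<forall>i\<in>{1..n}. wt k l i = m i" using wt d by blast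
      then show ?thesis by (simp add: op_lin wmul_e00) (simp add: wmul_def)
    qed (simp add: op_lin wmul_e00, simp add: wmul_def d)
  qed
qed

section \<open>Linear extension\<close>

lemma lookup_pm_scale [simp]: "Poly_Mapping.lookup (pm_scale c x) a = c * Poly_Mapping.lookup x a"
  by (simp add: pm_scale_def Poly_Mapping.map.rep_eq when_def)

lemma pm_scale_simps:
  "pm_scale c (x + y) = pm_scale c x + pm_scale c y"
  "pm_scale c (x - y) = pm_scale c x - pm_scale c y"
  "pm_scale c (- x) = - pm_scale c x"
  "pm_scale c 0 = 0"
  "pm_scale c (pm_scale d x) = pm_scale (c * d) x"
  "pm_scale 1 x = x"
  "pm_scale 0 x = 0"
  "pm_scale (c + d) x = pm_scale c x + pm_scale d x"
  "pm_scale (- 1) x = - x"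
  by (rule poly_mapping_eqI, simp add: lookup_add lookup_minus algebra_simps)+

lemma pm_scale_single [simp]: "pm_scale c (Poly_Mapping.single a z) = Poly_Mapping.single a (c * z)"
  by (rule poly_mapping_eqI) (simp add: lookup_single when_def)

lemma pm_scale_conv_mult: "pm_scale c x = Poly_Mapping.single 0 c * x"
  for x :: "'a::monoid_add \<Rightarrow>\<^sub>0 complex"
  unfolding pm_scale_def by (rule mult_map_scale_conv_mult)

lemma keys_pm_scale: "Poly_Mapping.keys (pm_scale c x) \<subseteq> Poly_Mapping.keys x"
  by (auto simp: in_keys_iff)

lemma keys_diff_subset: "Poly_Mapping.keys (x - y :: _ \<Rightarrow>\<^sub>0 complex) \<subseteq> Poly_Mapping.keys x \<union> Poly_Mapping.keys y"
  by (auto simp: in_keys_iff lookup_minus)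

lemma keys_sum_subset: "Poly_Mapping.keys (\<Sum>i\<in>A. f i) \<subseteq> (\<Union>i\<in>A. Poly_Mapping.keys (f i))"
proof (induction A rule: infinite_finite_induct)
  case (insert x F)
  then show ?case using keys_add[of "f x" "sum f F"] by auto
qed auto

lemma poly_mapping_sum_single:
  "x = (\<Sum>a\<in>Poly_Mapping.keys x. Poly_Mapping.single a (Poly_Mapping.lookup x a))"
  by (rule poly_mapping_eqI) (auto simp: lookup_sum lookup_single when_def in_keys_iff)

lemma pm_scale_mult:
  fixes x y :: "'a::monoid_add \<Rightarrow>\<^sub>0 complex"
  shows "pm_scale c x * y = pm_scale c (x * y)" "x * pm_scale c y = pm_scale c (x * y)"
proof -
  show "pm_scale c x * y = pm_scale c (x * y)" by (simp add: pm_scale_conv_mult mult.assoc)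
  have "(\<Sum>a\<in>A. Poly_Mapping.single a (u a)) * Poly_Mapping.single 0 c
      = Poly_Mapping.single 0 c * (\<Sum>a\<in>A. Poly_Mapping.single a (u a))" for A and u :: "'a \<Rightarrow> complex"
    by (simp add: sum_distrib_left sum_distrib_right mult_single mult.commute)
  then have "x * Poly_Mapping.single 0 c = Poly_Mapping.single 0 c * x"
    by (metis poly_mapping_sum_single)
  then show "x * pm_scale c y = pm_scale c (x * y)"
    by (simp add: pm_scale_conv_mult mult.assoc[symmetric])
qed

definition lext :: "('a \<Rightarrow> fock) \<Rightarrow> ('a \<Rightarrow>\<^sub>0 complex) \<Rightarrow> fock" where
  "lext F x = (\<Sum>a\<in>Poly_Mapping.keys x. scal (Poly_Mapping.lookup x a) (F a))"

lemma lext_superset: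
  "finite A \<Longrightarrow> Poly_Mapping.keys x \<subseteq> A \<Longrightarrow> lext F x = (\<Sum>a\<in>A. scal (Poly_Mapping.lookup x a) (F a))"
  unfolding lext_def by (rule sum.mono_neutral_left) (auto simp: in_keys_iff scal_simps)

lemma lext_add: "lext F (x + y) = lext F x + lext F y"
proof -
  let ?A = "Poly_Mapping.keys x \<union> Poly_Mapping.keys y"
  have "lext F (x + y) = (\<Sum>a\<in>?A. scal (Poly_Mapping.lookup (x + y) a) (F a))"
    using keys_add[of x y] by (intro lext_superset) auto
  then show ?thesis
    by (simp add: lext_superset[of ?A] lookup_add scal_add_left sum.distrib)
qed

lemma lext_scale: "lext F (pm_scale c x) = scal c (lext F x)"
  by (subst lext_superset[of "Poly_Mapping.keys x"])
    (auto simp: keys_pm_scale lext_def scal_sum scal_simps)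

lemma lext_zero [simp]: "lext F 0 = 0"
  by (simp add: lext_def)

lemma lext_uminus: "lext F (- x) = - lext F x"
  using lext_scale[of F "- 1" x] by (simp add: pm_scale_simps scal_simps)

lemma lext_diff: "lext F (x - y) = lext F x - lext F y"
  using lext_add[of F x "- y"] by (simp add: lext_uminus)

lemma lext_sum: "lext F (\<Sum>i\<in>A. g i) = (\<Sum>i\<in>A. lext F (g i))"
  using sum_comp_morphism[of "lext F" g A] by (simp add: lext_add comp_def)

lemma lext_single [simp]: "lext F (Poly_Mapping.single a c) = scal c (F a)"
  by (simp add: lext_def scal_simps)

lemma lin_lext: "(\<And>a. lin (F a)) \<Longrightarrow> lin (\<lambda>f. lext (\<lambda>a. F a f) x)"
  unfolding lext_def by (intro lin_sum lin_scal)

section \<open>Representations of \<open>q(n+1)\<close> and of its free algebra\<close>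

definition qact :: "nat \<Rightarrow> nat \<Rightarrow> qelem \<Rightarrow> fock \<Rightarrow> fock" where
  "qact n p x f = lext (\<lambda>(i, j, s). qop n p i j s f) x"

lemma lin_qact [simp]: "lin (qact n p x)"
  unfolding qact_def by (rule lin_lext) (auto simp: case_prod_unfold)

lemma qact_simps:
  "qact n p (x + y) f = qact n p x f + qact n p y f"
  "qact n p (x - y) f = qact n p x f - qact n p y f"
  "qact n p (pm_scale c x) f = scal c (qact n p x f)"
  "qact n p 0 f = 0"
  "qact n p (- x) f = - qact n p x f"
  by (simp_all add: qact_def lext_add lext_diff lext_scale lext_uminus)

lemma qact_qE [simp]: "qact n p (qE i j s) f = qop n p i j s f"
  by (simp add: qact_def qE_def scal_simps)

lemma qact_sum: "qact n p (\<Sum>i\<in>A. g i) f = (\<Sum>i\<in>A. qact n p (g i) f)"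
  by (simp add: qact_def lext_sum)

lemma qact_basis_bracket:
  assumes "i \<le> n" "j \<le> n" "k \<le> n" "l \<le> n"
  shows "qact n p (basis_bracket (i, j, s) (k, l, t)) f =
    qop n p i j s (qop n p k l t f) - scal (ssign s t) (qop n p k l t (qop n p i j s f))"
  using qop_bracket[OF assms, of p s t, unfolded qrel_def, rule_format, of f]
  by (cases "j = k"; cases "i = l") (simp_all add: qact_simps pm_scale_simps scal_simps del: add_bit_eq_xor)

text \<open>Homogeneity makes the sign the same for all pairs of keys, so the relation extends
  bilinearly from basis elements.\<close>

lemma qact_bracket:
  assumes "x \<in> qalg n" "y \<in> qalg n" "x \<in> homog s" "y \<in> homog t"
  shows "qact n p (sbracket x y) f = qact n p x (qact n p y f) - scal (ssign s t) (qact n p y (qact n p x f))"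
proof -
  let ?q = "\<lambda>a g. case a of (i, j, s) \<Rightarrow> qop n p i j s g"
  let ?X = "Poly_Mapping.lookup x" and ?Y = "Poly_Mapping.lookup y"
  have L: "lin (?q a)" for a by (cases a) simp
  have "qact n p (basis_bracket a b) f = ?q a (?q b f) - scal (ssign s t) (?q b (?q a f))"
    if "a \<in> Poly_Mapping.keys x" "b \<in> Poly_Mapping.keys y" for a b
  proof -
    obtain i j s' k l t' where ab: "a = (i, j, s')" "b = (k, l, t')" by (cases a; cases b)
    with that assms have "i \<le> n" "j \<le> n" "k \<le> n" "l \<le> n" "s' = s" "t' = t"
      by (auto simp: qalg_def q_span_def homog_def)
    then show ?thesis using ab by (simp del: basis_bracket.simps add: qact_basis_bracket)
  qed
  then have "qact n p (sbracket x y) f = (\<Sum>a\<in>Poly_Mapping.keys x. \<Sum>b\<in>Poly_Mapping.keys y.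
      scal (?X a * ?Y b) (?q a (?q b f) - scal (ssign s t) (?q b (?q a f))))"
    by (simp add: sbracket_def qact_sum qact_simps)
  also have "\<dots> = (\<Sum>a\<in>Poly_Mapping.keys x. \<Sum>b\<in>Poly_Mapping.keys y. scal (?X a) (?q a (scal (?Y b) (?q b f))))
      - (\<Sum>a\<in>Poly_Mapping.keys x. \<Sum>b\<in>Poly_Mapping.keys y. scal (ssign s t) (scal (?Y b) (?q b (scal (?X a) (?q a f)))))"
    by (simp add: lin_simps[OF L] scal_simps sum_subtractf ac_simps)
  also have "(\<Sum>a\<in>Poly_Mapping.keys x. \<Sum>b\<in>Poly_Mapping.keys y. scal (?X a) (?q a (scal (?Y b) (?q b f))))
      = qact n p x (qact n p y f)"
    unfolding qact_def lext_def lin_simps(6)[OF L] scal_sum ..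
  also have "(\<Sum>a\<in>Poly_Mapping.keys x. \<Sum>b\<in>Poly_Mapping.keys y. scal (ssign s t) (scal (?Y b) (?q b (scal (?X a) (?q a f)))))
      = scal (ssign s t) (qact n p y (qact n p x f))"
    unfolding qact_def lext_def lin_simps(6)[OF L] scal_sum by (rule sum.swap)
  finally show ?thesis .
qed

definition arep :: "nat \<Rightarrow> nat \<Rightarrow> free_elem \<Rightarrow> fock \<Rightarrow> fock" where
  "arep n p u f = lext (\<lambda>w. foldr (qact n p) (letters w) f) u"

lemma lin_foldr: "(\<And>x. lin (T x)) \<Longrightarrow> lin (foldr T xs)"
  by (induction xs) (auto simp: lin_def)

lemma lin_arep [simp]: "lin (arep n p u)"
  unfolding arep_def by (rule lin_lext) (simp add: lin_foldr)

lemma arep_simps: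
  "arep n p (u + v) f = arep n p u f + arep n p v f"
  "arep n p (u - v) f = arep n p u f - arep n p v f"
  "arep n p (pm_scale c u) f = scal c (arep n p u f)"
  "arep n p 0 f = 0"
  by (simp_all add: arep_def lext_add lext_diff lext_scale)

lemma arep_gen [simp]: "arep n p (gen x) f = qact n p x f"
  by (simp add: arep_def gen_def scal_simps)

lemma arep_one [simp]: "arep n p 1 f = f"
  unfolding single_one[symmetric] arep_def by (simp add: zero_fword_def scal_simps)

lemma letters_add [simp]: "letters (v + w) = letters v @ letters w"
  by (simp add: plus_fword_def)

lemma free_mult_expand:
  fixes u v :: "'a::monoid_add \<Rightarrow>\<^sub>0 complex"
  shows "u * v = (\<Sum>a\<in>Poly_Mapping.keys u. \<Sum>b\<in>Poly_Mapping.keys v.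
    Poly_Mapping.single (a + b) (Poly_Mapping.lookup u a * Poly_Mapping.lookup v b))"
  by (subst poly_mapping_sum_single[of u], subst poly_mapping_sum_single[of v])
    (simp add: sum_product mult_single)

lemma arep_mult: "arep n p (u * v) f = arep n p u (arep n p v f)"
proof -
  let ?F = "\<lambda>w f. foldr (qact n p) (letters w) f"
  have L: "lin (?F w)" for w using lin_foldr[of "qact n p"] by simp
  have "arep n p (u * v) f = (\<Sum>a\<in>Poly_Mapping.keys u. \<Sum>b\<in>Poly_Mapping.keys v.
      scal (Poly_Mapping.lookup u a * Poly_Mapping.lookup v b) (?F a (?F b f)))"
    by (simp add: free_mult_expand[of u v] arep_def lext_sum)
  also have "\<dots> = arep n p u (arep n p v f)"
    unfolding arep_def lext_def lin_simps(6)[OF L] scal_sum lin_simps(2)[OF L] scal_simps(5) ..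
  finally show ?thesis .
qed

section \<open>Enveloping algebras\<close>

definition subalg :: "qelem set \<Rightarrow> bool" where
  "subalg L \<longleftrightarrow> (\<forall>x\<in>L. \<forall>y\<in>L. x + y \<in> L \<and> sbracket x y \<in> L) \<and> (\<forall>c. \<forall>x\<in>L. pm_scale c x \<in> L)"

lemma q_span_closed:
  "x \<in> q_span S \<Longrightarrow> y \<in> q_span S \<Longrightarrow> x + y \<in> q_span S"
  "x \<in> q_span S \<Longrightarrow> y \<in> q_span S \<Longrightarrow> x - y \<in> q_span S"
  "x \<in> q_span S \<Longrightarrow> pm_scale c x \<in> q_span S"
  "0 \<in> q_span S"
  "(\<And>a. a \<in> A \<Longrightarrow> g a \<in> q_span S) \<Longrightarrow> (\<Sum>a\<in>A. g a) \<in> q_span S"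
  "qE i j s \<in> q_span S \<longleftrightarrow> (i, j) \<in> S"
  using keys_add[of x y] keys_diff_subset[of x y] keys_pm_scale[of c x] keys_sum_subset[of g A]
  by (fastforce simp: q_span_def qE_def)+

text \<open>Brackets of matrix units only compose index pairs. Both \<open>q(n+1)\<close> and its
  block triangular parabolic subalgebra are spans of this kind.\<close>

lemma subalg_q_span:
  assumes "trans S" shows "subalg (q_span S)"
proof -
  have "sbracket x y \<in> q_span S" if xy: "x \<in> q_span S" "y \<in> q_span S" for x y
  proof -
    have "basis_bracket a b \<in> q_span S"
      if "a \<in> Poly_Mapping.keys x" "b \<in> Poly_Mapping.keys y" for a b
    proof -
      obtain i j s k l t where ab: "a = (i, j, s)" "b = (k, l, t)" by (cases a; cases b)
      then have "(i, j) \<in> S" "(k, l) \<in> S" using that xy by (auto simp: q_span_def)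
      then have "j = k \<Longrightarrow> (i, l) \<in> S" "i = l \<Longrightarrow> (k, j) \<in> S" using assms by (auto dest: transD)
      then show ?thesis
        unfolding ab basis_bracket.simps
        by (intro q_span_closed(2,3)) (auto simp: q_span_closed(4,6))
    qed
    then show ?thesis unfolding sbracket_def by (intro q_span_closed(3,5)) auto
  qed
  then show ?thesis by (auto simp: subalg_def q_span_closed)
qed

lemma subalg_qalg: "subalg (qalg n)"
  unfolding qalg_def by (rule subalg_q_span) (auto intro!: transI)

lemma subalg_q_par: "subalg (q_par n)"
  unfolding q_par_def by (rule subalg_q_span) (auto intro!: transI)

lemma q_par_subset: "q_par n \<subseteq> qalg n"
  by (fastforce simp: q_par_def qalg_def q_span_def)

lemma qE_mem [simp]: "qE i j s \<in> qalg n \<longleftrightarrow> i \<le> n \<and> j \<le> n"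
  by (simp add: qalg_def q_span_closed)

definition FA :: "qelem set \<Rightarrow> free_elem set" where
  "FA L = {f. \<forall>w\<in>Poly_Mapping.keys f. set (letters w) \<subseteq> L}"

lemma free_alg_sel [simp]:
  "carrier (free_alg L) = FA L" "mult (free_alg L) = (*)" "add (free_alg L) = (+)"
  "one (free_alg L) = 1" "zero (free_alg L) = 0"
  by (simp_all add: free_alg_def FA_def)

lemma FA_closed [intro, simp]:
  "0 \<in> FA L" "1 \<in> FA L"
  "f \<in> FA L \<Longrightarrow> g \<in> FA L \<Longrightarrow> f + g \<in> FA L"
  "f \<in> FA L \<Longrightarrow> g \<in> FA L \<Longrightarrow> f - g \<in> FA L"
  "f \<in> FA L \<Longrightarrow> g \<in> FA L \<Longrightarrow> f * g \<in> FA L"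
  "f \<in> FA L \<Longrightarrow> - f \<in> FA L"
  "f \<in> FA L \<Longrightarrow> pm_scale c f \<in> FA L"
  "x \<in> L \<Longrightarrow> gen x \<in> FA L"
  "Poly_Mapping.single 0 c \<in> FA L"
proof -
  show "0 \<in> FA L" "1 \<in> FA L" "Poly_Mapping.single 0 c \<in> FA L"
    by (simp_all add: FA_def zero_fword_def)
  show "x \<in> L \<Longrightarrow> gen x \<in> FA L" by (simp add: FA_def gen_def)
  assume f: "f \<in> FA L"
  then show "- f \<in> FA L" by (simp add: FA_def)
  show "pm_scale c f \<in> FA L" using f keys_pm_scale[of c f] by (auto simp: FA_def)
  assume g: "g \<in> FA L"
  show "f + g \<in> FA L" using f g keys_add[of f g] by (auto simp: FA_def)
  show "f - g \<in> FA L" using f g keys_diff_subset[of f g] by (auto simp: FA_def)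
  show "f * g \<in> FA L"
  proof -
    have "set (letters w) \<subseteq> L" if w: "w \<in> Poly_Mapping.keys (f * g)" for w
    proof -
      obtain a b where "w = a + b" "a \<in> Poly_Mapping.keys f" "b \<in> Poly_Mapping.keys g"
        using keys_mult[of f g] w by auto
      then show ?thesis using f g by (auto simp: FA_def)
    qed
    then show ?thesis by (auto simp: FA_def)
  qed
qed

lemma FA_sum: "(\<And>a. a \<in> A \<Longrightarrow> g a \<in> FA L) \<Longrightarrow> (\<Sum>a\<in>A. g a) \<in> FA L"
  by (induction A rule: infinite_finite_induct) auto

lemma FA_mono: "H \<subseteq> L \<Longrightarrow> FA H \<subseteq> FA L"
  by (auto simp: FA_def)

lemma FA_induct [consumes 1, case_names zero one add scale gen]:
  assumes "f \<in> FA L"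
    and zero: "P 0" and one: "P 1"
    and add: "\<And>f g. f \<in> FA L \<Longrightarrow> g \<in> FA L \<Longrightarrow> P f \<Longrightarrow> P g \<Longrightarrow> P (f + g)"
    and scale: "\<And>c f. f \<in> FA L \<Longrightarrow> P f \<Longrightarrow> P (pm_scale c f)"
    and gen: "\<And>x f. x \<in> L \<Longrightarrow> f \<in> FA L \<Longrightarrow> P f \<Longrightarrow> P (gen x * f)"
  shows "P f"
proof -
  have word: "P (Poly_Mapping.single (FWord xs) 1) \<and> Poly_Mapping.single (FWord xs) 1 \<in> FA L" if "set xs \<subseteq> L" for xs
    using that
  proof (induction xs)
    case Nil
    have "Poly_Mapping.single (FWord []) 1 = (1 :: free_elem)"
      unfolding zero_fword_def[symmetric] by simp
    then show ?case using one by simp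
  next
    case (Cons x xs)
    have "Poly_Mapping.single (FWord (x # xs)) 1 = gen x * Poly_Mapping.single (FWord xs) 1"
      by (simp add: gen_def mult_single plus_fword_def)
    then show ?case using Cons gen by auto
  qed
  have *: "P (pm_scale c (Poly_Mapping.single w 1)) \<and> pm_scale c (Poly_Mapping.single w 1) \<in> FA L"
    if "set (letters w) \<subseteq> L" for w c
    using word[OF that] scale by (metis FA_closed(7) fword.collapse)
  have "P (\<Sum>w\<in>A. Poly_Mapping.single w (h w)) \<and> (\<Sum>w\<in>A. Poly_Mapping.single w (h w)) \<in> FA L"
    if "finite A" "\<And>w. w \<in> A \<Longrightarrow> set (letters w) \<subseteq> L" for A h
    using that
  proof (induction A rule: finite_induct)
    case (insert w A)
    then show ?case using *[of w "h w"] by (auto intro: add)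
  qed (simp add: zero)
  from this[of "Poly_Mapping.keys f" "Poly_Mapping.lookup f"] assms(1) poly_mapping_sum_single[of f]
  show ?thesis by (auto simp: FA_def)
qed

lemma ring_free_alg: "ring (free_alg L)"
proof (rule ringI)
  show "abelian_group (free_alg L)"
    by (rule abelian_groupI) (auto simp: ac_simps intro: bexI[of _ "- _"])
  show "Group.monoid (free_alg L)"
    by (rule monoidI) (auto simp: mult.assoc)
qed (auto simp: algebra_simps)

lemma free_alg_a_inv [simp]: "f \<in> FA L \<Longrightarrow> \<ominus>\<^bsub>free_alg L\<^esub> f = - f"
proof -
  assume f: "f \<in> FA L"
  interpret ring "free_alg L" by (rule ring_free_alg)
  show ?thesis using minus_equality[of "- f" f] f by simp
qed

lemma ideal_free_algI:
  assumes "K \<subseteq> FA L" "0 \<in> K" "\<And>f g. f \<in> K \<Longrightarrow> g \<in> K \<Longrightarrow> f + g \<in> K"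
    "\<And>f. f \<in> K \<Longrightarrow> - f \<in> K"
    "\<And>f g. f \<in> K \<Longrightarrow> g \<in> FA L \<Longrightarrow> g * f \<in> K" "\<And>f g. f \<in> K \<Longrightarrow> g \<in> FA L \<Longrightarrow> f * g \<in> K"
  shows "ideal K (free_alg L)"
proof (rule idealI[OF ring_free_alg])
  interpret ring "free_alg L" by (rule ring_free_alg)
  show "subgroup K (add_monoid (free_alg L))"
  proof (rule add.subgroupI)
    fix a assume "a \<in> K"
    then show "\<ominus>\<^bsub>free_alg L\<^esub> a \<in> K" using assms by (simp add: subset_iff)
  qed (use assms in auto)
qed (use assms in auto)

lemma uea_rels_subset: "subalg L \<Longrightarrow> uea_rels L \<subseteq> FA L"
  by (auto simp: uea_rels_def subalg_def)

lemma ideal_uea_ideal: "subalg L \<Longrightarrow> ideal (uea_ideal L) (free_alg L)"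
  unfolding uea_ideal_def using ring.genideal_ideal[OF ring_free_alg] uea_rels_subset by auto

lemma uea_ideal_minimal:
  "ideal K (free_alg L) \<Longrightarrow> uea_rels L \<subseteq> K \<Longrightarrow> uea_ideal L \<subseteq> K"
  unfolding uea_ideal_def by (rule ring.genideal_minimal[OF ring_free_alg])

lemma uea_rels_ideal: "subalg L \<Longrightarrow> uea_rels L \<subseteq> uea_ideal L"
  unfolding uea_ideal_def using ring.genideal_self[OF ring_free_alg] uea_rels_subset by auto

lemma uea_ideal_closed:
  assumes "subalg L"
  shows "uea_ideal L \<subseteq> FA L" "0 \<in> uea_ideal L"
    "f \<in> uea_ideal L \<Longrightarrow> g \<in> uea_ideal L \<Longrightarrow> f + g \<in> uea_ideal L"
    "f \<in> uea_ideal L \<Longrightarrow> - f \<in> uea_ideal L"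
    "f \<in> uea_ideal L \<Longrightarrow> g \<in> FA L \<Longrightarrow> g * f \<in> uea_ideal L"
    "f \<in> uea_ideal L \<Longrightarrow> g \<in> FA L \<Longrightarrow> f * g \<in> uea_ideal L"
proof -
  interpret I: ideal "uea_ideal L" "free_alg L" by (rule ideal_uea_ideal[OF assms])
  show sub: "uea_ideal L \<subseteq> FA L" using I.a_subset by simp
  show "0 \<in> uea_ideal L" using additive_subgroup.zero_closed[OF I.additive_subgroup_axioms] by simp
  show "f \<in> uea_ideal L \<Longrightarrow> g \<in> uea_ideal L \<Longrightarrow> f + g \<in> uea_ideal L"
    using additive_subgroup.a_closed[OF I.additive_subgroup_axioms] by simp
  show "f \<in> uea_ideal L \<Longrightarrow> - f \<in> uea_ideal L" using I.I_l_closed[of f "- 1"] by simp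
  show "f \<in> uea_ideal L \<Longrightarrow> g \<in> FA L \<Longrightarrow> g * f \<in> uea_ideal L" using I.I_l_closed by simp
  show "f \<in> uea_ideal L \<Longrightarrow> g \<in> FA L \<Longrightarrow> f * g \<in> uea_ideal L" using I.I_r_closed by simp
qed

lemma uea_ideal_mono:
  assumes "subalg H" "subalg L" "H \<subseteq> L" shows "uea_ideal H \<subseteq> uea_ideal L"
proof -
  \<comment> \<open>Intersecting with the smaller free algebra gives an ideal of that algebra, to
    which minimality applies.\<close>
  have "uea_ideal H \<subseteq> uea_ideal L \<inter> FA H"
  proof (rule uea_ideal_minimal[OF ideal_free_algI])
    show "uea_rels H \<subseteq> uea_ideal L \<inter> FA H"
    proof -
      have "uea_rels H \<subseteq> uea_rels L" using assms(3) unfolding uea_rels_def by blast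
      then show ?thesis using uea_rels_ideal[OF assms(2)] uea_rels_subset[OF assms(1)] by blast
    qed
  qed (use FA_mono[OF assms(3)] uea_ideal_closed[OF assms(2)] in auto)
  then show ?thesis by blast
qed

lemma uea_of_eq: "uea_of L f = (\<lambda>i. i + f) ` uea_ideal L"
  by (auto simp: uea_of_def a_r_coset_def')

lemma uea_simps:
  assumes "subalg L"
  shows "carrier (uea L) = uea_of L ` FA L"
    "f \<in> FA L \<Longrightarrow> g \<in> FA L \<Longrightarrow> uea_of L f \<otimes>\<^bsub>uea L\<^esub> uea_of L g = uea_of L (f * g)"
    "f \<in> FA L \<Longrightarrow> g \<in> FA L \<Longrightarrow> uea_of L f \<oplus>\<^bsub>uea L\<^esub> uea_of L g = uea_of L (f + g)"
    "\<one>\<^bsub>uea L\<^esub> = uea_of L 1"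
    "f \<in> FA L \<Longrightarrow> uea_scale L c (uea_of L f) = uea_of L (pm_scale c f)"
proof -
  interpret I: ideal "uea_ideal L" "free_alg L" by (rule ideal_uea_ideal[OF assms])
  show "carrier (uea L) = uea_of L ` FA L"
    by (auto simp: uea_def FactRing_def A_RCOSETS_def' uea_of_def)
  show m: "uea_of L f \<otimes>\<^bsub>uea L\<^esub> uea_of L g = uea_of L (f * g)" if "f \<in> FA L" "g \<in> FA L" for f g
    using that I.rcoset_mult_add by (simp add: uea_def FactRing_def uea_of_def)
  show "f \<in> FA L \<Longrightarrow> g \<in> FA L \<Longrightarrow> uea_of L f \<oplus>\<^bsub>uea L\<^esub> uea_of L g = uea_of L (f + g)"
    using I.a_rcos_sum by (simp add: uea_def FactRing_def uea_of_def)
  show "\<one>\<^bsub>uea L\<^esub> = uea_of L 1" by (simp add: uea_def FactRing_def uea_of_def)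
  show "f \<in> FA L \<Longrightarrow> uea_scale L c (uea_of L f) = uea_of L (pm_scale c f)"
    unfolding uea_scale_def by (subst m) (simp_all add: pm_scale_conv_mult)
qed

lemma uea_of_mem: "subalg L \<Longrightarrow> g \<in> uea_of L f \<longleftrightarrow> g - f \<in> uea_ideal L"
  by (auto simp: uea_of_eq image_iff) (metis diff_add_cancel)

lemma uea_of_cong:
  assumes "subalg L" "f - g \<in> uea_ideal L" shows "uea_of L f = uea_of L g"
proof -
  have "h - f \<in> uea_ideal L \<longleftrightarrow> h - g \<in> uea_ideal L" for h
    using uea_ideal_closed(3)[OF assms(1), of "h - f" "f - g"] 
      uea_ideal_closed(3)[OF assms(1), of "h - g" "- (f - g)"] uea_ideal_closed(4)[OF assms] assms(2)
    by auto
  then show ?thesis using uea_of_mem[OF assms(1)] by blast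
qed

lemma uea_incl_of:
  assumes "subalg H" "subalg L" "H \<subseteq> L" 
  shows "uea_incl L (uea_of H h) = uea_of L h"
proof -
  have "uea_incl L (uea_of H h) = {a + (b + h) | a b. a \<in> uea_ideal L \<and> b \<in> uea_ideal H}"
    by (auto simp: uea_incl_def set_add_def' uea_of_eq)
  also have "\<dots> = uea_of L h"
  proof safe
    fix a b assume "a \<in> uea_ideal L" "b \<in> uea_ideal H"
    then have "a + b \<in> uea_ideal L" using uea_ideal_mono[OF assms] uea_ideal_closed[OF assms(2)] by blast
    then show "a + (b + h) \<in> uea_of L h" using assms by (simp add: uea_of_mem)
  next
    fix g assume "g \<in> uea_of L h"
    then show "\<exists>a b. g = a + (b + h) \<and> a \<in> uea_ideal L \<and> b \<in> uea_ideal H"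
      using uea_ideal_closed(2)[OF assms(1)] assms
      by (intro exI[of _ "g - h"] exI[of _ 0]) (simp add: uea_of_mem)
  qed
  finally show ?thesis .
qed

section \<open>The action of the enveloping algebra on Fock space\<close>

text \<open>The elements acting as zero form an ideal, and the bracket relations of Fock space place
  the defining relations in it.\<close>

lemma arep_uea_ideal:
  assumes "u \<in> uea_ideal (qalg n)" shows "arep n p u f = 0"
proof -
  let ?K = "{u \<in> FA (qalg n). \<forall>f. arep n p u f = 0}"
  have "ideal ?K (free_alg (qalg n))"
    by (rule ideal_free_algI)
      (auto simp: arep_simps arep_mult lin_simps(3)[OF lin_arep] arep_simps(2)[of n p 0, simplified])
  moreover have "uea_rels (qalg n) \<subseteq> ?K"
  proof
    fix u assume u: "u \<in> uea_rels (qalg n)"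
    then have "u \<in> FA (qalg n)" using uea_rels_subset[OF subalg_qalg] by blast
    moreover have "arep n p u f = 0" for f
      using u by (auto simp: uea_rels_def arep_simps qact_simps arep_mult qact_bracket)
    ultimately show "u \<in> ?K" by simp
  qed
  ultimately show ?thesis using uea_ideal_minimal assms by blast
qed

lemma arep_uea_of:
  assumes "g \<in> uea_of (qalg n) f" shows "arep n p g v = arep n p f v"
  using arep_uea_ideal[of "g - f" n p v] assms uea_of_mem[OF subalg_qalg] by (simp add: arep_simps)

lemma qact_vac:
  assumes "x \<in> q_par n" shows "qact n p x vac = scal (chi p x) vac"
proof -
  let ?c = "\<lambda>(i, j, s). if (i, j) = (0, 0) then
    if s = 0 then of_nat p else complex_of_real (sqrt (real p)) else 0"
  have "qact n p x vac = (\<Sum>a\<in>Poly_Mapping.keys x. scal (Poly_Mapping.lookup x a) (scal (?c a) vac))"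
    unfolding qact_def lext_def
  proof (rule sum.cong)
    fix a assume a: "a \<in> Poly_Mapping.keys x"
    obtain i j s where ijs: "a = (i, j, s)" by (cases a)
    have "(i, j) \<in> {(0, 0)} \<union> {1..n} \<times> {1..n} \<union> {0} \<times> {1..n}"
      using a ijs assms by (auto simp: q_par_def q_span_def)
    then show "scal (Poly_Mapping.lookup x a) (case a of (i, j, s) \<Rightarrow> qop n p i j s vac)
        = scal (Poly_Mapping.lookup x a) (scal (?c a) vac)"
      using qop_vac[of i j n p s] ijs by simp
  qed simp
  also have "\<dots> = scal (\<Sum>a\<in>Poly_Mapping.keys x. Poly_Mapping.lookup x a * ?c a) vac"
    by (simp add: scal_def fun_eq_iff sum_fun_apply sum_distrib_right mult.assoc)
  \<comment> \<open>Only the two keys with indices 0, 0 contribute; the sum is enlarged first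
    because either may be missing from the support.\<close>
  also have "(\<Sum>a\<in>Poly_Mapping.keys x. Poly_Mapping.lookup x a * ?c a)
      = (\<Sum>a\<in>Poly_Mapping.keys x \<union> {(0, 0, 0), (0, 0, 1)}. Poly_Mapping.lookup x a * ?c a)"
    by (rule sum.mono_neutral_left) (auto simp: in_keys_iff)
  also have "\<dots> = (\<Sum>a\<in>{(0, 0, 0), (0, 0, 1)}. Poly_Mapping.lookup x a * ?c a)"
  proof (intro sum.mono_neutral_right ballI)
    fix a assume a: "a \<in> Poly_Mapping.keys x \<union> {(0, 0, 0), (0, 0, 1)} - {(0, 0, 0), (0, 0, 1)}"
    obtain i j s where "a = (i, j, s)" by (cases a)
    with a show "Poly_Mapping.lookup x a * ?c a = 0" by (cases s) auto
  qed auto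
  also have "\<dots> = chi p x" by (simp add: chi_def mult.commute)
  finally show ?thesis .
qed

lemma foldr_qact_vac:
  "set ws \<subseteq> q_par n \<Longrightarrow> foldr (qact n p) ws vac = scal (prod_list (map (chi p) ws)) vac"
  by (induction ws) (simp_all add: scal_simps qact_vac lin_simps(2)[OF lin_qact] mult.commute)

lemma scal_sum_left: "(\<Sum>a\<in>A. scal (c a) f) = scal (\<Sum>a\<in>A. c a) f"
  by (simp add: scal_def fun_eq_iff sum_fun_apply sum_distrib_right)

lemma arep_vac:
  assumes "h \<in> FA (q_par n)" shows "arep n p h vac = scal (free_char (chi p) h) vac"
proof -
  have "arep n p h vac = (\<Sum>w\<in>Poly_Mapping.keys h.
      scal (Poly_Mapping.lookup h w * prod_list (map (chi p) (letters w))) vac)"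
    unfolding arep_def lext_def using assms
    by (intro sum.cong) (simp_all add: FA_def foldr_qact_vac scal_simps)
  then show ?thesis by (simp add: scal_sum_left free_char_def)
qed

lemma scal_vac_inj: "scal c vac = scal d vac \<longleftrightarrow> c = d"
proof
  assume "scal c vac = scal d vac"
  from fun_cong[OF fun_cong[OF this, of "\<lambda>_. 0"], of "\<lambda>_. False"] show "c = d"
    by (simp add: scal_def vac_def fmon_def)
qed simp

text \<open>\<open>the_elem\<close> requires a constant value on the coset. The scalar is read off
  from the action on the vacuum, on which the ideal acts as zero.\<close>

lemma uea_char_of:
  assumes "h \<in> FA (q_par n)"
  shows "uea_char (chi p) (uea_of (q_par n) h) = free_char (chi p) h"
proof -
  have "free_char (chi p) g = free_char (chi p) h" if "g \<in> uea_of (q_par n) h" for g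
  proof -
    have d: "g - h \<in> uea_ideal (q_par n)" using that uea_of_mem[OF subalg_q_par] by blast
    then have "g \<in> FA (q_par n)"
      using uea_ideal_closed(1)[OF subalg_q_par] FA_closed(3)[OF assms, of "g - h"] by auto
    moreover have "arep n p (g - h) vac = 0"
      using d uea_ideal_mono[OF subalg_q_par subalg_qalg q_par_subset] arep_uea_ideal by blast
    ultimately show ?thesis using assms by (simp add: arep_simps arep_vac scal_vac_inj)
  qed
  moreover have "h \<in> uea_of (q_par n) h"
    using uea_ideal_closed(2)[OF subalg_q_par] by (simp add: uea_of_mem[OF subalg_q_par])
  ultimately have "free_char (chi p) ` uea_of (q_par n) h = {free_char (chi p) h}" by blast
  then show ?thesis by (simp add: uea_char_def)
qed

section \<open>The induced module\<close>

definition FT :: "qelem set \<Rightarrow> pre_ind set" where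
  "FT L = {f. Poly_Mapping.keys f \<subseteq> carrier (uea L) \<times> UNIV}"

lemma free_tensor_sel [simp]:
  "carrier (free_tensor L) = FT L"
  "zero (free_tensor L) = 0" "add (free_tensor L) = (+)" "smult (free_tensor L) = pm_scale"
  by (simp_all add: free_tensor_def FT_def)

lemma FT_closed:
  "0 \<in> FT L" "f \<in> FT L \<Longrightarrow> g \<in> FT L \<Longrightarrow> f + g \<in> FT L"
  "f \<in> FT L \<Longrightarrow> g \<in> FT L \<Longrightarrow> f - g \<in> FT L"
  "f \<in> FT L \<Longrightarrow> - f \<in> FT L"
  "f \<in> FT L \<Longrightarrow> pm_scale c f \<in> FT L"
  "u \<in> carrier (uea L) \<Longrightarrow> ptensor u z \<in> FT L"
  using keys_add[of f g] keys_diff_subset[of f g] keys_pm_scale[of c f] by (auto simp: ptensor_def FT_def)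

lemma vectorspace_free_tensor: "vectorspace class_ring (free_tensor L)"
proof (rule vs_criteria)
  show "field (class_ring :: complex ring)" by (rule class_field.field_axioms)
  show "\<forall>v\<in>carrier (free_tensor L). \<exists>w\<in>carrier (free_tensor L). v \<oplus>\<^bsub>free_tensor L\<^esub> w = \<zero>\<^bsub>free_tensor L\<^esub>"
    by (auto intro!: bexI[of _ "- _"] FT_closed)
qed (use FT_closed in \<open>auto simp: pm_scale_simps ac_simps\<close>)

lemma submodule_free_tensorI:
  assumes "K \<subseteq> FT L" "0 \<in> K" "\<And>f g. f \<in> K \<Longrightarrow> g \<in> K \<Longrightarrow> f + g \<in> K" "\<And>c f. f \<in> K \<Longrightarrow> pm_scale c f \<in> K"
  shows "submodule class_ring K (free_tensor L)"
proof -
  interpret vectorspace class_ring "free_tensor L" by (rule vectorspace_free_tensor)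
  show ?thesis by (unfold_locales) (use assms in auto)
qed

definition push :: "('a \<Rightarrow> 'b) \<Rightarrow> ('a \<Rightarrow>\<^sub>0 complex) \<Rightarrow> ('b \<Rightarrow>\<^sub>0 complex)" where
  "push G f = (\<Sum>a\<in>Poly_Mapping.keys f. Poly_Mapping.single (G a) (Poly_Mapping.lookup f a))"

lemma push_superset:
  "finite A \<Longrightarrow> Poly_Mapping.keys x \<subseteq> A \<Longrightarrow> push G x = (\<Sum>a\<in>A. Poly_Mapping.single (G a) (Poly_Mapping.lookup x a))"
  unfolding push_def by (rule sum.mono_neutral_left) (auto simp: in_keys_iff)

lemma push_add: "push G (x + y) = push G x + push G y"
proof -
  let ?A = "Poly_Mapping.keys x \<union> Poly_Mapping.keys y"
  have "push G (x + y) = (\<Sum>a\<in>?A. Poly_Mapping.single (G a) (Poly_Mapping.lookup (x + y) a))"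
    using keys_add[of x y] by (intro push_superset) auto
  then show ?thesis
    by (simp add: push_superset[of ?A] lookup_add single_add sum.distrib)
qed

lemma pm_scale_sum: "pm_scale c (\<Sum>a\<in>A. g a) = (\<Sum>a\<in>A. pm_scale c (g a))"
  by (rule poly_mapping_eqI) (simp add: lookup_sum sum_distrib_left)

lemma push_scale: "push G (pm_scale c x) = pm_scale c (push G x)"
  by (subst push_superset[of "Poly_Mapping.keys x"]) (auto simp: keys_pm_scale push_def pm_scale_sum)

lemma push_uminus: "push G (- x) = - push G x"
  using push_scale[of G "- 1" x] by (simp add: pm_scale_simps)

lemma push_diff: "push G (x - y) = push G x - push G y"
  using push_add[of G x "- y"] by (simp add: push_uminus)

lemma push_zero [simp]: "push G 0 = 0"
  by (simp add: push_def)

lemma push_single [simp]: "push G (Poly_Mapping.single a c) = Poly_Mapping.single (G a) c"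
  by (simp add: push_def)

lemma free_tensor_act:
  "act (free_tensor L) x = push (\<lambda>(u, z). (uea_of L (gen x) \<otimes>\<^bsub>uea L\<^esub> u, z))"
  by (rule ext) (auto simp: free_tensor_def push_def case_prod_unfold intro!: sum.cong)

text \<open>The map given by the universal property: a pure tensor of \<open>u\<close> and
  \<open>z\<close> goes to \<open>z\<close> times \<open>u\<close> applied to the vacuum. A
  representative is chosen because \<open>arep\<close> lives on the free algebra;
  \<open>arep_uea_of\<close> makes the choice immaterial.\<close>

definition ind_eval :: "nat \<Rightarrow> nat \<Rightarrow> pre_ind \<Rightarrow> fock" where
  "ind_eval n p = lext (\<lambda>(u, z). scal z (arep n p (SOME g. g \<in> u) vac))"

lemma ind_eval_simps:
  "ind_eval n p (f + g) = ind_eval n p f + ind_eval n p g"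
  "ind_eval n p (f - g) = ind_eval n p f - ind_eval n p g"
  "ind_eval n p (pm_scale c f) = scal c (ind_eval n p f)"
  "ind_eval n p 0 = 0"
  by (simp_all add: ind_eval_def lext_add lext_diff lext_scale)

lemma arep_some:
  assumes "f \<in> FA (qalg n)" shows "arep n p (SOME g. g \<in> uea_of (qalg n) f) v = arep n p f v"
proof (rule arep_uea_of)
  have "f \<in> uea_of (qalg n) f"
    using uea_ideal_closed(2)[OF subalg_qalg] by (simp add: uea_of_mem[OF subalg_qalg])
  then show "(SOME g. g \<in> uea_of (qalg n) f) \<in> uea_of (qalg n) f" by (rule someI)
qed

lemma ind_eval_single:
  "f \<in> FA (qalg n) \<Longrightarrow> ind_eval n p (Poly_Mapping.single (uea_of (qalg n) f, z) c) = scal (c * z) (arep n p f vac)"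
  by (simp add: ind_eval_def arep_some scal_simps)

lemma ind_eval_ptensor:
  "f \<in> FA (qalg n) \<Longrightarrow> ind_eval n p (ptensor (uea_of (qalg n) f) z) = scal z (arep n p f vac)"
  by (simp add: ptensor_def ind_eval_single)

lemma tensor_rels_subset: "tensor_rels (qalg n) (q_par n) (chi p) \<subseteq> FT (qalg n)"
proof -
  have *: "h \<in> FA (q_par n) \<Longrightarrow> h \<in> FA (qalg n)" for h using FA_mono[OF q_par_subset] by blast
  note S = uea_simps[OF subalg_qalg[of n]] uea_simps(1)[OF subalg_q_par[of n]]
    uea_incl_of[OF subalg_q_par subalg_qalg q_par_subset]
  show ?thesis
    unfolding tensor_rels_def
    by (auto simp: S * intro!: FT_closed)
qed

lemma tensor_kernel_submodule:
  "submodule class_ring (tensor_kernel (qalg n) (q_par n) (chi p)) (free_tensor (qalg n))"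
proof -
  interpret vectorspace class_ring "free_tensor (qalg n)" by (rule vectorspace_free_tensor)
  show ?thesis
    unfolding tensor_kernel_def using tensor_rels_subset by (intro span_is_submodule) simp
qed

lemma tensor_kernel_minimal:
  assumes "submodule class_ring K (free_tensor (qalg n))" "tensor_rels (qalg n) (q_par n) (chi p) \<subseteq> K"
  shows "tensor_kernel (qalg n) (q_par n) (chi p) \<subseteq> K"
proof -
  interpret vectorspace class_ring "free_tensor (qalg n)" by (rule vectorspace_free_tensor)
  show ?thesis unfolding tensor_kernel_def using assms by (intro span_is_subset)
qed

lemma tensor_rels_kernel: 
  "tensor_rels (qalg n) (q_par n) (chi p) \<subseteq> tensor_kernel (qalg n) (q_par n) (chi p)"
proof -
  interpret vectorspace class_ring "free_tensor (qalg n)" by (rule vectorspace_free_tensor)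
  show ?thesis unfolding tensor_kernel_def using tensor_rels_subset by (intro in_own_span) simp
qed

lemma tensor_kernel_closed:
  fixes n p defines "N \<equiv> tensor_kernel (qalg n) (q_par n) (chi p)"
  shows "N \<subseteq> FT (qalg n)" "0 \<in> N" "f \<in> N \<Longrightarrow> g \<in> N \<Longrightarrow> f + g \<in> N" "f \<in> N \<Longrightarrow> pm_scale c f \<in> N"
    "f \<in> N \<Longrightarrow> - f \<in> N" "f \<in> N \<Longrightarrow> g \<in> N \<Longrightarrow> f - g \<in> N"
proof -
  interpret submodule class_ring N "free_tensor (qalg n)"
    unfolding N_def by (rule tensor_kernel_submodule)
  show "N \<subseteq> FT (qalg n)" "0 \<in> N" using subset zero_closed by simp_all
  show a: "f \<in> N \<Longrightarrow> g \<in> N \<Longrightarrow> f + g \<in> N" for f g using m_closed[of f g] by simp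
  show c: "f \<in> N \<Longrightarrow> pm_scale c f \<in> N" for c f using smult_closed[of c f] by simp
  show m: "f \<in> N \<Longrightarrow> - f \<in> N" for f using c[of f "- 1"] by (simp add: pm_scale_simps)
  show "f \<in> N \<Longrightarrow> g \<in> N \<Longrightarrow> f - g \<in> N" using a[of f "- g"] m by simp
qed

text \<open>The balancing relations are respected because the parabolic subalgebra acts on the
  vacuum by the character; the other relations express linearity.\<close>

lemma ind_eval_kernel:
  assumes "f \<in> tensor_kernel (qalg n) (q_par n) (chi p)" shows "ind_eval n p f = 0"
proof -
  have P: "h \<in> FA (q_par n) \<Longrightarrow> h \<in> FA (qalg n)" for h using FA_mono[OF q_par_subset] by blast
  note S = uea_simps[OF subalg_qalg[of n]] uea_simps(1)[OF subalg_q_par[of n]]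
    uea_incl_of[OF subalg_q_par subalg_qalg q_par_subset]
  have "submodule class_ring {f \<in> FT (qalg n). ind_eval n p f = 0} (free_tensor (qalg n))"
    using FT_closed by (intro submodule_free_tensorI) (auto simp: ind_eval_simps scal_simps)
  moreover have "tensor_rels (qalg n) (q_par n) (chi p) \<subseteq> {f \<in> FT (qalg n). ind_eval n p f = 0}"
  proof
    fix f assume f: "f \<in> tensor_rels (qalg n) (q_par n) (chi p)"
    then have "f \<in> FT (qalg n)" using tensor_rels_subset by blast
    moreover have "ind_eval n p f = 0"
      using f unfolding tensor_rels_def
      by (auto simp: S P ind_eval_simps ind_eval_ptensor arep_simps arep_mult scal_simps scal_add_left
          arep_vac uea_char_of lin_simps(2)[OF lin_arep] mult.commute)
    ultimately show "f \<in> {f \<in> FT (qalg n). ind_eval n p f = 0}" by simp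
  qed
  ultimately show ?thesis using tensor_kernel_minimal assms by blast
qed

lemma ind_eval_act:
  assumes "x \<in> qalg n" "f \<in> FT (qalg n)"
  shows "ind_eval n p (act (free_tensor (qalg n)) x f) = qact n p x (ind_eval n p f)"
proof -
  have "ind_eval n p (act (free_tensor (qalg n)) x (\<Sum>a\<in>A. Poly_Mapping.single a (h a)))
     = qact n p x (ind_eval n p (\<Sum>a\<in>A. Poly_Mapping.single a (h a)))"
    if "finite A" "A \<subseteq> carrier (uea (qalg n)) \<times> UNIV" for A h
    using that
  proof (induction A rule: finite_induct)
    case (insert a A)
    then obtain g z where "a = (uea_of (qalg n) g, z)" "g \<in> FA (qalg n)"
      by (auto simp: uea_simps[OF subalg_qalg[of n]])
    then show ?case using insert assms(1)
      by (simp add: free_tensor_act push_add ind_eval_simps lin_simps[OF lin_qact]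
          uea_simps[OF subalg_qalg[of n]] ind_eval_single arep_mult del: plus_fun_apply)
  qed (simp add: free_tensor_act ind_eval_simps lin_simps[OF lin_qact])
  from this[of "Poly_Mapping.keys f" "Poly_Mapping.lookup f"] assms(2)
  show ?thesis by (simp add: FT_def flip: poly_mapping_sum_single)
qed

lemma act_FT:
  assumes "x \<in> qalg n" "f \<in> FT (qalg n)" shows "act (free_tensor (qalg n)) x f \<in> FT (qalg n)"
proof -
  have "Poly_Mapping.keys (act (free_tensor (qalg n)) x f)
      \<subseteq> (\<lambda>(u, z). (uea_of (qalg n) (gen x) \<otimes>\<^bsub>uea (qalg n)\<^esub> u, z)) ` Poly_Mapping.keys f"
    unfolding free_tensor_act push_def by (rule keys_sum_subset[THEN subset_trans]) auto
  also have "\<dots> \<subseteq> carrier (uea (qalg n)) \<times> UNIV"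
    using assms by (force simp: FT_def uea_simps[OF subalg_qalg[of n]])
  finally show ?thesis by (simp add: FT_def)
qed

text \<open>Left multiplication by \<open>gen x\<close> turns each generating relation into one of
  the same kind.\<close>

lemma act_tensor_kernel:
  assumes x: "x \<in> qalg n" and "f \<in> tensor_kernel (qalg n) (q_par n) (chi p)"
  shows "act (free_tensor (qalg n)) x f \<in> tensor_kernel (qalg n) (q_par n) (chi p)"
proof -
  let ?L = "qalg n" and ?N = "tensor_kernel (qalg n) (q_par n) (chi p)"
  let ?R = "tensor_rels (qalg n) (q_par n) (chi p)"
  let ?K = "{f \<in> FT ?L. act (free_tensor ?L) x f \<in> ?N}"
  have P: "h \<in> FA (q_par n) \<Longrightarrow> h \<in> FA (qalg n)" for h using FA_mono[OF q_par_subset] by blast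
  note S = uea_simps[OF subalg_qalg[of n]] uea_simps(1)[OF subalg_q_par[of n]]
    uea_incl_of[OF subalg_q_par subalg_qalg q_par_subset]
  have "submodule class_ring ?K (free_tensor ?L)"
    using FT_closed tensor_kernel_closed[where n = n and p = p]
    by (intro submodule_free_tensorI) (auto simp: free_tensor_act push_add push_scale)
  moreover have "?R \<subseteq> ?K"
  proof
    fix f assume f: "f \<in> ?R"
    then have "f \<in> FT ?L" using tensor_rels_subset by blast
    moreover have "act (free_tensor ?L) x f \<in> ?R"
    proof -
      have T: "act (free_tensor ?L) x (ptensor (uea_of ?L u) z) = ptensor (uea_of ?L (gen x * u)) z"
        if "u \<in> FA ?L" for u z
        using that x by (simp add: free_tensor_act S ptensor_def)
      have D: "act (free_tensor ?L) x (f - g) = act (free_tensor ?L) x f - act (free_tensor ?L) x g" for f g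
        by (simp add: free_tensor_act push_diff)
      have C: "act (free_tensor ?L) x (pm_scale c f) = pm_scale c (act (free_tensor ?L) x f)" for f c
        by (simp add: free_tensor_act push_scale)
      from f consider
          (1) u u' z where "u \<in> FA ?L" "u' \<in> FA ?L" 
            "f = ptensor (uea_of ?L (u + u')) z - ptensor (uea_of ?L u) z - ptensor (uea_of ?L u') z"
        | (2) u z z' where "u \<in> FA ?L"
            "f = ptensor (uea_of ?L u) (z + z') - ptensor (uea_of ?L u) z - ptensor (uea_of ?L u) z'"
        | (3) c u z where "u \<in> FA ?L"
            "f = ptensor (uea_of ?L (pm_scale c u)) z - pm_scale c (ptensor (uea_of ?L u) z)"
        | (4) c u z where "u \<in> FA ?L"
            "f = ptensor (uea_of ?L u) (c * z) - pm_scale c (ptensor (uea_of ?L u) z)"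
        | (5) u h z where "u \<in> FA ?L" "h \<in> FA (q_par n)"
            "f = ptensor (uea_of ?L (u * h)) z
              - ptensor (uea_of ?L u) (uea_char (chi p) (uea_of (q_par n) h) * z)"
        unfolding tensor_rels_def by (auto simp: S P)
      then show ?thesis
      proof cases
        case 1
        then have "act (free_tensor ?L) x f = ptensor (uea_of ?L (gen x * u) \<oplus>\<^bsub>uea ?L\<^esub> uea_of ?L (gen x * u')) z
            - ptensor (uea_of ?L (gen x * u)) z - ptensor (uea_of ?L (gen x * u')) z"
          using x by (simp add: D T S distrib_left)
        moreover have "uea_of ?L (gen x * u) \<in> carrier (uea ?L)" "uea_of ?L (gen x * u') \<in> carrier (uea ?L)"
          using 1 x by (auto simp: S)
        ultimately show ?thesis unfolding tensor_rels_def by blast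
      next
        case 2
        then have "act (free_tensor ?L) x f = ptensor (uea_of ?L (gen x * u)) (z + z')
            - ptensor (uea_of ?L (gen x * u)) z - ptensor (uea_of ?L (gen x * u)) z'"
          by (simp add: D T)
        moreover have "uea_of ?L (gen x * u) \<in> carrier (uea ?L)" using 2 x by (auto simp: S)
        ultimately show ?thesis unfolding tensor_rels_def by blast
      next
        case 3
        then have "act (free_tensor ?L) x f = ptensor (uea_scale ?L c (uea_of ?L (gen x * u))) z
            - pm_scale c (ptensor (uea_of ?L (gen x * u)) z)"
          using x by (simp add: D T C S pm_scale_mult)
        moreover have "uea_of ?L (gen x * u) \<in> carrier (uea ?L)" using 3 x by (auto simp: S)
        ultimately show ?thesis unfolding tensor_rels_def by blast
      next
        case 4
        then have "act (free_tensor ?L) x f = ptensor (uea_of ?L (gen x * u)) (c * z)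
            - pm_scale c (ptensor (uea_of ?L (gen x * u)) z)"
          by (simp add: D T C)
        moreover have "uea_of ?L (gen x * u) \<in> carrier (uea ?L)" using 4 x by (auto simp: S)
        ultimately show ?thesis unfolding tensor_rels_def by blast
      next
        case 5
        then have "act (free_tensor ?L) x f
            = ptensor (uea_of ?L (gen x * u) \<otimes>\<^bsub>uea ?L\<^esub> uea_incl ?L (uea_of (q_par n) h)) z
            - ptensor (uea_of ?L (gen x * u)) (uea_char (chi p) (uea_of (q_par n) h) * z)"
          using x by (simp add: D T S P mult.assoc)
        moreover have "uea_of ?L (gen x * u) \<in> carrier (uea ?L)" "uea_of (q_par n) h \<in> carrier (uea (q_par n))"
          using 5 x by (auto simp: S)
        ultimately show ?thesis unfolding tensor_rels_def by blast
      qed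
    qed
    ultimately show "f \<in> ?K" using tensor_rels_kernel by blast
  qed
  ultimately show ?thesis using tensor_kernel_minimal assms(2) by blast
qed

section \<open>The induced module is Fock space\<close>

lemma qact_fockn:
  assumes "x \<in> qalg n" "f \<in> fockn n" shows "qact n p x f \<in> fockn n"
  unfolding qact_def lext_def
proof (rule fockn_sum)
  fix a assume a: "a \<in> Poly_Mapping.keys x"
  obtain i j s where ijs: "a = (i, j, s)" by (cases a)
  with a assms(1) have "i \<le> n" "j \<le> n" by (auto simp: qalg_def q_span_def)
  then show "scal (Poly_Mapping.lookup x a) (case a of (i, j, s) \<Rightarrow> qop n p i j s f) \<in> fockn n"
    using ijs assms(2) by (auto intro!: fockn_scal fockn_qop)
qed

lemma arep_fockn:
  assumes "u \<in> FA (qalg n)" shows "arep n p u vac \<in> fockn n"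
  using assms
  by (induction rule: FA_induct)
    (auto simp: arep_simps arep_mult qact_fockn fockn_scal fockn_add simp del: plus_fun_apply zero_fun_apply)

text \<open>\<open>jcong n p f g\<close> says that \<open>f v\<^sub>0 = g v\<^sub>0\<close> in the induced module.\<close>

definition jcong :: "nat \<Rightarrow> nat \<Rightarrow> free_elem \<Rightarrow> free_elem \<Rightarrow> bool" where
  "jcong n p f g \<longleftrightarrow> f \<in> FA (qalg n) \<and> g \<in> FA (qalg n) \<and>
     ptensor (uea_of (qalg n) f) 1 - ptensor (uea_of (qalg n) g) 1 \<in> tensor_kernel (qalg n) (q_par n) (chi p)"

section \<open>Calculus of words applied to the cyclic vector\<close>

context
  fixes n p :: nat
begin

abbreviation (input) jc (infix "\<doteq>" 50) where "f \<doteq> g \<equiv> jcong n p f g"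

abbreviation (input) "LL \<equiv> qalg n"
abbreviation (input) "NN \<equiv> tensor_kernel LL (q_par n) (chi p)"
abbreviation (input) "TT f \<equiv> ptensor (uea_of LL f) 1"

lemmas NN_closed = tensor_kernel_closed[where n = n and p = p]

lemma uea_carrier: "f \<in> FA LL \<Longrightarrow> uea_of LL f \<in> carrier (uea LL)"
  by (simp add: uea_simps[OF subalg_qalg])

text \<open>Pure tensors are formal symbols here, so even additivity holds only modulo the
  kernel.\<close>

lemma TT_add: assumes "f \<in> FA LL" "g \<in> FA LL" shows "TT (f + g) - TT f - TT g \<in> NN"
proof -
  have "TT (f + g) - TT f - TT g = ptensor (uea_of LL f \<oplus>\<^bsub>uea LL\<^esub> uea_of LL g) 1 - TT f - TT g"
    using assms by (simp add: uea_simps[OF subalg_qalg])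
  also have "\<dots> \<in> tensor_rels LL (q_par n) (chi p)"
    using uea_carrier[OF assms(1)] uea_carrier[OF assms(2)] unfolding tensor_rels_def by blast
  finally show ?thesis using tensor_rels_kernel by blast
qed

lemma TT_scale: assumes "f \<in> FA LL" shows "TT (pm_scale c f) - pm_scale c (TT f) \<in> NN"
proof -
  have "TT (pm_scale c f) - pm_scale c (TT f) = ptensor (uea_scale LL c (uea_of LL f)) 1 - pm_scale c (TT f)"
    using assms by (simp add: uea_simps[OF subalg_qalg])
  also have "\<dots> \<in> tensor_rels LL (q_par n) (chi p)"
    using uea_carrier[OF assms(1)] unfolding tensor_rels_def by blast
  finally show ?thesis using tensor_rels_kernel by blast
qed

lemma jc_refl: "f \<in> FA LL \<Longrightarrow> f \<doteq> f"
  using NN_closed by (simp add: jcong_def)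

lemma jc_sym: "f \<doteq> g \<Longrightarrow> g \<doteq> f"
  using NN_closed(5)[of "TT f - TT g"] by (simp add: jcong_def)

lemma jc_trans [trans]: "f \<doteq> g \<Longrightarrow> g \<doteq> h \<Longrightarrow> f \<doteq> h"
  using NN_closed(3)[of "TT f - TT g" "TT g - TT h"] by (simp add: jcong_def)

lemma jc_eq_trans [trans]: "f = g \<Longrightarrow> g \<doteq> h \<Longrightarrow> f \<doteq> h" "f \<doteq> g \<Longrightarrow> g = h \<Longrightarrow> f \<doteq> h"
  by simp_all

lemma jc_FA: "f \<doteq> g \<Longrightarrow> f \<in> FA LL" "f \<doteq> g \<Longrightarrow> g \<in> FA LL"
  by (simp_all add: jcong_def)

lemma jc_add: assumes "f \<doteq> g" "f' \<doteq> g'" shows "f + f' \<doteq> g + g'"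
proof -
  have 1: "TT (f + f') - TT f - TT f' \<in> NN" and 2: "TT (g + g') - TT g - TT g' \<in> NN"
    using assms by (auto intro!: TT_add dest: jc_FA)
  have 3: "TT f - TT g \<in> NN" and 4: "TT f' - TT g' \<in> NN" using assms by (simp_all add: jcong_def)
  have "(TT (f + f') - TT f - TT f') - (TT (g + g') - TT g - TT g') + (TT f - TT g) + (TT f' - TT g') \<in> NN"
    by (rule NN_closed(3)[OF NN_closed(3)[OF NN_closed(6)[OF 1 2] 3] 4])
  then show ?thesis using assms by (simp add: jcong_def algebra_simps)
qed

lemma jc_scale: assumes "f \<doteq> g" shows "pm_scale c f \<doteq> pm_scale c g"
proof -
  have 1: "TT (pm_scale c f) - pm_scale c (TT f) \<in> NN" and 2: "TT (pm_scale c g) - pm_scale c (TT g) \<in> NN"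
    using assms by (auto intro!: TT_scale dest: jc_FA)
  have 3: "pm_scale c (TT f - TT g) \<in> NN"
    using assms by (intro NN_closed(4)) (simp add: jcong_def)
  have "(TT (pm_scale c f) - pm_scale c (TT f)) - (TT (pm_scale c g) - pm_scale c (TT g))
      + pm_scale c (TT f - TT g) \<in> NN"
    by (rule NN_closed(3)[OF NN_closed(6)[OF 1 2] 3])
  then show ?thesis using assms by (simp add: jcong_def pm_scale_simps algebra_simps)
qed

text \<open>The kernel is stable under the action, so congruent words stay congruent under left
  multiplication. Right multiplication has no such property in general, as it separates the word
  from the cyclic vector.\<close>

lemma jc_gen: assumes "x \<in> LL" "f \<doteq> g" shows "gen x * f \<doteq> gen x * g"
proof -
  have T: "act (free_tensor LL) x (TT f) = TT (gen x * f)" if "f \<in> FA LL" for f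
    using that assms(1) by (simp add: free_tensor_act uea_simps[OF subalg_qalg] ptensor_def)
  have "act (free_tensor LL) x (TT f - TT g) \<in> NN"
    using assms by (intro act_tensor_kernel) (simp_all add: jcong_def)
  also have "act (free_tensor LL) x (TT f - TT g) = TT (gen x * f) - TT (gen x * g)"
    using assms T jc_FA by (simp add: free_tensor_act push_diff)
  finally show ?thesis using assms by (simp add: jcong_def)
qed

lemma jc_ideal:
  assumes "f - g \<in> uea_ideal LL" "f \<in> FA LL" "g \<in> FA LL" shows "f \<doteq> g"
  using uea_of_cong[OF subalg_qalg assms(1)] NN_closed(2) assms(2,3) by (simp add: jcong_def)

lemma jc_rel:
  assumes "f - g \<in> uea_rels LL" "f \<in> FA LL" "g \<in> FA LL" "v \<in> FA LL" shows "f * v \<doteq> g * v"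
proof (rule jc_ideal)
  have "(f - g) * v \<in> uea_ideal LL"
    using assms(1,4) uea_rels_ideal[OF subalg_qalg] uea_ideal_closed(6)[OF subalg_qalg] by blast
  then show "f * v - g * v \<in> uea_ideal LL" by (simp add: left_diff_distrib)
qed (use assms in auto)

lemma qalg_add: "x \<in> LL \<Longrightarrow> y \<in> LL \<Longrightarrow> x + y \<in> LL"
  and qalg_scale: "x \<in> LL \<Longrightarrow> pm_scale c x \<in> LL"
  and qalg_bracket: "x \<in> LL \<Longrightarrow> y \<in> LL \<Longrightarrow> sbracket x y \<in> LL"
  using subalg_qalg by (auto simp: subalg_def)

lemma jc_gen_add:
  assumes "x \<in> LL" "y \<in> LL" "v \<in> FA LL" shows "gen (x + y) * v \<doteq> gen x * v + gen y * v"
  unfolding distrib_right[symmetric] using assms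
  by (intro jc_rel) (auto simp: uea_rels_def qalg_add diff_diff_add[symmetric])

lemma jc_gen_scale:
  assumes "x \<in> LL" "v \<in> FA LL" shows "gen (pm_scale c x) * v \<doteq> pm_scale c (gen x * v)"
  unfolding pm_scale_mult(1)[symmetric] using assms
  by (intro jc_rel) (auto simp: uea_rels_def qalg_scale)

lemma jc_bracket:
  assumes "x \<in> LL" "y \<in> LL" "x \<in> homog s" "y \<in> homog t" "v \<in> FA LL"
  shows "gen x * (gen y * v) \<doteq> pm_scale (ssign s t) (gen y * (gen x * v)) + gen (sbracket x y) * v"
proof -
  have "gen x * gen y - (pm_scale (ssign s t) (gen y * gen x) + gen (sbracket x y)) \<in> uea_rels LL"
    using assms unfolding uea_rels_def diff_diff_add[symmetric] by blast
  then have "(gen x * gen y) * v \<doteq> (pm_scale (ssign s t) (gen y * gen x) + gen (sbracket x y)) * v"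
    by (rule jc_rel) (use assms in \<open>auto simp: qalg_bracket\<close>)
  then show ?thesis by (simp add: distrib_right pm_scale_mult mult.assoc)
qed

lemma jc_gen_zero: "v \<in> FA LL \<Longrightarrow> gen 0 * v \<doteq> 0"
  using jc_gen_scale[of 0 v 0] by (simp add: pm_scale_simps qalg_def q_span_closed)

text \<open>Balancing moves \<open>gen x\<close> across the tensor sign, where it becomes the scalar
  \<open>chi p x\<close>; bilinearity brings the scalar back to the left.\<close>

lemma jc_vac: assumes "x \<in> q_par n" shows "gen x \<doteq> pm_scale (chi p x) 1"
proof -
  let ?c = "chi p x" and ?H = "q_par n"
  have xL: "x \<in> LL" using assms q_par_subset by blast
  have "uea_char (chi p) (uea_of ?H (gen x)) = ?c"
    using assms by (simp add: uea_char_of, simp add: free_char_def gen_def)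
  moreover have "uea_incl LL (uea_of ?H (gen x)) = uea_of LL (gen x)"
    by (rule uea_incl_of[OF subalg_q_par subalg_qalg q_par_subset])
  moreover have "uea_of LL 1 \<otimes>\<^bsub>uea LL\<^esub> uea_of LL (gen x) = uea_of LL (gen x)"
    using xL by (simp add: uea_simps[OF subalg_qalg])
  ultimately have "TT (gen x) - ptensor (uea_of LL 1) (?c * 1)
      = ptensor (uea_of LL 1 \<otimes>\<^bsub>uea LL\<^esub> uea_incl LL (uea_of ?H (gen x))) 1
       - ptensor (uea_of LL 1) (uea_char (chi p) (uea_of ?H (gen x)) * 1)"
    by simp
  also have "\<dots> \<in> tensor_rels LL ?H (chi p)"
  proof -
    have "uea_of LL 1 \<in> carrier (uea LL)" "uea_of ?H (gen x) \<in> carrier (uea ?H)"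
      using assms by (auto simp: uea_simps(1)[OF subalg_qalg] uea_simps(1)[OF subalg_q_par])
    then show ?thesis unfolding tensor_rels_def by blast
  qed
  finally have 1: "TT (gen x) - ptensor (uea_of LL 1) (?c * 1) \<in> NN" using tensor_rels_kernel by blast
  have "ptensor (uea_of LL 1) (?c * 1) - pm_scale ?c (TT 1) \<in> tensor_rels LL ?H (chi p)"
    using uea_carrier[of 1] unfolding tensor_rels_def by blast
  then have 2: "ptensor (uea_of LL 1) (?c * 1) - pm_scale ?c (TT 1) \<in> NN" using tensor_rels_kernel by blast
  have "(TT (gen x) - ptensor (uea_of LL 1) (?c * 1)) + (ptensor (uea_of LL 1) (?c * 1) - pm_scale ?c (TT 1))
      - (TT (pm_scale ?c 1) - pm_scale ?c (TT 1)) \<in> NN"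
    by (rule NN_closed(6)[OF NN_closed(3)[OF 1 2] TT_scale]) simp
  then show ?thesis using xL by (simp add: jcong_def)
qed

section \<open>Moving a creation operator to its place in an ordered word\<close>

lemma qE_homog: "qE i j s \<in> homog s"
  by (simp add: qE_def homog_def)

lemma sbracket_qE: "sbracket (qE i j s) (qE k l t) = basis_bracket (i, j, s) (k, l, t)"
  by (simp add: sbracket_def qE_def pm_scale_simps del: basis_bracket.simps)

lemma jc_raise_comm:
  assumes "i \<in> {1..n}" "j \<in> {1..n}" "v \<in> FA LL"
  shows "gen (qE i 0 s) * (gen (qE j 0 t) * v) \<doteq> pm_scale (ssign s t) (gen (qE j 0 t) * (gen (qE i 0 s) * v))"
proof -
  have "sbracket (qE i 0 s) (qE j 0 t) = 0"
    using assms by (simp add: sbracket_qE pm_scale_simps)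
  with jc_bracket[of "qE i 0 s" "qE j 0 t" s t v] assms
  have "gen (qE i 0 s) * (gen (qE j 0 t) * v) \<doteq> pm_scale (ssign s t) (gen (qE j 0 t) * (gen (qE i 0 s) * v)) + gen 0 * v"
    by (simp add: qE_homog)
  also have "\<dots> \<doteq> pm_scale (ssign s t) (gen (qE j 0 t) * (gen (qE i 0 s) * v)) + 0"
    using assms by (intro jc_add jc_refl jc_gen_zero) auto
  finally show ?thesis by simp
qed

text \<open>An odd creation operator supercommutes with itself, so its square is congruent to its
  own negative.\<close>

lemma jc_raise_sq:
  assumes "i \<in> {1..n}" "v \<in> FA LL"
  shows "gen (qE i 0 1) * (gen (qE i 0 1) * v) \<doteq> 0"
proof -
  let ?w = "gen (qE i 0 1) * (gen (qE i 0 1) * v)"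
  have w: "?w \<in> FA LL" using assms by auto
  have "?w + ?w \<doteq> pm_scale (ssign 1 1) ?w + ?w"
    by (intro jc_add jc_refl w jc_raise_comm assms)
  also have "pm_scale (ssign 1 1) ?w + ?w = 0" by (simp add: pm_scale_simps)
  finally have "pm_scale (1 / 2) (?w + ?w) \<doteq> pm_scale (1 / 2) 0" by (rule jc_scale)
  moreover have "pm_scale (1 / 2) (?w + ?w) = ?w"
    by (rule poly_mapping_eqI) (simp add: lookup_add)
  ultimately show ?thesis by (simp add: pm_scale_simps)
qed

lemma FA_pow: "x \<in> LL \<Longrightarrow> v \<in> FA LL \<Longrightarrow> gen x ^ m * v \<in> FA LL"
  by (induction m) (auto simp: mult.assoc)

lemma jc_pow: "x \<in> LL \<Longrightarrow> f \<doteq> g \<Longrightarrow> gen x ^ m * f \<doteq> gen x ^ m * g"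
  by (induction m) (auto simp: mult.assoc intro: jc_gen)

lemma jc_raise_pow:
  assumes "i \<in> {1..n}" "j \<in> {1..n}" "v \<in> FA LL"
  shows "gen (qE i 0 s) * (gen (qE j 0 t) ^ m * v) \<doteq> pm_scale (ssign s t ^ m) (gen (qE j 0 t) ^ m * (gen (qE i 0 s) * v))"
proof (induction m)
  case 0
  show ?case using assms by (auto simp: pm_scale_simps intro!: jc_refl)
next
  case (Suc m)
  let ?a = "gen (qE i 0 s)" and ?b = "gen (qE j 0 t)"
  have b: "qE j 0 t \<in> LL" using assms by simp
  have "?a * (?b * (?b ^ m * v)) \<doteq> pm_scale (ssign s t) (?b * (?a * (?b ^ m * v)))"
    using assms b by (intro jc_raise_comm FA_pow) auto
  also have "\<dots> \<doteq> pm_scale (ssign s t) (?b * pm_scale (ssign s t ^ m) (?b ^ m * (?a * v)))"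
    by (intro jc_scale jc_gen b Suc)
  finally show ?case by (simp add: pm_scale_mult pm_scale_simps mult.assoc)
qed

text \<open>The tail of the ordered word from index \<open>j\<close> on. Downward induction on
  \<open>j\<close> puts one more index in front of a tail that has already absorbed the
  generator.\<close>

definition mword :: "(nat \<Rightarrow> nat) \<Rightarrow> (nat \<Rightarrow> bool) \<Rightarrow> nat \<Rightarrow> free_elem" where
  "mword k l j = foldr (\<lambda>i v. gen (qE i 0 0) ^ k i * (gen (qE i 0 1) ^ of_bool (l i) * v)) [j..<Suc n] 1"

lemma mword_rec:
  "j \<le> n \<Longrightarrow> mword k l j = gen (qE j 0 0) ^ k j * (gen (qE j 0 1) ^ of_bool (l j) * mword k l (Suc j))"
  by (simp add: mword_def upt_conv_Cons del: upt_Suc)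

lemma mword_cong:
  assumes "\<And>i. i \<in> {j..n} \<Longrightarrow> k i = k' i \<and> l i = l' i" shows "mword k l j = mword k' l' j"
  unfolding mword_def by (rule foldr_cong) (use assms in auto)

lemma mword_FA: "mword k l j \<in> FA LL"
proof -
  have *: "foldr (\<lambda>i v. gen (qE i 0 0) ^ k i * (gen (qE i 0 1) ^ of_bool (l i) * v)) is 1 \<in> FA LL"
    if "set is \<subseteq> {..n}" for "is"
    using that by (induction "is") (auto intro!: FA_pow)
  show ?thesis unfolding mword_def by (rule *) auto
qed

lemma mword_bcr:
  assumes i: "i \<in> {1..n}" and "1 \<le> j" "j \<le> i"
  shows "gen (qE i 0 0) * mword k l j \<doteq> mword (k(i := Suc (k i))) l j"
  using assms(3,2)
proof (induction j rule: inc_induct)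
  case base
  have "mword (k(i := Suc (k i))) l (Suc i) = mword k l (Suc i)"
    by (rule mword_cong) auto
  then have "gen (qE i 0 0) * mword k l i = mword (k(i := Suc (k i))) l i"
    using i by (simp add: mword_rec mult.assoc)
  then show ?case using jc_refl[OF mword_FA] by metis
next
  case (step j)
  let ?a = "gen (qE i 0 0)" and ?b = "gen (qE j 0 0)" and ?f = "gen (qE j 0 1)"
  have j: "j \<in> {1..n}" "j \<noteq> i" "j \<le> n" using step i by auto
  have jL: "qE j 0 s \<in> LL" for s using j by simp
  have "?a * mword k l j = ?a * (?b ^ k j * (?f ^ of_bool (l j) * mword k l (Suc j)))"
    using j by (simp add: mword_rec)
  also have "\<dots> \<doteq> pm_scale (ssign 0 0 ^ k j) (?b ^ k j * (?a * (?f ^ of_bool (l j) * mword k l (Suc j))))"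
    by (intro jc_raise_pow i j FA_pow jL mword_FA)
  also have "\<dots> \<doteq> pm_scale (ssign 0 0 ^ k j) (?b ^ k j * (pm_scale (ssign 0 1 ^ of_bool (l j)) (?f ^ of_bool (l j) * (?a * mword k l (Suc j)))))"
    by (intro jc_scale jc_pow jc_raise_pow i j jL mword_FA)
  also have "\<dots> \<doteq> pm_scale (ssign 0 0 ^ k j) (?b ^ k j * (pm_scale (ssign 0 1 ^ of_bool (l j)) (?f ^ of_bool (l j) * mword (k(i := Suc (k i))) l (Suc j))))"
    by (intro jc_scale jc_pow jL step.IH) simp
  also have "\<dots> = mword (k(i := Suc (k i))) l j"
    using j by (simp add: mword_rec pm_scale_simps)
  finally show ?case .
qed

text \<open>The generator changes sign at every occupied fermion between \<open>j\<close> and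
  \<open>i - 1\<close>. At its own place it fills an empty slot or meets its equal and gives
  zero.\<close>

lemma mword_fcr:
  assumes i: "i \<in> {1..n}" and "1 \<le> j" "j \<le> i"
  shows "gen (qE i 0 1) * mword k l j \<doteq>
    (if l i then 0 else pm_scale (\<Prod>m\<in>{j..<i}. if l m then - 1 else 1) (mword k (l(i := True)) j))"
  using assms(3,2)
proof (induction j rule: inc_induct)
  case base
  let ?a = "gen (qE i 0 0)" and ?f = "gen (qE i 0 1)"
  have iL: "qE i 0 s \<in> LL" for s using i by simp
  have "?f * mword k l i = ?f * (?a ^ k i * (?f ^ of_bool (l i) * mword k l (Suc i)))"
    using i by (simp add: mword_rec)
  also have "\<dots> \<doteq> pm_scale (ssign 1 0 ^ k i) (?a ^ k i * (?f * (?f ^ of_bool (l i) * mword k l (Suc i))))"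
    by (intro jc_raise_pow i FA_pow iL mword_FA)
  also have "\<dots> = ?a ^ k i * (?f * (?f ^ of_bool (l i) * mword k l (Suc i)))"
    by (simp add: pm_scale_simps)
  also have "\<dots> \<doteq> (if l i then 0 else mword k (l(i := True)) i)"
  proof (cases "l i")
    case True
    have "?a ^ k i * (?f * (?f * mword k l (Suc i))) \<doteq> ?a ^ k i * 0"
      by (intro jc_pow jc_raise_sq i iL mword_FA)
    with True show ?thesis by simp
  next
    case False
    have "mword k (l(i := True)) (Suc i) = mword k l (Suc i)"
      by (rule mword_cong) auto
    then have "?a ^ k i * (?f * mword k l (Suc i)) = mword k (l(i := True)) i"
      using i by (simp add: mword_rec)
    with False show ?thesis using jc_refl[OF mword_FA] by simp
  qed
  finally show ?case by (cases "l i") (simp_all add: pm_scale_simps fun_upd_def)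
next
  case (step j)
  let ?a = "gen (qE i 0 1)" and ?b = "gen (qE j 0 0)" and ?f = "gen (qE j 0 1)"
  let ?c = "\<lambda>j. (\<Prod>m\<in>{j..<i}. if l m then - 1 else 1) :: complex"
  have j: "j \<in> {1..n}" "j \<noteq> i" "j \<le> n" using step i by auto
  have jL: "qE j 0 s \<in> LL" for s using j by simp
  have c: "?c j = (if l j then - 1 else 1) * ?c (Suc j)"
    using step by (simp add: prod.atLeast_Suc_lessThan)
  have "?a * mword k l j = ?a * (?b ^ k j * (?f ^ of_bool (l j) * mword k l (Suc j)))"
    using j by (simp add: mword_rec)
  also have "\<dots> \<doteq> pm_scale (ssign 1 0 ^ k j) (?b ^ k j * (?a * (?f ^ of_bool (l j) * mword k l (Suc j))))"
    by (intro jc_raise_pow i j FA_pow jL mword_FA)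
  also have "\<dots> \<doteq> pm_scale (ssign 1 0 ^ k j) (?b ^ k j * (pm_scale (ssign 1 1 ^ of_bool (l j)) (?f ^ of_bool (l j) * (?a * mword k l (Suc j)))))"
    by (intro jc_scale jc_pow jc_raise_pow i j jL mword_FA)
  also have "\<dots> \<doteq> pm_scale (ssign 1 0 ^ k j) (?b ^ k j * (pm_scale (ssign 1 1 ^ of_bool (l j)) (?f ^ of_bool (l j) *
       (if l i then 0 else pm_scale (?c (Suc j)) (mword k (l(i := True)) (Suc j))))))"
    by (intro jc_scale jc_pow jL step.IH) simp
  also have "\<dots> = (if l i then 0 else pm_scale (?c j) (mword k (l(i := True)) j))"
    using j by (auto simp: mword_rec pm_scale_simps pm_scale_mult c)
  finally show ?case .
qed

section \<open>The inverse map from Fock space to words\<close>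

definition psi :: "fock \<Rightarrow> free_elem" where
  "psi f = (\<Sum>(k, l)\<in>fsupp f. pm_scale (f k l) (mword k l 1))"

lemma psi_superset:
  "finite A \<Longrightarrow> fsupp f \<subseteq> A \<Longrightarrow> psi f = (\<Sum>(k, l)\<in>A. pm_scale (f k l) (mword k l 1))"
  unfolding psi_def by (rule sum.mono_neutral_left) (auto simp: fsupp_def pm_scale_simps)

lemma psi_add:
  assumes "f \<in> fockn n" "g \<in> fockn n" shows "psi (f + g) = psi f + psi g"
proof -
  let ?A = "fsupp f \<union> fsupp g"
  have A: "finite ?A" using assms by (simp add: fockn_def)
  have "psi (f + g) = (\<Sum>(k, l)\<in>?A. pm_scale ((f + g) k l) (mword k l 1))"
    by (rule psi_superset[OF A]) (auto simp: fsupp_def)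
  also have "\<dots> = (\<Sum>(k, l)\<in>?A. pm_scale (f k l) (mword k l 1)) + (\<Sum>(k, l)\<in>?A. pm_scale (g k l) (mword k l 1))"
    unfolding sum.distrib[symmetric] by (simp add: pm_scale_simps case_prod_unfold)
  also have "\<dots> = psi f + psi g"
    by (simp add: psi_superset[OF A, of f] psi_superset[OF A, of g])
  finally show ?thesis .
qed

lemma psi_scal:
  assumes "f \<in> fockn n" shows "psi (scal c f) = pm_scale c (psi f)"
proof -
  have "psi (scal c f) = (\<Sum>(k, l)\<in>fsupp f. pm_scale (scal c f k l) (mword k l 1))"
    using assms by (intro psi_superset) (auto simp: fsupp_def fockn_def scal_def)
  then show ?thesis by (simp add: psi_def pm_scale_sum scal_def pm_scale_simps case_prod_unfold)
qed

lemma psi_zero: "psi 0 = 0"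
  by (simp add: psi_def fsupp_def)

lemma psi_fmon: "psi (fmon k l) = mword k l 1"
  by (subst psi_superset[of "{(k, l)}"]) (auto simp: fsupp_def fmon_def pm_scale_simps)

lemma psi_vac: "psi vac = 1"
proof -
  have "foldr (\<lambda>i v. gen (qE i 0 0) ^ 0 * (gen (qE i 0 1) ^ of_bool False * v)) xs 1 = 1" for xs
    by (induction xs) auto
  then show ?thesis by (simp add: vac_def psi_fmon mword_def)
qed

lemma psi_FA: "f \<in> fockn n \<Longrightarrow> psi f \<in> FA LL"
  unfolding psi_def by (rule FA_sum) (auto simp: mword_FA)

lemma psi_raise:
  assumes "f \<in> fockn n" "i \<in> {1..n}"
  shows "psi (qop n p i 0 s f) \<doteq> gen (qE i 0 s) * psi f"
  using assms(1)
proof (induction rule: fockn_lin_induct)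
  case zero
  then show ?case by (simp add: lin_simps(3)[OF lin_qop] psi_zero jc_refl del: zero_fun_apply)
next
  case (add f g)
  then have "psi (qop n p i 0 s f) + psi (qop n p i 0 s g) \<doteq> gen (qE i 0 s) * psi f + gen (qE i 0 s) * psi g"
    by (intro jc_add)
  with add assms(2) show ?case
    by (simp add: lin_simps(1)[OF lin_qop] psi_add fockn_qop distrib_left del: plus_fun_apply)
next
  case (scal c f)
  then have "pm_scale c (psi (qop n p i 0 s f)) \<doteq> pm_scale c (gen (qE i 0 s) * psi f)"
    by (intro jc_scale)
  with scal assms(2) show ?case
    by (simp add: lin_simps(2)[OF lin_qop] psi_scal fockn_qop pm_scale_mult)
next
  case (fmon k l)
  consider "s = 0" | "s = 1" by (rule bit_cases)
  then show ?case
  proof cases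
    case 1
    then show ?thesis using jc_sym[OF mword_bcr[OF assms(2), of 1 k l]] assms(2)
      by (simp add: qop_def bcr_mon psi_fmon)
  next
    case 2
    \<comment> \<open>\<open>sgn_upto\<close> starts at index 0 and the word at index 1; the label
      is empty at 0.\<close>
    have "sgn_upto i l = (\<Prod>m\<in>{1..<i}. if l m then - 1 else 1)"
    proof -
      have "\<not> l 0" using fmon by (auto simp: labels_def)
      moreover have "{..<i} = insert 0 {1..<i}" using assms(2) by auto
      ultimately show ?thesis by (simp add: sgn_upto_def)
    qed
    moreover have "(k, l(i := True)) \<in> labels n" using fmon assms(2) by (auto simp: labels_def)
    ultimately have "psi (qop n p i 0 s (fmon k l))
        = (if l i then 0 else pm_scale (\<Prod>m\<in>{1..<i}. if l m then - 1 else 1) (mword k (l(i := True)) 1))"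
      using 2 assms(2) by (simp add: qop_def fcr_mon psi_zero psi_scal psi_fmon fmon_fockn)
    then show ?thesis using jc_sym[OF mword_fcr[OF assms(2), of 1 k l]] assms(2) 2
      by (simp add: psi_fmon)
  qed
qed

text \<open>Passes from generators to all of the algebra at one fixed vector, as an induction step
  needs for brackets, which combine several generators.\<close>

lemma psi_extend:
  assumes f: "f \<in> fockn n"
    and E: "\<And>i j s. i \<le> n \<Longrightarrow> j \<le> n \<Longrightarrow> psi (qop n p i j s f) \<doteq> gen (qE i j s) * psi f"
    and x: "x \<in> LL"
  shows "psi (qact n p x f) \<doteq> gen x * psi f"
proof -
  have "psi (qact n p (\<Sum>a\<in>A. Poly_Mapping.single a (h a)) f) \<doteq> gen (\<Sum>a\<in>A. Poly_Mapping.single a (h a)) * psi f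
      \<and> (\<Sum>a\<in>A. Poly_Mapping.single a (h a)) \<in> LL"
    if "finite A" "\<And>i j s. (i, j, s) \<in> A \<Longrightarrow> i \<le> n \<and> j \<le> n" for A h
    using that
  proof (induction A rule: finite_induct)
    case empty
    then show ?case
      using jc_sym[OF jc_gen_zero[OF psi_FA[OF f]]] by (simp add: qact_simps psi_zero qalg_def q_span_closed del: zero_fun_apply)
  next
    case (insert a A)
    obtain i j s where a: "a = (i, j, s)" by (cases a)
    then have ij: "i \<le> n" "j \<le> n" using insert.prems by auto
    let ?y = "\<Sum>a\<in>A. Poly_Mapping.single a (h a)" and ?z = "Poly_Mapping.single a (h a)"
    have z: "?z = pm_scale (h a) (qE i j s)" by (simp add: qE_def a)
    have zL: "?z \<in> LL" unfolding z using ij by (intro qalg_scale) simp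
    have IH: "psi (qact n p ?y f) \<doteq> gen ?y * psi f" "?y \<in> LL" using insert by auto
    have "psi (qact n p (?z + ?y) f) = pm_scale (h a) (psi (qop n p i j s f)) + psi (qact n p ?y f)"
      using f ij IH(2) by (simp add: qact_simps z psi_add psi_scal fockn_qop fockn_scal qact_fockn del: plus_fun_apply pm_scale_single)
    also have "\<dots> \<doteq> pm_scale (h a) (gen (qE i j s) * psi f) + gen ?y * psi f"
      by (intro jc_add jc_scale E ij IH)
    also have "\<dots> \<doteq> gen ?z * psi f + gen ?y * psi f"
      unfolding z using IH f ij by (intro jc_add jc_refl jc_sym[OF jc_gen_scale]) (auto simp: psi_FA)
    also have "\<dots> \<doteq> gen (?z + ?y) * psi f"
      using f by (intro jc_sym[OF jc_gen_add] zL IH psi_FA)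
    finally show ?case using insert zL IH qalg_add by simp
  qed
  from this[of "Poly_Mapping.keys x" "Poly_Mapping.lookup x"] x show ?thesis
    by (force simp: qalg_def q_span_def simp flip: poly_mapping_sum_single)
qed

text \<open>Let Y be the generator and X the creation operator. In Fock space and for words alike,
  YX is a signed XY plus the bracket. Y and the bracket then meet \<open>f\<close>, where
  equivariance is assumed for all generators, and the X in front is covered by
  \<open>psi_raise\<close>.\<close>

lemma psi_raise_step:
  assumes f: "f \<in> fockn n" and a: "a \<in> {1..n}"
    and E: "\<And>i j s. i \<le> n \<Longrightarrow> j \<le> n \<Longrightarrow> psi (qop n p i j s f) \<doteq> gen (qE i j s) * psi f"
    and ij: "i \<le> n" "j \<le> n"
  shows "psi (qop n p i j s (qop n p a 0 t f)) \<doteq> gen (qE i j s) * psi (qop n p a 0 t f)"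
proof -
  let ?z = "basis_bracket (i, j, s) (a, 0, t)" and ?Y = "gen (qE i j s)" and ?X = "gen (qE a 0 t)"
  have zL: "?z \<in> LL" using qalg_bracket[of "qE i j s" "qE a 0 t"] ij a by (simp add: sbracket_qE del: basis_bracket.simps)
  have XL: "qE a 0 t \<in> LL" using a by simp
  have zF: "gen ?z * psi f \<in> FA LL" by (intro FA_closed zL psi_FA f)
  have "qop n p i j s (qop n p a 0 t f) = scal (ssign s t) (qop n p a 0 t (qop n p i j s f)) + qact n p ?z f"
    using a ij by (subst qact_basis_bracket) auto
  then have "psi (qop n p i j s (qop n p a 0 t f))
      = pm_scale (ssign s t) (psi (qop n p a 0 t (qop n p i j s f))) + psi (qact n p ?z f)"
    using a ij f zL by (simp add: psi_add psi_scal fockn_qop fockn_scal qact_fockn del: plus_fun_apply basis_bracket.simps)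
  also have "\<dots> \<doteq> pm_scale (ssign s t) (?X * psi (qop n p i j s f)) + gen ?z * psi f"
    by (rule jc_add[OF jc_scale[OF psi_raise[OF fockn_qop[OF f ij] a]] psi_extend[OF f E zL]])
  also have "\<dots> \<doteq> pm_scale (ssign s t) (?X * (?Y * psi f)) + gen ?z * psi f"
    by (rule jc_add[OF jc_scale[OF jc_gen[OF XL E[OF ij]]] jc_refl[OF zF]])
  also have "\<dots> \<doteq> ?Y * (?X * psi f)"
    using a ij f jc_sym[OF jc_bracket[of "qE i j s" "qE a 0 t" s t "psi f"]]
    by (simp add: qE_homog sbracket_qE psi_FA del: basis_bracket.simps)
  also have "\<dots> \<doteq> ?Y * psi (qop n p a 0 t f)"
    using a ij f by (intro jc_gen jc_sym[OF psi_raise]) auto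
  finally show ?thesis .
qed

lemma psi_qop:
  assumes "f \<in> fockn n" "i \<le> n" "j \<le> n"
  shows "psi (qop n p i j s f) \<doteq> gen (qE i j s) * psi f"
  using assms
proof (induction arbitrary: i j s rule: fockn_induct)
  case (vac i j s)
  show ?case
  proof (cases "(i, j) \<in> {(0, 0)} \<union> {1..n} \<times> {1..n} \<union> {0} \<times> {1..n}")
    case True
    then have "qE i j s \<in> q_par n" by (simp add: q_par_def q_span_closed)
    then have "psi (qop n p i j s vac) = pm_scale (chi p (qE i j s)) 1"
      using qact_vac[of "qE i j s" n p] by (simp add: psi_scal psi_vac)
    then show ?thesis using jc_sym[OF jc_vac[OF \<open>qE i j s \<in> q_par n\<close>]] by (simp add: psi_vac)
  next
    case False
    then have "i \<in> {1..n}" "j = 0" using vac by auto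
    then show ?thesis using psi_raise[of vac i s] by simp
  qed
next
  case zero
  then show ?case by (simp add: lin_simps(3)[OF lin_qop] psi_zero jc_refl del: zero_fun_apply)
next
  case (add f g)
  then have "psi (qop n p i j s f) + psi (qop n p i j s g) \<doteq> gen (qE i j s) * psi f + gen (qE i j s) * psi g"
    by (intro jc_add) auto
  with add show ?case
    by (simp add: lin_simps(1)[OF lin_qop] psi_add fockn_qop distrib_left del: plus_fun_apply)
next
  case (scal c f)
  then have "pm_scale c (psi (qop n p i j s f)) \<doteq> pm_scale c (gen (qE i j s) * psi f)"
    by (intro jc_scale) auto
  with scal show ?case
    by (simp add: lin_simps(2)[OF lin_qop] psi_scal fockn_qop pm_scale_mult)
next
  case (bcr a f)
  then show ?case using psi_raise_step[of f a i j s 0] by (simp add: qop_def[of n p a 0 0])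
next
  case (fcr a f)
  then show ?case using psi_raise_step[of f a i j s 1] by (simp add: qop_def[of n p a 0 1])
qed

text \<open>Modulo the relations a word is determined by the vector it makes from the vacuum. This
  yields the injectivity of evaluation and shows that ordered words span.\<close>

lemma psi_arep:
  assumes "u \<in> FA LL" shows "psi (arep n p u vac) \<doteq> u"
  using assms
proof (induction rule: FA_induct)
  case zero
  then show ?case by (simp add: arep_simps psi_zero jc_refl del: zero_fun_apply)
next
  case one
  then show ?case by (simp add: psi_vac jc_refl)
next
  case (add f g)
  then show ?case using jc_add by (simp add: arep_simps psi_add arep_fockn del: plus_fun_apply)
next
  case (scale c f)
  then show ?case using jc_scale by (simp add: arep_simps psi_scal arep_fockn)
next
  case (gen x f)
  then have "psi (qact n p x (arep n p f vac)) \<doteq> gen x * psi (arep n p f vac)"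
    by (intro psi_extend psi_qop arep_fockn)
  also have "\<dots> \<doteq> gen x * f" using gen by (intro jc_gen)
  finally show ?case by (simp add: arep_mult)
qed

text \<open>Scalars in the right factor are absorbed by the left one, after which sums of tensors
  with right factor 1 merge.\<close>

lemma FT_rep:
  assumes "f \<in> FT LL"
  obtains u where "u \<in> FA LL" "f - TT u \<in> NN"
proof -
  have "\<exists>u\<in>FA LL. (\<Sum>a\<in>A. Poly_Mapping.single a (h a)) - TT u \<in> NN"
    if "finite A" "A \<subseteq> carrier (uea LL) \<times> UNIV" for A h
    using that
  proof (induction A rule: finite_induct)
    case empty
    \<comment> \<open>The tensor of the zero coset is a nonzero formal symbol; additivity at 0 + 0
      places its negative in the kernel.\<close>
    have "TT (0 + 0) - TT 0 - TT 0 \<in> NN" by (rule TT_add) auto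
    then show ?case by (intro bexI[of _ 0]) auto
  next
    case (insert a A)
    then obtain u where u: "u \<in> FA LL" "(\<Sum>a\<in>A. Poly_Mapping.single a (h a)) - TT u \<in> NN" by auto
    obtain g z where a: "a = (uea_of LL g, z)" "g \<in> FA LL"
      using insert by (auto simp: uea_simps[OF subalg_qalg])
    let ?c = "h a"
    have "ptensor (uea_of LL g) (z * 1) - pm_scale z (TT g) \<in> tensor_rels LL (q_par n) (chi p)"
      using uea_carrier[OF a(2)] unfolding tensor_rels_def by blast
    then have "ptensor (uea_of LL g) (z * 1) - pm_scale z (TT g) \<in> NN" using tensor_rels_kernel by blast
    then have 1: "pm_scale ?c (ptensor (uea_of LL g) (z * 1) - pm_scale z (TT g)) \<in> NN" by (rule NN_closed(4))
    have 2: "TT (pm_scale (?c * z) g) - pm_scale (?c * z) (TT g) \<in> NN" using a by (intro TT_scale)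
    have 3: "TT (pm_scale (?c * z) g + u) - TT (pm_scale (?c * z) g) - TT u \<in> NN" using a u by (intro TT_add) auto
    have "pm_scale ?c (ptensor (uea_of LL g) (z * 1) - pm_scale z (TT g))
       - (TT (pm_scale (?c * z) g) - pm_scale (?c * z) (TT g))
       - (TT (pm_scale (?c * z) g + u) - TT (pm_scale (?c * z) g) - TT u)
       + ((\<Sum>a\<in>A. Poly_Mapping.single a (h a)) - TT u) \<in> NN"
      by (rule NN_closed(3)[OF NN_closed(6)[OF NN_closed(6)[OF 1 2] 3] u(2)])
    moreover have "Poly_Mapping.single a ?c = pm_scale ?c (ptensor (uea_of LL g) (z * 1))"
      by (simp add: a ptensor_def)
    ultimately show ?case
      using insert(1,2) a u by (intro bexI[of _ "pm_scale (?c * z) g + u"]) (auto simp: pm_scale_simps algebra_simps)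
  qed
  from this[of "Poly_Mapping.keys f" "Poly_Mapping.lookup f"] assms that show ?thesis
    by (auto simp: FT_def simp flip: poly_mapping_sum_single)
qed

theorem ind_eval_kernel_iff:
  assumes "f \<in> FT LL" shows "f \<in> NN \<longleftrightarrow> ind_eval n p f = 0"
proof
  assume 0: "ind_eval n p f = 0"
  obtain u where u: "u \<in> FA LL" "f - TT u \<in> NN" using FT_rep[OF assms] .
  then have "ind_eval n p (f - TT u) = 0" by (intro ind_eval_kernel)
  with 0 u(1) have "arep n p u vac = 0" by (simp add: ind_eval_simps ind_eval_ptensor scal_simps)
  then have "0 \<doteq> u" using psi_arep[OF u(1)] by (simp add: psi_zero)
  then have 1: "TT 0 - TT u \<in> NN" by (simp add: jcong_def)
  have 2: "TT (0 + 0) - TT 0 - TT 0 \<in> NN" by (rule TT_add) auto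
  have "(f - TT u) - (TT 0 - TT u) - (TT (0 + 0) - TT 0 - TT 0) \<in> NN"
    by (rule NN_closed(6)[OF NN_closed(6)[OF u(2) 1] 2])
  then show "f \<in> NN" by simp
qed (rule ind_eval_kernel)

lemma ind_eval_fockn: assumes "f \<in> FT LL" shows "ind_eval n p f \<in> fockn n"
proof -
  obtain u where u: "u \<in> FA LL" "f - TT u \<in> NN" using FT_rep[OF assms] .
  then have "ind_eval n p (f - TT u) = 0" by (intro ind_eval_kernel)
  then have "ind_eval n p f = arep n p u vac"
    using u(1) by (simp add: ind_eval_simps ind_eval_ptensor scal_simps)
  then show ?thesis using arep_fockn[OF u(1)] by simp
qed

end

section \<open>Quotient modules\<close>

lemma subspace_iff:
  "VectorSpace.subspace class_ring N V \<longleftrightarrow> vectorspace (class_ring :: complex ring) V \<and> N \<subseteq> carrier V \<and> \<zero>\<^bsub>V\<^esub> \<in> N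
    \<and> (\<forall>v\<in>N. \<forall>w\<in>N. v \<oplus>\<^bsub>V\<^esub> w \<in> N) \<and> (\<forall>c. \<forall>v\<in>N. c \<odot>\<^bsub>V\<^esub> v \<in> N)"
  unfolding subspace_def submodule_def vectorspace_def by auto

locale quot_space =
  fixes V :: "'v qmodule" and N
  assumes sub: "VectorSpace.subspace class_ring N V"
begin

sublocale vectorspace "class_ring :: complex ring" V
  using sub by (simp add: subspace_iff)

abbreviation Q where "Q \<equiv> quot_module V N"
abbreviation proj where "proj v \<equiv> N +>\<^bsub>V\<^esub> v"

lemma smult_simps:
  "v \<in> carrier V \<Longrightarrow> 1 \<odot>\<^bsub>V\<^esub> v = v"
  "v \<in> carrier V \<Longrightarrow> (a + b) \<odot>\<^bsub>V\<^esub> v = a \<odot>\<^bsub>V\<^esub> v \<oplus>\<^bsub>V\<^esub> b \<odot>\<^bsub>V\<^esub> v"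
  using smult_one[of v] smult_l_distr[of a b v] by simp_all

lemma N_facts: "v \<in> N \<Longrightarrow> v \<in> carrier V" "\<zero>\<^bsub>V\<^esub> \<in> N" "v \<in> N \<Longrightarrow> w \<in> N \<Longrightarrow> v \<oplus>\<^bsub>V\<^esub> w \<in> N"
  "v \<in> N \<Longrightarrow> c \<odot>\<^bsub>V\<^esub> v \<in> N" 
  using sub by (auto simp: subspace_iff)

lemma N_uminus: "v \<in> N \<Longrightarrow> \<ominus>\<^bsub>V\<^esub> v \<in> N"
  using N_facts(4)[of v "- 1"] smult_minus_1[of v] N_facts(1)[of v] by (simp add: class_ring_simps)

lemma N_subgroup: "additive_subgroup N V"
  using N_facts N_uminus
  by (intro additive_subgroup.intro M.add.subgroupI) (auto simp: a_inv_def)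

lemma N_abelian_subgroup: "abelian_subgroup N V"
  using N_subgroup M.abelian_group_axioms by (intro abelian_subgroupI3)

lemma mem_proj: "v \<in> carrier V \<Longrightarrow> w \<in> proj v \<longleftrightarrow> (\<exists>h\<in>N. w = h \<oplus>\<^bsub>V\<^esub> v)"
  by (auto simp: a_r_coset_def')

lemma proj_eq_iff: "v \<in> carrier V \<Longrightarrow> w \<in> carrier V \<Longrightarrow> proj v = proj w \<longleftrightarrow> v \<ominus>\<^bsub>V\<^esub> w \<in> N"
proof -
  assume vw: "v \<in> carrier V" "w \<in> carrier V"
  interpret S: abelian_subgroup N V by (rule N_abelian_subgroup)
  have "v \<in> proj w \<longleftrightarrow> v \<ominus>\<^bsub>V\<^esub> w \<in> N"
    using S.a_rcos_module[OF vw(2,1)] by (simp add: a_minus_def)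
  moreover have "v \<in> proj w \<longleftrightarrow> proj v = proj w"
    using S.a_rcos_self[OF vw(1)] 
      M.a_repr_independence[OF _ vw(2) additive_subgroup.a_subgroup[OF N_subgroup], of v] by auto
  ultimately show ?thesis by simp
qed

lemma proj_shift: "h \<in> N \<Longrightarrow> v \<in> carrier V \<Longrightarrow> proj (h \<oplus>\<^bsub>V\<^esub> v) = proj v"
  using N_facts(1)[of h] M.add.m_assoc[of h v "\<ominus>\<^bsub>V\<^esub> v"] M.r_neg[of v]
  by (simp add: proj_eq_iff a_minus_def)

lemma quot_sel [simp]:
  "carrier Q = proj ` carrier V" "zero Q = N" "one Q = N" "add Q = (\<lambda>A B. A <+>\<^bsub>V\<^esub> B)"
  by (auto simp: quot_module_def A_RCOSETS_def')

lemma proj_zero: "proj \<zero>\<^bsub>V\<^esub> = N"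
  using N_facts(1) by (intro M.a_coset_add_zero) auto

lemma proj_add: "v \<in> carrier V \<Longrightarrow> w \<in> carrier V \<Longrightarrow> proj v \<oplus>\<^bsub>Q\<^esub> proj w = proj (v \<oplus>\<^bsub>V\<^esub> w)"
  using abelian_subgroup.a_rcos_sum[OF N_abelian_subgroup] by simp

text \<open>Operations of \<open>quot_module\<close> are unions over the members of a coset; all
  members give the same coset, so the union collapses to it.\<close>

lemma proj_union:
  assumes v: "v \<in> carrier V" and T: "\<And>w. w \<in> carrier V \<Longrightarrow> T w \<in> carrier V"
    "\<And>w. w \<in> N \<Longrightarrow> T w \<in> N"
    "\<And>u w. u \<in> carrier V \<Longrightarrow> w \<in> carrier V \<Longrightarrow> T (u \<oplus>\<^bsub>V\<^esub> w) = T u \<oplus>\<^bsub>V\<^esub> T w"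
  shows "(\<Union>w\<in>proj v. proj (T w)) = proj (T v)"
proof -
  have "proj (T w) = proj (T v)" if "w \<in> proj v" for w
    using that v T proj_shift N_facts(1) by (auto simp: mem_proj)
  moreover have "v \<in> proj v" using v N_facts(2) by (auto simp: mem_proj intro!: bexI[of _ "\<zero>\<^bsub>V\<^esub>"])
  ultimately show ?thesis by blast
qed

lemma proj_smult: "v \<in> carrier V \<Longrightarrow> c \<odot>\<^bsub>Q\<^esub> proj v = proj (c \<odot>\<^bsub>V\<^esub> v)"
  using proj_union[of v "\<lambda>w. c \<odot>\<^bsub>V\<^esub> w"] by (simp add: quot_module_def N_facts smult_r_distr)

lemma proj_act:
  assumes "v \<in> carrier V" "\<And>w. w \<in> carrier V \<Longrightarrow> act V x w \<in> carrier V"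
    "\<And>w. w \<in> N \<Longrightarrow> act V x w \<in> N"
    "\<And>u w. u \<in> carrier V \<Longrightarrow> w \<in> carrier V \<Longrightarrow> act V x (u \<oplus>\<^bsub>V\<^esub> w) = act V x u \<oplus>\<^bsub>V\<^esub> act V x w"
  shows "act Q x (proj v) = proj (act V x v)"
  unfolding quot_module_def by (simp, rule proj_union) (use assms in auto)

lemma quot_vectorspace: "vectorspace (class_ring :: complex ring) Q"
proof (rule vs_criteria)
  show "field (class_ring :: complex ring)" by (rule class_field.field_axioms)
  have neg: "proj v \<oplus>\<^bsub>Q\<^esub> proj (\<ominus>\<^bsub>V\<^esub> v) = N" if "v \<in> carrier V" for v
    using that by (simp only: proj_add M.a_inv_closed M.r_neg proj_zero)
  show "\<forall>v\<in>carrier Q. \<exists>w\<in>carrier Q. v \<oplus>\<^bsub>Q\<^esub> w = \<zero>\<^bsub>Q\<^esub>"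
  proof
    fix A assume "A \<in> carrier Q"
    then obtain v where v: "v \<in> carrier V" "A = proj v" by auto
    then show "\<exists>w\<in>carrier Q. A \<oplus>\<^bsub>Q\<^esub> w = \<zero>\<^bsub>Q\<^esub>"
      by (intro bexI[of _ "proj (\<ominus>\<^bsub>V\<^esub> v)"]) (use neg[OF v(1)] in auto)
  qed
  show "\<zero>\<^bsub>Q\<^esub> \<in> carrier Q" using proj_zero by auto
  have zero: "proj v \<oplus>\<^bsub>Q\<^esub> N = proj v" if "v \<in> carrier V" for v
    using proj_add[OF that M.zero_closed] that by (simp only: proj_zero M.r_zero)
  then show "\<forall>v\<in>carrier Q. v \<oplus>\<^bsub>Q\<^esub> \<zero>\<^bsub>Q\<^esub> = v" by auto
qed (auto simp: proj_add proj_smult smult_assoc_simp smult_simps smult_r_distr M.a_ac smult_assoc1[symmetric]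
    simp del: quot_sel(4))

end

lemma linear_mapI:
  assumes "vectorspace K V" "vectorspace K W" "\<And>v. v \<in> carrier V \<Longrightarrow> T v \<in> carrier W"
    "\<And>v w. v \<in> carrier V \<Longrightarrow> w \<in> carrier V \<Longrightarrow> T (v \<oplus>\<^bsub>V\<^esub> w) = T v \<oplus>\<^bsub>W\<^esub> T w"
    "\<And>c v. c \<in> carrier K \<Longrightarrow> v \<in> carrier V \<Longrightarrow> T (c \<odot>\<^bsub>V\<^esub> v) = c \<odot>\<^bsub>W\<^esub> T v"
  shows "linear_map K V W T"
  using assms unfolding linear_map_def mod_hom_def mod_hom_axioms_def vectorspace_def LinearCombinations.module_hom_def
  by blast

lemma subspace_rank_nullity:
  fixes V :: "'v qmodule" and W :: "'w qmodule"
  assumes S: "VectorSpace.subspace class_ring S V" and W: "vectorspace class_ring W"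
    and fd: "finite A" "A \<subseteq> S" "LinearCombinations.module.span class_ring V A = S"
    and T: "\<And>v. v \<in> S \<Longrightarrow> T v \<in> carrier W"
    "\<And>v w. v \<in> S \<Longrightarrow> w \<in> S \<Longrightarrow> T (v \<oplus>\<^bsub>V\<^esub> w) = T v \<oplus>\<^bsub>W\<^esub> T w"
    "\<And>c v. v \<in> S \<Longrightarrow> T (c \<odot>\<^bsub>V\<^esub> v) = c \<odot>\<^bsub>W\<^esub> T v"
  shows "subdim W (T ` S) + subdim V {v \<in> S. T v = \<zero>\<^bsub>W\<^esub>} = subdim V S"
proof -
  interpret V: vectorspace class_ring V using S by (simp add: subspace_iff)
  have vS: "vectorspace class_ring (V\<lparr>carrier := S\<rparr>)" using S by (rule V.subspace_is_vs)
  interpret T: linear_map class_ring "V\<lparr>carrier := S\<rparr>" W T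
    by (rule linear_mapI[OF vS W]) (use T in auto)
  \<comment> \<open>The given span is taken in the ambient space, whereas finite dimension refers to
    the subspace as a space of its own.\<close>
  have "LinearCombinations.module.span class_ring (V\<lparr>carrier := S\<rparr>) A = S"
    using V.span_li_not_depend(1)[OF fd(2)] S fd(3) by (simp add: subspace_def)
  then have "T.V.fin_dim" unfolding T.V.fin_dim_def using fd by (intro exI[of _ A]) auto
  from T.rank_nullity[OF this] show ?thesis
    by (simp add: subdim_def T.im_def T.ker_def)
qed

section \<open>Transport to Fock space\<close>

lemma quot_space_tensor:
  "quot_space (free_tensor (qalg n)) (tensor_kernel (qalg n) (q_par n) (chi p))"
  using tensor_kernel_submodule vectorspace_free_tensor by (simp add: quot_space_def subspace_def)

context
  fixes n p :: nat
begin

abbreviation (input) "VV \<equiv> Vbar n p"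
abbreviation (input) "cl f \<equiv> tensor_kernel (qalg n) (q_par n) (chi p) +>\<^bsub>free_tensor (qalg n)\<^esub> f"

interpretation tensor_quot: quot_space "free_tensor (qalg n)" "tensor_kernel (qalg n) (q_par n) (chi p)"
  by (rule quot_space_tensor)

definition toF :: "pre_ind set \<Rightarrow> fock" where
  "toF A = ind_eval n p (SOME f. f \<in> A)"

lemma cl_minus: "g \<in> FT (qalg n) \<Longrightarrow> f \<ominus>\<^bsub>free_tensor (qalg n)\<^esub> g = f - g"
  using tensor_quot.M.minus_equality[of "- g" g] by (simp add: a_minus_def FT_closed)

lemma cl_eq_iff: "f \<in> FT (qalg n) \<Longrightarrow> g \<in> FT (qalg n) \<Longrightarrow> cl f = cl g \<longleftrightarrow> ind_eval n p f = ind_eval n p g"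
  using tensor_quot.proj_eq_iff[of f g] ind_eval_kernel_iff[of "f - g" n p]
  by (simp add: cl_minus FT_closed ind_eval_simps)

lemma toF_cl: "f \<in> FT (qalg n) \<Longrightarrow> toF (cl f) = ind_eval n p f"
proof -
  assume f: "f \<in> FT (qalg n)"
  have "f \<in> cl f" using f NN_closed(2)[of n p] by (auto simp: tensor_quot.mem_proj intro!: bexI[of _ 0])
  then have "(SOME g. g \<in> cl f) \<in> cl f" by (rule someI)
  then obtain h where "h \<in> tensor_kernel (qalg n) (q_par n) (chi p)" "(SOME g. g \<in> cl f) = h + f"
    using f by (auto simp: tensor_quot.mem_proj)
  then show ?thesis by (simp add: toF_def ind_eval_simps ind_eval_kernel)
qed

lemma VV_eq: "VV = quot_module (free_tensor (qalg n)) (tensor_kernel (qalg n) (q_par n) (chi p))"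
  by (simp add: Vbar_def ind_module_def)

lemma VV_carrier: "carrier VV = cl ` FT (qalg n)"
  by (simp add: VV_eq)

lemma VV_space: "vectorspace class_ring VV"
  unfolding VV_eq by (rule tensor_quot.quot_vectorspace)

interpretation VV: vectorspace class_ring VV by (rule VV_space)

lemma toF_simps:
  "v \<in> carrier VV \<Longrightarrow> toF v \<in> fockn n"
  "v \<in> carrier VV \<Longrightarrow> w \<in> carrier VV \<Longrightarrow> toF (v \<oplus>\<^bsub>VV\<^esub> w) = toF v + toF w"
  "v \<in> carrier VV \<Longrightarrow> toF (c \<odot>\<^bsub>VV\<^esub> v) = scal c (toF v)"
  "toF \<zero>\<^bsub>VV\<^esub> = 0"
  "x \<in> qalg n \<Longrightarrow> v \<in> carrier VV \<Longrightarrow> act VV x v \<in> carrier VV"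
  "x \<in> qalg n \<Longrightarrow> v \<in> carrier VV \<Longrightarrow> toF (act VV x v) = qact n p x (toF v)"
proof -
  have z: "0 \<in> FT (qalg n)" by (rule FT_closed)
  show "toF \<zero>\<^bsub>VV\<^esub> = 0"
    using toF_cl[OF z] tensor_quot.proj_zero by (simp add: VV_eq ind_eval_simps)
  assume "v \<in> carrier VV"
  then obtain f where f: "f \<in> FT (qalg n)" "v = cl f" by (auto simp: VV_carrier)
  show "toF v \<in> fockn n" using f by (simp add: toF_cl ind_eval_fockn)
  show "toF (c \<odot>\<^bsub>VV\<^esub> v) = scal c (toF v)"
    using f tensor_quot.proj_smult[of f c] by (simp add: VV_eq toF_cl FT_closed ind_eval_simps)
  { assume "w \<in> carrier VV"
    then obtain g where g: "g \<in> FT (qalg n)" "w = cl g" by (auto simp: VV_carrier)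
    show "toF (v \<oplus>\<^bsub>VV\<^esub> w) = toF v + toF w"
      using f g tensor_quot.proj_add[of f g]
      by (simp add: VV_eq toF_cl FT_closed ind_eval_simps del: tensor_quot.quot_sel(4)) }
  assume x: "x \<in> qalg n"
  have a: "act VV x v = cl (act (free_tensor (qalg n)) x f)"
    unfolding VV_eq f(2) using f(1) x act_FT act_tensor_kernel
    by (intro tensor_quot.proj_act) (auto simp: free_tensor_act push_add)
  show "act VV x v \<in> carrier VV" unfolding a VV_carrier using x f by (simp add: act_FT)
  show "toF (act VV x v) = qact n p x (toF v)"
    unfolding a using x f by (simp add: toF_cl act_FT ind_eval_act)
qed

lemma toF_inj: "v \<in> carrier VV \<Longrightarrow> w \<in> carrier VV \<Longrightarrow> toF v = toF w \<Longrightarrow> v = w"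
  by (auto simp: VV_carrier toF_cl simp flip: cl_eq_iff)

lemma toF_v0: "v0 n p \<in> carrier VV" "toF (v0 n p) = vac"
proof -
  have *: "ptensor (uea_of (qalg n) 1) 1 \<in> FT (qalg n)"
    by (intro FT_closed uea_carrier) simp
  have v0: "v0 n p = cl (ptensor (uea_of (qalg n) 1) 1)"
    by (simp add: v0_def uea_simps[OF subalg_qalg])
  show "v0 n p \<in> carrier VV" using * by (simp add: v0 VV_carrier)
  show "toF (v0 n p) = vac" using * by (simp add: v0 toF_cl ind_eval_ptensor scal_simps)
qed

lemma toF_submodule_eq:
  assumes M: "M \<subseteq> carrier VV" "\<zero>\<^bsub>VV\<^esub> \<in> M" "\<And>v w. v \<in> M \<Longrightarrow> w \<in> M \<Longrightarrow> v \<oplus>\<^bsub>VV\<^esub> w \<in> M"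
    "\<And>c v. v \<in> M \<Longrightarrow> c \<odot>\<^bsub>VV\<^esub> v \<in> M"
  shows "0 \<in> toF ` M" "f \<in> toF ` M \<Longrightarrow> g \<in> toF ` M \<Longrightarrow> f + g \<in> toF ` M"
    "f \<in> toF ` M \<Longrightarrow> scal c f \<in> toF ` M"
    "(\<And>i. i \<in> A \<Longrightarrow> h i \<in> toF ` M) \<Longrightarrow> sum h A \<in> toF ` M"
proof -
  show 0: "0 \<in> toF ` M" using M toF_simps(4) by force
  show add: "f + g \<in> toF ` M" if "f \<in> toF ` M" "g \<in> toF ` M" for f g
    using that M toF_simps(2) by (smt (verit) image_iff subset_iff)
  show "f \<in> toF ` M \<Longrightarrow> scal c f \<in> toF ` M" for f
    using M toF_simps(3) by (smt (verit) image_iff subset_iff)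
  show "sum h A \<in> toF ` M" if "\<And>i. i \<in> A \<Longrightarrow> h i \<in> toF ` M"
    using that
    by (induction A rule: infinite_finite_induct) (auto simp: 0 simp del: plus_fun_apply zero_fun_apply intro!: add)
qed

lemma submodule_image:
  assumes "is_submodule n VV M"
  shows "fock_submodule n p (toF ` M)" "v0 n p \<in> M \<Longrightarrow> fockn n \<subseteq> toF ` M"
    "v0 n p \<in> M \<Longrightarrow> M = carrier VV"
proof -
  have S: "M \<subseteq> carrier VV" "\<zero>\<^bsub>VV\<^esub> \<in> M" "\<And>v w. v \<in> M \<Longrightarrow> w \<in> M \<Longrightarrow> v \<oplus>\<^bsub>VV\<^esub> w \<in> M"
    "\<And>c v. v \<in> M \<Longrightarrow> c \<odot>\<^bsub>VV\<^esub> v \<in> M" and a: "\<And>x v. x \<in> qalg n \<Longrightarrow> v \<in> M \<Longrightarrow> act VV x v \<in> M"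
    using assms by (auto simp: is_submodule_def subspace_iff)
  show F: "fock_submodule n p (toF ` M)"
  proof
    show "toF ` M \<subseteq> fockn n" using S toF_simps(1) by auto
    fix f i j s assume "f \<in> toF ` M" "i \<le> n" "j \<le> n"
    then obtain v where v: "v \<in> M" "f = toF v" "v \<in> carrier VV" using S by auto
    then have "qop n p i j s f = toF (act VV (qE i j s) v)"
      using \<open>i \<le> n\<close> \<open>j \<le> n\<close> by (simp add: toF_simps)
    then show "qop n p i j s f \<in> toF ` M" using a v \<open>i \<le> n\<close> \<open>j \<le> n\<close> by simp
  qed (use toF_submodule_eq[OF S] in auto)
  assume v0: "v0 n p \<in> M"
  interpret fock_submodule n p "toF ` M" by (rule F)
  have "f \<in> toF ` M" if "f \<in> fockn n" for f
    using that
  proof (induction rule: fockn_induct)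
    case vac
    then show ?case using v0 toF_v0(2) by force
  next
    case (bcr i f)
    then show ?case using M_qop[of f i 0 0] by (simp add: qop_def)
  next
    case (fcr i f)
    then show ?case using M_qop[of f i 0 1] by (simp add: qop_def)
  next
    case (add f g)
    then show ?case by (intro M_add)
  next
    case (scal c f)
    then show ?case by (intro M_scal)
  next
    case zero
    then show ?case by (rule M_zero)
  qed
  then show sub: "fockn n \<subseteq> toF ` M" by blast
  show "M = carrier VV"
    using sub S(1) toF_simps(1) toF_inj by (smt (verit) image_iff subsetD subsetI subset_antisym)
qed

lemma carrier_submodule: "is_submodule n VV (carrier VV)"
  using VV_space by (auto simp: is_submodule_def subspace_iff toF_simps)

text \<open>The carrier is itself a submodule containing \<open>v0 n p\<close>, so its image
  contains the vacuum and all that creation operators make of it.\<close>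

lemma toF_image: "toF ` carrier VV = fockn n"
  using submodule_image(2)[OF carrier_submodule toF_v0(1)] toF_simps(1) by blast

lemma toF_surj: assumes "f \<in> fockn n" obtains v where "v \<in> carrier VV" "toF v = f"
proof -
  from assms have "f \<in> toF ` carrier VV" by (simp only: toF_image)
  then obtain v where "f = toF v" "v \<in> carrier VV" by (rule imageE)
  with that show ?thesis by simp
qed

lemma toF_group:
  "v \<in> carrier VV \<Longrightarrow> toF (\<ominus>\<^bsub>VV\<^esub> v) = - toF v"
  "v \<in> carrier VV \<Longrightarrow> w \<in> carrier VV \<Longrightarrow> toF (v \<ominus>\<^bsub>VV\<^esub> w) = toF v - toF w"
  "(\<And>i. i \<in> A \<Longrightarrow> h i \<in> carrier VV) \<Longrightarrow> toF (\<Oplus>\<^bsub>VV\<^esub>i\<in>A. h i) = (\<Sum>i\<in>A. toF (h i))"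
proof -
  show m: "toF (\<ominus>\<^bsub>VV\<^esub> v) = - toF v" if "v \<in> carrier VV" for v
  proof -
    have "toF v + toF (\<ominus>\<^bsub>VV\<^esub> v) = 0"
      using that toF_simps(2)[of v "\<ominus>\<^bsub>VV\<^esub> v"] toF_simps(4) VV.M.r_neg[OF that] by simp
    then show ?thesis by (simp add: eq_neg_iff_add_eq_0 add.commute)
  qed
  show "v \<in> carrier VV \<Longrightarrow> w \<in> carrier VV \<Longrightarrow> toF (v \<ominus>\<^bsub>VV\<^esub> w) = toF v - toF w"
    by (simp add: a_minus_def toF_simps m)
  show "toF (\<Oplus>\<^bsub>VV\<^esub>i\<in>A. h i) = (\<Sum>i\<in>A. toF (h i))" if "\<And>i. i \<in> A \<Longrightarrow> h i \<in> carrier VV"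
  proof (cases "finite A")
    case True
    then show ?thesis using that
    proof (induction A rule: finite_induct)
      case (insert x F)
      then have "(\<Oplus>\<^bsub>VV\<^esub>i\<in>insert x F. h i) = h x \<oplus>\<^bsub>VV\<^esub> (\<Oplus>\<^bsub>VV\<^esub>i\<in>F. h i)"
        by (intro VV.M.finsum_insert) auto
      moreover have "(\<Oplus>\<^bsub>VV\<^esub>i\<in>F. h i) \<in> carrier VV" using insert by (intro VV.M.finsum_closed) auto
      ultimately have "toF (\<Oplus>\<^bsub>VV\<^esub>i\<in>insert x F. h i) = toF (h x) + (\<Sum>i\<in>F. toF (h i))"
        using insert by (simp add: toF_simps del: plus_fun_apply)
      also have "\<dots> = (\<Sum>i\<in>insert x F. toF (h i))" using insert by (simp del: plus_fun_apply)
      finally show ?case .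
    next
      case empty
      have "(\<Oplus>\<^bsub>VV\<^esub>i\<in>{}. h i) = \<zero>\<^bsub>VV\<^esub>" by simp
      then have "toF (\<Oplus>\<^bsub>VV\<^esub>i\<in>{}. h i) = (\<Sum>i\<in>{}. toF (h i))" by (simp only: toF_simps sum.empty)
      then show ?case .
    qed
  next
    case False
    then show ?thesis by (simp add: toF_simps VV.M.finsum_infinite)
  qed
qed

lemma maxsub_sum: "(\<And>i. i \<in> A \<Longrightarrow> h i \<in> maxsub n p) \<Longrightarrow> sum h A \<in> maxsub n p"
  by (induction A rule: infinite_finite_induct)
    (auto simp: maxsub_lin simp del: plus_fun_apply zero_fun_apply)

lemma maxsub_qact:
  assumes "x \<in> qalg n" "f \<in> maxsub n p" shows "qact n p x f \<in> maxsub n p"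
  unfolding qact_def lext_def
proof (rule maxsub_sum)
  fix a assume a: "a \<in> Poly_Mapping.keys x"
  obtain i j s where ijs: "a = (i, j, s)" by (cases a)
  with a assms(1) have "i \<le> n" "j \<le> n" by (auto simp: qalg_def q_span_def)
  then show "scal (Poly_Mapping.lookup x a) (case a of (i, j, s) \<Rightarrow> qop n p i j s f) \<in> maxsub n p"
    using ijs assms(2) by (auto intro!: maxsub_lin maxsub_qop)
qed

text \<open>The candidate misses the vacuum since p is positive. A proper submodule misses it too,
  because \<open>v0 n p\<close> generates everything; so the candidate bounds all of them and
  \<open>GREATEST\<close> is attained.\<close>

lemma Mp_eq:
  assumes "p \<ge> 1" shows "Mp n p = {v \<in> carrier VV. toF v \<in> maxsub n p}"
  unfolding Mp_def
proof (rule Greatest_equality)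
  let ?M = "{v \<in> carrier VV. toF v \<in> maxsub n p}"
  have "is_submodule n VV ?M"
    using VV_space by (auto simp: is_submodule_def subspace_iff toF_simps maxsub_lin maxsub_qact)
  moreover have "v0 n p \<notin> ?M" using vac_not_maxsub[OF assms] by (simp add: toF_v0)
  ultimately show "is_submodule n VV ?M \<and> ?M \<noteq> carrier VV" using toF_v0(1) by blast
next
  fix M assume M: "is_submodule n VV M \<and> M \<noteq> carrier VV"
  then have sub: "M \<subseteq> carrier VV" by (auto simp: is_submodule_def subspace_iff)
  interpret fock_submodule n p "toF ` M" using M by (intro submodule_image) simp
  have "vac \<notin> toF ` M"
  proof
    assume "vac \<in> toF ` M"
    then obtain v where "v \<in> M" "toF v = vac" by auto
    then have "v0 n p \<in> M" using toF_inj[of v "v0 n p"] sub toF_v0 by auto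
    then show False using submodule_image(3) M by blast
  qed
  then show "M \<subseteq> {v \<in> carrier VV. toF v \<in> maxsub n p}" using maxsub_greatest sub by blast
qed

section \<open>Weight spaces and kets in Fock coordinates\<close>

lemma weight_space_eq:
  "weight_space n VV (lambda_wt n p m) = {v \<in> carrier VV. toF v \<in> wspace n m}"
proof -
  have "act VV (qE i i 0) v = lambda_wt n p m i \<odot>\<^bsub>VV\<^esub> v \<longleftrightarrow> qop n p i i 0 (toF v) = scal (lambda_wt n p m i) (toF v)"
    if "v \<in> carrier VV" "i \<le> n" for i v
  proof -
    have "act VV (qE i i 0) v = lambda_wt n p m i \<odot>\<^bsub>VV\<^esub> v
        \<longleftrightarrow> toF (act VV (qE i i 0) v) = toF (lambda_wt n p m i \<odot>\<^bsub>VV\<^esub> v)"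
    proof
      have "act VV (qE i i 0) v \<in> carrier VV" using that by (simp add: toF_simps)
      moreover have "lambda_wt n p m i \<odot>\<^bsub>VV\<^esub> v \<in> carrier VV" using that by simp
      moreover assume "toF (act VV (qE i i 0) v) = toF (lambda_wt n p m i \<odot>\<^bsub>VV\<^esub> v)"
      ultimately show "act VV (qE i i 0) v = lambda_wt n p m i \<odot>\<^bsub>VV\<^esub> v" by (rule toF_inj)
    qed simp
    then show ?thesis using that by (simp add: toF_simps)
  qed
  then show ?thesis
    by (auto simp: weight_space_def wspace_iff[of _ n m p] toF_simps(1))
qed

lemma act_funpow:
  assumes "x \<in> qalg n" "v \<in> carrier VV"
  shows "(act VV x ^^ m) v \<in> carrier VV \<and> toF ((act VV x ^^ m) v) = (qact n p x ^^ m) (toF v)"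
  using assms by (induction m) (auto simp: toF_simps)

lemma ket_aux:
  assumes "set is \<subseteq> {1..n}"
  shows "foldr (\<lambda>i v. (act VV (qE i 0 0) ^^ k i) ((act VV (qE i 0 1) ^^ l i) v)) is (v0 n p) \<in> carrier VV
    \<and> toF (foldr (\<lambda>i v. (act VV (qE i 0 0) ^^ k i) ((act VV (qE i 0 1) ^^ l i) v)) is (v0 n p))
      = foldr (\<lambda>i f. (bcr i ^^ k i) ((fcr i ^^ l i) f)) is vac"
  using assms
proof (induction "is")
  case Nil
  then show ?case using toF_v0 by simp
next
  case (Cons i "is")
  have "qact n p (qE i 0 0) = bcr i" "qact n p (qE i 0 1) = fcr i"
    using Cons.prems by (auto simp: fun_eq_iff qop_def)
  then show ?case using Cons act_funpow[of "qE i 0 s" for s] by (simp add: act_funpow)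
qed

lemma ket_carrier: "ket n p k l \<in> carrier VV"
  unfolding ket_def using ket_aux[of "[1..<Suc n]" k l] by (simp add: atLeastLessThanSuc_atLeastAtMost del: upt_Suc)

lemma bcr_pow_fmon: "(bcr i ^^ m) (fmon k l) = fmon (k(i := k i + m)) l"
  by (induction m) (auto simp: bcr_mon intro!: arg_cong[where f = "\<lambda>k. fmon k l"])

text \<open>The labels of \<open>ket\<close> are arbitrary outside \<open>{1..n}\<close>; truncation
  makes them canonical. The lower end \<open>j\<close> follows the partial products in
  \<open>foldr_ket\<close>.\<close>

definition trk :: "(nat \<Rightarrow> nat) \<Rightarrow> nat \<Rightarrow> nat \<Rightarrow> nat" where
  "trk k j = (\<lambda>i. if i \<in> {j..n} then k i else 0)"

definition trl :: "(nat \<Rightarrow> nat) \<Rightarrow> nat \<Rightarrow> nat \<Rightarrow> bool" where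
  "trl l j = (\<lambda>i. i \<in> {j..n} \<and> l i = 1)"

lemma foldr_ket:
  assumes "\<forall>i\<in>{1..n}. l i \<in> {0, 1}" "j \<le> Suc n" "1 \<le> j"
  shows "foldr (\<lambda>i f. (bcr i ^^ k i) ((fcr i ^^ l i) f)) [j..<Suc n] vac = fmon (trk k j) (trl l j)"
  using assms(2,3)
proof (induction j rule: inc_induct)
  case base
  then show ?case by (auto simp: vac_def trk_def trl_def)
next
  case (step j)
  have "foldr (\<lambda>i f. (bcr i ^^ k i) ((fcr i ^^ l i) f)) [j..<Suc n] vac
      = (bcr j ^^ k j) ((fcr j ^^ l j) (fmon (trk k (Suc j)) (trl l (Suc j))))"
    using step by (simp add: upt_conv_Cons del: upt_Suc)
  also have "(fcr j ^^ l j) (fmon (trk k (Suc j)) (trl l (Suc j))) = fmon (trk k (Suc j)) (trl l j)"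
  proof -
    have "l j = 0 \<or> l j = 1" using assms(1) step by auto
    then show ?thesis
    proof
      assume "l j = 0"
      then have "trl l (Suc j) = trl l j" by (auto simp: trl_def fun_eq_iff Suc_le_eq le_less)
      with \<open>l j = 0\<close> show ?thesis by simp
    next
      assume l: "l j = 1"
      \<comment> \<open>The product is built from the right, so no fermion of index below
        \<open>j\<close> is occupied yet and no sign arises.\<close>
      have "sgn_upto j (trl l (Suc j)) = 1" unfolding sgn_upto_def
        by (rule prod.neutral) (auto simp: trl_def)
      moreover have "(trl l (Suc j))(j := True) = trl l j"
        using l step by (auto simp: trl_def fun_eq_iff)
      ultimately show ?thesis using l by (simp add: fcr_mon trl_def scal_simps)
    qed
  qed
  also have "(bcr j ^^ k j) (fmon (trk k (Suc j)) (trl l j)) = fmon (trk k j) (trl l j)"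
  proof -
    have "(trk k (Suc j))(j := trk k (Suc j) j + k j) = trk k j"
      using step by (auto simp: trk_def fun_eq_iff)
    then show ?thesis by (simp add: bcr_pow_fmon)
  qed
  finally show ?case .
qed

lemma toF_ket:
  assumes "\<forall>i\<in>{1..n}. l i \<in> {0, 1}"
  shows "toF (ket n p k l) = fmon (trk k 1) (trl l 1)"
  unfolding ket_def using ket_aux[of "[1..<Suc n]" k l] foldr_ket[OF assms, of 1 k]
  by (simp add: atLeastLessThanSuc_atLeastAtMost del: upt_Suc)

end

section \<open>The vectors \<open>X\<close>\<close>

lemma sgn_upto_trl:
  assumes "\<forall>i\<in>{1..n}. l i \<in> {0, 1}" "i \<le> n"
  shows "sgn_upto (Suc i) (trl n l 1) = (- 1) ^ (\<Sum>j=1..i. l j)"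
  using assms(2)
proof (induction i)
  case 0
  then show ?case by (simp add: sgn_upto_def trl_def)
next
  case (Suc i)
  have "l (Suc i) = 0 \<or> l (Suc i) = 1" using assms(1) Suc.prems by auto
  then show ?case using Suc by (auto simp: sgn_upto_def trl_def)
qed

lemma trk_upd: "i \<in> {1..n} \<Longrightarrow> trk n (k(i := a)) 1 = (trk n k 1)(i := a)"
  by (auto simp: trk_def)

lemma trl_upd: "i \<in> {1..n} \<Longrightarrow> trl n (l(i := a)) 1 = (trl n l 1)(i := (a = 1))"
  by (auto simp: trl_def)

lemma Xvec_e00:
  assumes l: "\<forall>i\<in>{1..n}. l i \<in> {0, 1}"
  shows "Xvec n p k l \<in> carrier (Vbar n p)"
    "toF n p (Xvec n p k l) = e00 n p (fmon (trk n k 1) (trl n l 1))"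
proof -
  interpret VV: vectorspace class_ring "Vbar n p" by (rule VV_space)
  let ?K = "trk n k 1" and ?L = "trl n l 1" and ?F = "fmon (trk n k 1) (trl n l 1)"
  let ?a = "((- 1) ^ (\<Sum>i=1..n. l i) * complex_of_real (sqrt (real p)))"
  let ?b = "\<lambda>i. ((- 1) ^ (\<Sum>j=1..i. l j) * of_nat (l i)) :: complex"
  let ?c = "\<lambda>i. ((- 1) ^ (\<Sum>j=1..i. l j) * (if l i = 0 then of_nat (k i) else 0)) :: complex"
  let ?u = "\<lambda>i. ket n p (k(i := k i + 1)) (l(i := l i - 1))"
  let ?v = "\<lambda>i. ket n p (k(i := k i - 1)) (l(i := l i + 1))"
  have C: "?b i \<odot>\<^bsub>Vbar n p\<^esub> ?u i \<in> carrier (Vbar n p)" "?c i \<odot>\<^bsub>Vbar n p\<^esub> ?v i \<in> carrier (Vbar n p)"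
    "?a \<odot>\<^bsub>Vbar n p\<^esub> ket n p k l \<in> carrier (Vbar n p)" for i
    using VV.smult_closed ket_carrier by auto
  have S: "(\<Oplus>\<^bsub>Vbar n p\<^esub>i\<in>{1..n}. ?b i \<odot>\<^bsub>Vbar n p\<^esub> ?u i) \<in> carrier (Vbar n p)"
    "(\<Oplus>\<^bsub>Vbar n p\<^esub>i\<in>{1..n}. ?c i \<odot>\<^bsub>Vbar n p\<^esub> ?v i) \<in> carrier (Vbar n p)"
    using C by (auto intro!: VV.M.finsum_closed)
  show "Xvec n p k l \<in> carrier (Vbar n p)"
    unfolding Xvec_def using C S by (intro VV.M.minus_closed)
  have "toF n p (Xvec n p k l) = scal ?a ?F - (\<Sum>i=1..n. scal (?b i) (toF n p (?u i)))
      - (\<Sum>i=1..n. scal (?c i) (toF n p (?v i)))"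
    unfolding Xvec_def using C S
    by (simp only: toF_group VV.M.minus_closed toF_simps(3) ket_carrier toF_ket[OF l])
  also have "(\<Sum>i=1..n. scal (?b i) (toF n p (?u i))) = (\<Sum>i=1..n. - bcr i (fan i ?F))"
  proof (rule sum.cong)
    fix i assume i: "i \<in> {1..n}"
    have "l i = 0 \<or> l i = 1" using l i by auto
    then show "scal (?b i) (toF n p (?u i)) = - bcr i (fan i ?F)"
    proof
      assume "l i = 0"
      then show ?thesis by (simp add: fan_mon trl_def scal_simps op_lin)
    next
      assume li: "l i = 1"
      have "\<forall>j\<in>{1..n}. (l(i := l i - 1)) j \<in> {0, 1}" using l li by auto
      then have "toF n p (?u i) = fmon (?K(i := Suc (k i))) (?L(i := False))"
        using i li by (simp add: toF_ket trk_upd[unfolded One_nat_def] trl_upd[unfolded One_nat_def])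
      \<comment> \<open>The exponent in \<open>Xvec\<close> includes \<open>l i = 1\<close>, while
        the Jordan-Wigner sign stops before \<open>i\<close>; hence the minus. In the other sum
        \<open>l i = 0\<close> and the two signs agree.\<close>
      moreover have "?b i = - sgn_upto i ?L"
        using sgn_upto_trl[OF l, of i, symmetric] i li by (simp add: sgn_upto_def trl_def)
      moreover have "?K i = k i" "?L i" using i li by (auto simp: trk_def trl_def)
      ultimately show ?thesis by (simp add: fan_mon bcr_mon op_lin scal_simps)
    qed
  qed simp
  also have "(\<Sum>i=1..n. scal (?c i) (toF n p (?v i))) = (\<Sum>i=1..n. fcr i (ban i ?F))"
  proof (rule sum.cong)
    fix i assume i: "i \<in> {1..n}"
    have "l i = 0 \<or> l i = 1" using l i by auto
    then show "scal (?c i) (toF n p (?v i)) = fcr i (ban i ?F)"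
    proof
      assume "l i = 1"
      then show ?thesis using i by (simp add: ban_mon fcr_mon trl_def scal_simps op_lin)
    next
      assume li: "l i = 0"
      have "\<forall>j\<in>{1..n}. (l(i := l i + 1)) j \<in> {0, 1}" using l li by auto
      then have "toF n p (?v i) = fmon (?K(i := k i - 1)) (?L(i := True))"
        using i li by (simp add: toF_ket trk_upd[unfolded One_nat_def] trl_upd[unfolded One_nat_def])
      moreover have "(- 1) ^ (\<Sum>j=1..i. l j) = sgn_upto i ?L"
        using sgn_upto_trl[OF l, of i, symmetric] i li by (simp add: sgn_upto_def trl_def)
      moreover have "?K i = k i" "\<not> ?L i" using i li by (auto simp: trk_def trl_def)
      ultimately show ?thesis using li by (simp add: ban_mon fcr_mon op_lin scal_simps mult.commute)
    qed
  qed simp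
  also have "scal ?a ?F = scal (complex_of_real (sqrt (real p))) (parity n ?F)"
  proof -
    have "parity n ?F = scal (sgn_upto (Suc n) ?L) ?F"
      by (auto simp: parity_def scal_def fmon_def fun_eq_iff intro!: sgn_upto_cong)
    then show ?thesis by (simp add: scal_simps sgn_upto_trl[OF l order_refl, symmetric, unfolded One_nat_def] mult.commute)
  qed
  finally show "toF n p (Xvec n p k l) = e00 n p ?F"
    unfolding e00_def mix_def sum_subtractf sum_negf by (simp only: diff_minus_eq_add add_diff_eq)
qed

section \<open>Dimensions at level \<open>p\<close>\<close>

definition wlabels :: "nat \<Rightarrow> (nat \<Rightarrow> nat) \<Rightarrow> ((nat \<Rightarrow> nat) \<times> (nat \<Rightarrow> bool)) set" where
  "wlabels n m = {(k, l) \<in> labels n. \<forall>i\<in>{1..n}. wt k l i = m i}"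

lemma finite_wlabels: "finite (wlabels n m)"
proof (rule finite_subset)
  let ?K = "{k. \<forall>i. (i \<in> {1..n} \<longrightarrow> k i \<in> {..level n m}) \<and> (i \<notin> {1..n} \<longrightarrow> k i = 0)}"
  let ?L = "{l. \<forall>i. (i \<in> {1..n} \<longrightarrow> l i \<in> UNIV) \<and> (i \<notin> {1..n} \<longrightarrow> l i = False)}"
  show "finite (?K \<times> ?L)" by (intro finite_cartesian_product finite_set_of_finite_funs) auto
  show "wlabels n m \<subseteq> ?K \<times> ?L"
  proof clarify
    fix k l assume kl: "(k, l) \<in> wlabels n m"
    have "k i \<le> level n m" if i: "i \<in> {1..n}" for i
    proof -
      have "k i \<le> wt k l i" by (simp add: wt_def)
      also have "\<dots> = m i" using kl i by (simp add: wlabels_def)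
      also have "\<dots> \<le> level n m" unfolding level_def using i by (intro member_le_sum) auto
      finally show ?thesis .
    qed
    then show "k \<in> ?K \<and> l \<in> ?L" using kl by (auto simp: wlabels_def labels_def)
  qed
qed

lemma fmon_wspace: "(k, l) \<in> wlabels n m \<Longrightarrow> fmon k l \<in> wspace n m"
  using fmon_fockn by (auto simp: wspace_def wlabels_def fmon_def)

lemma wspace_expand: "f \<in> wspace n m \<Longrightarrow> f = (\<Sum>(k, l)\<in>wlabels n m. scal (f k l) (fmon k l))"
  by (rule fock_expand[OF finite_wlabels]) (auto simp: wspace_def wlabels_def fockn_def fsupp_def)

lemma zero_wspace: "0 \<in> wspace n m"
  by (simp add: wspace_def)

lemma wspace_add: "f \<in> wspace n m \<Longrightarrow> g \<in> wspace n m \<Longrightarrow> f + g \<in> wspace n m"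
  by (auto simp: wspace_iff_wmul lin_simps[OF lin_wmul] simp del: plus_fun_apply)

context
  fixes n p :: nat
begin

interpretation VV: vectorspace class_ring "Vbar n p" by (rule VV_space)

abbreviation (input) "WS m \<equiv> weight_space n (Vbar n p) (lambda_wt n p m)"

lemma mem_WS: "v \<in> WS m \<longleftrightarrow> v \<in> carrier (Vbar n p) \<and> toF n p v \<in> wspace n m"
  by (simp add: weight_space_eq)

lemma WS_subspace: "VectorSpace.subspace class_ring (WS m) (Vbar n p)"
  using VV_space
  by (auto simp: subspace_iff mem_WS toF_simps wspace_add wspace_scal zero_wspace VV.smult_closed
      simp del: plus_fun_apply) 

lemma toF_memI: "v \<in> carrier (Vbar n p) \<Longrightarrow> U \<subseteq> carrier (Vbar n p) \<Longrightarrow> toF n p v \<in> toF n p ` U \<Longrightarrow> v \<in> U"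
proof -
  assume v: "v \<in> carrier (Vbar n p)" and U: "U \<subseteq> carrier (Vbar n p)" and "toF n p v \<in> toF n p ` U"
  then obtain u where u: "toF n p v = toF n p u" "u \<in> U" by (elim imageE)
  then have "v = u" using v U by (intro toF_inj[where n = n and p = p]) auto
  with u show "v \<in> U" by simp
qed

text \<open>A general \<open>T\<close> lets this serve twice: the identity gives a spanning set of
  the weight space, and \<open>e00\<close> shows that the vectors X span its image under H.\<close>

lemma toF_span:
  assumes A: "A \<subseteq> carrier (Vbar n p)" and T: "lin T"
    and "\<And>k l. (k, l) \<in> wlabels n m \<Longrightarrow> T (fmon k l) \<in> toF n p ` A" and f: "f \<in> wspace n m"
  shows "T f \<in> toF n p ` VV.span A"
proof -
  interpret S: submodule class_ring "VV.span A" "Vbar n p" using A by (rule VV.span_is_submodule)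
  note S = toF_submodule_eq[OF S.subset S.zero_closed S.m_closed S.smult_closed]
  have "T f = (\<Sum>z\<in>wlabels n m. scal (f (fst z) (snd z)) (T (fmon (fst z) (snd z))))"
    by (subst wspace_expand[OF f]) (simp add: lin_simps[OF T] case_prod_unfold)
  also have "\<dots> \<in> toF n p ` VV.span A"
  proof (intro S)
    fix z assume "z \<in> wlabels n m"
    then have "T (fmon (fst z) (snd z)) \<in> toF n p ` A" using assms(3) by simp
    then show "T (fmon (fst z) (snd z)) \<in> toF n p ` VV.span A"
      using image_mono[OF VV.in_own_span[OF A]] by (rule subsetD[rotated])
  qed auto
  finally show ?thesis .
qed

lemma WS_span:
  obtains A where "finite A" "A \<subseteq> WS m" "VV.span A = WS m"
proof
  let ?B = "(\<lambda>(k, l). fmon k l) ` wlabels n m"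
  let ?A = "{v \<in> carrier (Vbar n p). toF n p v \<in> ?B}"
  have inj: "inj_on (toF n p) ?A"
  proof (rule inj_onI)
    fix v w assume "v \<in> ?A" "w \<in> ?A" "toF n p v = toF n p w"
    then show "v = w" by (intro toF_inj[where n = n and p = p]) simp_all
  qed
  have "toF n p ` ?A \<subseteq> ?B" by auto
  then show "finite ?A" using finite_wlabels inj by (meson finite_imageD finite_imageI finite_subset)
  show sub: "?A \<subseteq> WS m" by (auto simp: mem_WS fmon_wspace)
  have "submodule class_ring (WS m) (Vbar n p)" using WS_subspace by (simp add: subspace_def)
  then have "VV.span ?A \<subseteq> WS m" using sub by (intro VV.span_is_subset)
  moreover have "v \<in> VV.span ?A" if "v \<in> WS m" for v
  proof (rule toF_memI)
    have "fmon k l \<in> toF n p ` ?A" if kl: "(k, l) \<in> wlabels n m" for k l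
    proof -
      have "fmon k l \<in> fockn n" using kl fmon_fockn by (auto simp: wlabels_def)
      then obtain w where "w \<in> carrier (Vbar n p)" "toF n p w = fmon k l" by (rule toF_surj)
      then show ?thesis using kl by (intro image_eqI[of _ _ w]) auto
    qed
    then show "toF n p v \<in> toF n p ` VV.span ?A"
      using that toF_span[of ?A "\<lambda>f. f" m "toF n p v"] by (simp add: lin_def mem_WS)
    show "VV.span ?A \<subseteq> carrier (Vbar n p)" by (intro VV.span_is_subset2) auto
  qed (use that in \<open>simp add: mem_WS\<close>)
  ultimately show "VV.span ?A = WS m" by blast
qed

lemma act_add:
  assumes "x \<in> qalg n" "v \<in> carrier (Vbar n p)" "w \<in> carrier (Vbar n p)"
  shows "act (Vbar n p) x (v \<oplus>\<^bsub>Vbar n p\<^esub> w) = act (Vbar n p) x v \<oplus>\<^bsub>Vbar n p\<^esub> act (Vbar n p) x w"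
  by (rule toF_inj[where n = n and p = p]) (use assms in \<open>simp_all add: toF_simps lin_simps[OF lin_qact] del: plus_fun_apply\<close>)

lemma act_smult:
  assumes "x \<in> qalg n" "v \<in> carrier (Vbar n p)"
  shows "act (Vbar n p) x (c \<odot>\<^bsub>Vbar n p\<^esub> v) = c \<odot>\<^bsub>Vbar n p\<^esub> act (Vbar n p) x v"
  by (rule toF_inj[where n = n and p = p]) (use assms in \<open>simp_all add: toF_simps lin_simps[OF lin_qact]\<close>)

context
  assumes p: "p \<ge> 1"
begin

lemma Mp_subspace: "VectorSpace.subspace class_ring (Mp n p) (Vbar n p)"
  using VV_space by (auto simp: subspace_iff Mp_eq[OF p] toF_simps maxsub_lin simp del: plus_fun_apply)

interpretation MQ: quot_space "Vbar n p" "Mp n p"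
  by (rule quot_space.intro[OF Mp_subspace])

lemma Mp_act: "x \<in> qalg n \<Longrightarrow> v \<in> Mp n p \<Longrightarrow> act (Vbar n p) x v \<in> Mp n p"
  by (simp add: Mp_eq[OF p] toF_simps maxsub_qact)

lemma Vp_zero: "\<zero>\<^bsub>Vp n p\<^esub> = Mp n p"
  by (simp add: Vp_def)

lemma proj_zero_iff:
  assumes "v \<in> carrier (Vbar n p)"
  shows "Mp n p +>\<^bsub>Vbar n p\<^esub> v = \<zero>\<^bsub>Vp n p\<^esub> \<longleftrightarrow> v \<in> Mp n p"
proof -
  have "v \<ominus>\<^bsub>Vbar n p\<^esub> \<zero>\<^bsub>Vbar n p\<^esub> = v" using assms by (simp add: a_minus_def)
  with MQ.proj_eq_iff[OF assms VV.M.zero_closed] show ?thesis by (simp add: Vp_zero MQ.proj_zero)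
qed

context
  fixes m
  assumes m: "level n m = p"
begin

abbreviation (input) "HH \<equiv> act (Vbar n p) (qE 0 0 1)"

lemma toF_HH: "v \<in> carrier (Vbar n p) \<Longrightarrow> HH v \<in> carrier (Vbar n p) \<and> toF n p (HH v) = e00 n p (toF n p v)"
  by (simp add: toF_simps qop_def)

lemma Mp_WS_kernel: "Mp n p \<inter> WS m = {v \<in> WS m. HH v = \<zero>\<^bsub>Vbar n p\<^esub>}"
proof -
  have "v \<in> Mp n p \<longleftrightarrow> HH v = \<zero>\<^bsub>Vbar n p\<^esub>" if "v \<in> WS m" for v
  proof -
    have v: "v \<in> carrier (Vbar n p)" "toF n p v \<in> wspace n m" using that by (auto simp: mem_WS)
    have "HH v = \<zero>\<^bsub>Vbar n p\<^esub> \<longleftrightarrow> toF n p (HH v) = toF n p \<zero>\<^bsub>Vbar n p\<^esub>"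
      using toF_inj[of "HH v" n p "\<zero>\<^bsub>Vbar n p\<^esub>"] toF_HH[OF v(1)] by auto
    then show ?thesis
      using wspace_maxsub_eq[OF m v(2)] v(1) toF_HH[OF v(1)] by (simp add: Mp_eq[OF p] toF_simps)
  qed
  then show ?thesis by auto
qed

text \<open>Compared in Fock coordinates, this is the exactness of H at level p.\<close>

lemma Mp_WS_image: "Mp n p \<inter> WS m = HH ` WS m"
proof -
  have "toF n p ` (Mp n p \<inter> WS m) = maxsub n p \<inter> wspace n m"
  proof -
    have "f \<in> toF n p ` (Mp n p \<inter> WS m)" if "f \<in> maxsub n p \<inter> wspace n m" for f
    proof -
      have "f \<in> fockn n" using that by (simp add: maxsub_def)
      then obtain v where "v \<in> carrier (Vbar n p)" "toF n p v = f" by (rule toF_surj)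
      with that show ?thesis by (intro image_eqI[of _ _ v]) (auto simp: Mp_eq[OF p] mem_WS)
    qed
    then show ?thesis by (auto simp: Mp_eq[OF p] mem_WS)
  qed
  moreover have "toF n p ` HH ` WS m = e00 n p ` wspace n m"
  proof -
    have "e00 n p f \<in> toF n p ` HH ` WS m" if "f \<in> wspace n m" for f
    proof -
      have "f \<in> fockn n" using that by (simp add: wspace_def)
      then obtain v where v: "v \<in> carrier (Vbar n p)" "toF n p v = f" by (rule toF_surj)
      with that have "HH v \<in> HH ` WS m" by (auto simp: mem_WS)
      moreover have "e00 n p f = toF n p (HH v)" using v toF_HH by simp
      ultimately show ?thesis by simp
    qed
    then show ?thesis using toF_HH by (auto simp: mem_WS)
  qed
  ultimately have eq: "toF n p ` (Mp n p \<inter> WS m) = toF n p ` HH ` WS m"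
    using maxsub_wspace_image[OF m p] by simp
  have c: "Mp n p \<inter> WS m \<subseteq> carrier (Vbar n p)" "HH ` WS m \<subseteq> carrier (Vbar n p)"
    using toF_HH by (auto simp: mem_WS)
  show ?thesis
  proof (intro equalityI subsetI)
    fix v assume v: "v \<in> Mp n p \<inter> WS m"
    show "v \<in> HH ` WS m"
      by (rule toF_memI[OF subsetD[OF c(1) v] c(2) imageI[OF v, of "toF n p", unfolded eq]])
  next
    fix v assume v: "v \<in> HH ` WS m"
    show "v \<in> Mp n p \<inter> WS m"
      by (rule toF_memI[OF subsetD[OF c(2) v] c(1) imageI[OF v, of "toF n p", folded eq]])
  qed
qed

text \<open>Kernel and image of H on the weight space are the same subspace, so rank-nullity counts
  it twice.\<close>

lemma dim_Mp: "2 * subdim (Vbar n p) (Mp n p \<inter> WS m) = subdim (Vbar n p) (WS m)"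
proof -
  obtain A where A: "finite A" "A \<subseteq> WS m" "VV.span A = WS m" by (rule WS_span)
  have "subdim (Vbar n p) (HH ` WS m) + subdim (Vbar n p) {v \<in> WS m. HH v = \<zero>\<^bsub>Vbar n p\<^esub>} = subdim (Vbar n p) (WS m)"
    by (rule subspace_rank_nullity[OF WS_subspace VV_space A]) (auto simp: mem_WS toF_HH act_add act_smult)
  then show ?thesis unfolding Mp_WS_kernel[symmetric] Mp_WS_image[symmetric] by simp
qed

text \<open>Cosets of weight vectors keep their weight; conversely \<open>wspace_quotient\<close>
  corrects a representative by an element of \<open>Mp n p\<close>.\<close>

lemma weight_space_Vp:
  "weight_space n (Vp n p) (lambda_wt n p m) = (\<lambda>v. Mp n p +>\<^bsub>Vbar n p\<^esub> v) ` WS m"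
proof -
  have act: "act (Vp n p) x (MQ.proj v) = MQ.proj (act (Vbar n p) x v)"
    if "x \<in> qalg n" "v \<in> carrier (Vbar n p)" for x v
    unfolding Vp_def using that by (intro MQ.proj_act) (auto simp: toF_simps Mp_act act_add)
  have smult: "c \<odot>\<^bsub>Vp n p\<^esub> MQ.proj v = MQ.proj (c \<odot>\<^bsub>Vbar n p\<^esub> v)" if "v \<in> carrier (Vbar n p)" for c v
    unfolding Vp_def using that by (rule MQ.proj_smult)
  have carr: "carrier (Vp n p) = MQ.proj ` carrier (Vbar n p)" by (simp add: Vp_def)
  have key: "(\<forall>i\<le>n. act (Vp n p) (qE i i 0) (MQ.proj v) = lambda_wt n p m i \<odot>\<^bsub>Vp n p\<^esub> MQ.proj v)
      \<longleftrightarrow> (\<forall>i\<le>n. qop n p i i 0 (toF n p v) - scal (lambda_wt n p m i) (toF n p v) \<in> maxsub n p)"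
    if v: "v \<in> carrier (Vbar n p)" for v
  proof -
    have "act (Vp n p) (qE i i 0) (MQ.proj v) = lambda_wt n p m i \<odot>\<^bsub>Vp n p\<^esub> MQ.proj v
      \<longleftrightarrow> qop n p i i 0 (toF n p v) - scal (lambda_wt n p m i) (toF n p v) \<in> maxsub n p" if i: "i \<le> n" for i
    proof -
      have 1: "act (Vbar n p) (qE i i 0) v \<in> carrier (Vbar n p)" using v i by (simp add: toF_simps)
      have 2: "lambda_wt n p m i \<odot>\<^bsub>Vbar n p\<^esub> v \<in> carrier (Vbar n p)" using v by simp
      have "act (Vp n p) (qE i i 0) (MQ.proj v) = lambda_wt n p m i \<odot>\<^bsub>Vp n p\<^esub> MQ.proj v
        \<longleftrightarrow> act (Vbar n p) (qE i i 0) v \<ominus>\<^bsub>Vbar n p\<^esub> lambda_wt n p m i \<odot>\<^bsub>Vbar n p\<^esub> v \<in> Mp n p"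
        using v i MQ.proj_eq_iff[OF 1 2] by (simp add: act smult)
      also have "\<dots> \<longleftrightarrow> toF n p (act (Vbar n p) (qE i i 0) v) - toF n p (lambda_wt n p m i \<odot>\<^bsub>Vbar n p\<^esub> v) \<in> maxsub n p"
        using VV.M.minus_closed[OF 1 2] by (simp add: Mp_eq[OF p] toF_group(2)[OF 1 2])
      finally show ?thesis using v i by (simp add: toF_simps)
    qed
    then show ?thesis by blast
  qed
  show ?thesis
  proof (intro equalityI subsetI)
    fix A assume A: "A \<in> weight_space n (Vp n p) (lambda_wt n p m)"
    then obtain v where v: "v \<in> carrier (Vbar n p)" "A = MQ.proj v" by (auto simp: weight_space_def carr)
    then have "\<forall>i\<le>n. qop n p i i 0 (toF n p v) - scal (lambda_wt n p m i) (toF n p v) \<in> maxsub n p"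
      using A key[OF v(1)] by (simp add: weight_space_def)
    then obtain g where g: "g \<in> wspace n m" "toF n p v - g \<in> maxsub n p"
      using wspace_quotient[OF toF_simps(1)[OF v(1)] m] by blast
    have "g \<in> fockn n" using g by (simp add: wspace_def)
    then obtain w where w: "w \<in> carrier (Vbar n p)" "toF n p w = g" by (rule toF_surj)
    have "v \<ominus>\<^bsub>Vbar n p\<^esub> w \<in> Mp n p"
      using g v w VV.M.minus_closed[of v w] by (simp add: Mp_eq[OF p] toF_group(2))
    then have "A = MQ.proj w" using MQ.proj_eq_iff[of v w] v w by simp
    then show "A \<in> MQ.proj ` WS m" using w g by (auto simp: mem_WS)
  next
    fix A assume "A \<in> MQ.proj ` WS m"
    then obtain v where v: "v \<in> WS m" "A = MQ.proj v" by auto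
    then have vc: "v \<in> carrier (Vbar n p)" by (simp add: mem_WS)
    have "\<forall>i\<le>n. qop n p i i 0 (toF n p v) = scal (lambda_wt n p m i) (toF n p v)"
      using v wspace_iff[of "toF n p v" n m p] by (simp add: mem_WS)
    then show "A \<in> weight_space n (Vp n p) (lambda_wt n p m)"
      using key[OF vc] v vc by (simp add: weight_space_def carr maxsub_lin)
  qed
qed

text \<open>Rank-nullity for the projection restricted to the weight space, whose kernel is the half
  found in \<open>dim_Mp\<close>.\<close>

lemma dim_Vp: "2 * subdim (Vp n p) (weight_space n (Vp n p) (lambda_wt n p m)) = subdim (Vbar n p) (WS m)"
proof -
  obtain A where A: "finite A" "A \<subseteq> WS m" "VV.span A = WS m" by (rule WS_span)
  have Vp: "vectorspace class_ring (Vp n p)" unfolding Vp_def by (rule MQ.quot_vectorspace)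
  have "subdim (Vp n p) (MQ.proj ` WS m) + subdim (Vbar n p) {v \<in> WS m. MQ.proj v = \<zero>\<^bsub>Vp n p\<^esub>}
      = subdim (Vbar n p) (WS m)"
    by (rule subspace_rank_nullity[OF WS_subspace Vp A])
      (auto simp: mem_WS Vp_def MQ.proj_add MQ.proj_smult simp del: MQ.quot_sel(4))
  moreover have "{v \<in> WS m. MQ.proj v = \<zero>\<^bsub>Vp n p\<^esub>} = Mp n p \<inter> WS m"
  proof -
    have "{v \<in> WS m. MQ.proj v = \<zero>\<^bsub>Vp n p\<^esub>} = {v \<in> WS m. v \<in> Mp n p}"
      using proj_zero_iff by (intro Collect_cong) (simp add: mem_WS cong: conj_cong)
    then show ?thesis by blast
  qed
  ultimately show ?thesis using dim_Mp unfolding weight_space_Vp by simp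
qed

lemma span_Xvec:
  "VV.span {Xvec n p k l | k l. \<forall>i\<in>{1..n}. l i \<in> {0, 1} \<and> k i + l i = m i} = Mp n p \<inter> WS m"
proof -
  let ?X = "{Xvec n p k l | k l. \<forall>i\<in>{1..n}. l i \<in> {0, 1} \<and> k i + l i = m i}"
  have XM: "?X \<subseteq> Mp n p \<inter> WS m"
  proof clarify
    fix k l assume kl: "\<forall>i\<in>{1..n}. l i \<in> {0, 1} \<and> k i + l i = m i"
    then have l: "\<forall>i\<in>{1..n}. l i \<in> {0, 1}" by blast
    have "(trk n k 1, trl n l 1) \<in> wlabels n m"
      using kl by (fastforce simp: wlabels_def labels_def wt_def trk_def trl_def)
    then have "e00 n p (fmon (trk n k 1) (trl n l 1)) \<in> maxsub n p \<inter> wspace n m"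
      unfolding maxsub_wspace_image[OF m p] by (intro imageI fmon_wspace)
    then show "Xvec n p k l \<in> Mp n p \<inter> WS m"
      using Xvec_e00[OF l, of p k] by (simp add: Mp_eq[OF p] mem_WS)
  qed
  have MW: "submodule class_ring (Mp n p \<inter> WS m) (Vbar n p)"
    using Mp_subspace WS_subspace[of m] by (auto simp: subspace_iff vectorspace_def submodule_def)
  have Xc: "?X \<subseteq> carrier (Vbar n p)"
  proof (rule subset_trans[OF XM])
    show "Mp n p \<inter> WS m \<subseteq> carrier (Vbar n p)" by (auto simp: mem_WS)
  qed
  have "v \<in> VV.span ?X" if "v \<in> Mp n p \<inter> WS m" for v
  proof (rule toF_memI)
    show "v \<in> carrier (Vbar n p)" using that by (simp add: mem_WS)
    show "VV.span ?X \<subseteq> carrier (Vbar n p)" using Xc by (rule VV.span_is_subset2)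
    \<comment> \<open>By exactness \<open>v\<close> is H of some weight vector; expanding that
      vector in monomials expresses \<open>v\<close> through the vectors X.\<close>
    from that have "v \<in> HH ` WS m" by (simp only: Mp_WS_image)
    then obtain w where w: "v = HH w" "w \<in> WS m" by (rule imageE)
    have "e00 n p (fmon k l) \<in> toF n p ` ?X" if kl: "(k, l) \<in> wlabels n m" for k l
    proof -
      define l' :: "nat \<Rightarrow> nat" where "l' = (\<lambda>i. of_bool (l i))"
      have l': "\<forall>i\<in>{1..n}. l' i \<in> {0, 1}" by (simp add: l'_def)
      have X: "Xvec n p k l' \<in> ?X" using kl l' by (fastforce simp: wlabels_def wt_def l'_def)
      have "trk n k 1 = k" "trl n l' 1 = l"
        using kl by (auto simp: wlabels_def labels_def trk_def trl_def l'_def fun_eq_iff)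
      then have "e00 n p (fmon k l) = toF n p (Xvec n p k l')" using Xvec_e00(2)[OF l', of p k] by simp
      then show ?thesis using X by (rule image_eqI)
    qed
    then have "e00 n p (toF n p w) \<in> toF n p ` VV.span ?X"
      using w by (intro toF_span[OF Xc lin_e00]) (auto simp: mem_WS)
    then show "toF n p v \<in> toF n p ` VV.span ?X" using w toF_HH by (simp add: mem_WS)
  qed
  moreover have "VV.span ?X \<subseteq> Mp n p \<inter> WS m" using XM MW by (rule VV.span_is_subset)
  ultimately show ?thesis by blast
qed

end

end

end

theorem proposition4:
  fixes n p :: nat
  assumes "n \<ge> 1" and "p \<ge> 1"
  shows
    "(\<forall>m v. weight_vector n (Vbar n p) (lambda_wt n p m) v \<and> level n m > p \<longrightarrow> v \<in> Mp n p)
   \<and> (\<forall>m v. weight_vector n (Vbar n p) (lambda_wt n p m) v \<and> level n m < p \<longrightarrow>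
        v \<notin> Mp n p \<and> Mp n p +>\<^bsub>Vbar n p\<^esub> v \<noteq> \<zero>\<^bsub>Vp n p\<^esub>)
   \<and> (\<forall>m d. level n m = p \<and> d = subdim (Vbar n p) (weight_space n (Vbar n p) (lambda_wt n p m)) \<longrightarrow>
        real (subdim (Vbar n p) (Mp n p \<inter> weight_space n (Vbar n p) (lambda_wt n p m))) = real d / 2
      \<and> real (subdim (Vp n p) (weight_space n (Vp n p) (lambda_wt n p m))) = real d / 2
      \<and> LinearCombinations.module.span class_ring (Vbar n p)
          {Xvec n p k l | k l. \<forall>i\<in>{1..n}. l i \<in> {0, 1} \<and> k i + l i = m i}
        = Mp n p \<inter> weight_space n (Vbar n p) (lambda_wt n p m))"
proof (intro conjI allI impI; (elim conjE)?)
  fix m v assume v: "weight_vector n (Vbar n p) (lambda_wt n p m) v" and m: "level n m > p"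
  then show "v \<in> Mp n p"
    using wspace_maxsub_gt by (auto simp: weight_vector_def mem_WS Mp_eq[OF assms(2)])
next
  fix m v assume v: "weight_vector n (Vbar n p) (lambda_wt n p m) v" and m: "level n m < p"
  then have vw: "v \<in> carrier (Vbar n p)" "toF n p v \<in> wspace n m" "v \<noteq> \<zero>\<^bsub>Vbar n p\<^esub>"
    by (auto simp: weight_vector_def mem_WS)
  interpret VV: vectorspace class_ring "Vbar n p" by (rule VV_space)
  have "toF n p v \<noteq> 0" using toF_inj[OF vw(1) VV.M.zero_closed] vw(3) toF_simps(4) by metis
  then show "v \<notin> Mp n p" using wspace_maxsub_lt[OF vw(2) m] by (auto simp: Mp_eq[OF assms(2)])
  then show "Mp n p +>\<^bsub>Vbar n p\<^esub> v \<noteq> \<zero>\<^bsub>Vp n p\<^esub>" using proj_zero_iff[OF assms(2) vw(1)] by simp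
next
  fix m d assume m: "level n m = p" and d: "d = subdim (Vbar n p) (weight_space n (Vbar n p) (lambda_wt n p m))"
  show "real (subdim (Vbar n p) (Mp n p \<inter> weight_space n (Vbar n p) (lambda_wt n p m))) = real d / 2"
    using dim_Mp[OF assms(2) m] d by simp
  show "real (subdim (Vp n p) (weight_space n (Vp n p) (lambda_wt n p m))) = real d / 2"
    using dim_Vp[OF assms(2) m] d by simp
  show "LinearCombinations.module.span class_ring (Vbar n p)
          {Xvec n p k l | k l. \<forall>i\<in>{1..n}. l i \<in> {0, 1} \<and> k i + l i = m i}
        = Mp n p \<inter> weight_space n (Vbar n p) (lambda_wt n p m)"
    by (rule span_Xvec[OF assms(2) m])
qed

end
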